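(* Let $\mathcal H=\bigoplus_{m\ge0}\mathcal H_m$ be a graded connected Hopf algebra over $\mathbb R$ with each $\mathcal H_m$ finite-dimensional, and $\mathcal B=\bigsqcup_m\mathcal B_m$ a basis of $\mathcal H$. Fix $n$ and let $P$ be a probability distribution on weak-compositions of $n$ such that $\mathcal B$ is a state space basis for $P$ and $P(D)>0$ for some weak-composition $D$ with at least two non-zero parts. For each multiset $\{c_1,\dots,c_n\}$ of elements of $\mathcal B_1$ define $\pi_{c_1,\dots,c_n}:\mathcal B_n\to\mathbb R$ by $$\pi_{c_1,\dots,c_n}(x):=\frac{\eta(x)}{(n!)^2}\sum_{\sigma\in\mathfrak S_n}\big(\text{coefficient of } x \text{ in } c_{\sigma(1)}\cdots c_{\sigma(n)}\big).$$ If $\pi_{c_1,\dots,c_n}(x)\ge0$ for all $x\in\mathcal B_n$, then $\pi_{c_1,\dots,c_n}$ is a stationary distribution of the Markov chain on $\mathcal B_n$ driven by $m\Delta_P$; and every stationary distribution of this chain can be written uniquely as a linear combination of the functions $\pi_{c_1,\dots,c_n}$.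
   Context: $\mathcal H_0=\mathbb R1$; $m$ denotes multiplication and $\Delta$ the coproduct; $\Delta^{[l]}=(\Delta\otimes\mathrm{id}^{\otimes(l-2)})\circ\cdots\circ\Delta$. For a weak-composition $D=(d_1,\dots,d_{l(D)})$ of $n$ (non-negative integers summing to $n$), $\Delta_D$ is $\Delta^{[l(D)]}$ followed by projection onto $\mathcal H_{d_1}\otimes\cdots\otimes\mathcal H_{d_{l(D)}}$, and $m\Delta_P:=\sum_D\frac{P(D)}{\binom nD}m\circ\Delta_D$, $\binom nD=n!/\prod d_i!$. $\mathcal B$ consists of homogeneous elements, $\mathcal B_m$ a basis of $\mathcal H_m$, $\mathcal B_0=\{1\}$. $\eta:\mathcal H\to\mathbb R$ is linear, $\eta(x)$ = sum of the coefficients of $\Delta_{(1,\dots,1)}(x)$ in the basis $\{c_1\otimes\cdots\otimes c_{\deg x}:c_i\in\mathcal B_1\}$. $\mathcal B$ is a state space basis for $D$ if all product structure constants of elements of $\mathcal B_{d_1},\dots,\mathcal B_{d_{l(D)}}$ (in $\mathcal B_n$) are $\ge0$, all coefficients of $\Delta_D(x)$, $x\in\mathcal B_n$, in the tensor basis are $\ge0$, and $\eta(x)>0$ for all $x\in\mathcal B$; it is one for $P$ if it is one for all $D$ with $P(D)>0$. The Markov chain on $\mathcal B_n$ driven by $m\Delta_P$ has transition matrix $\hat K(x,y)=\frac{\eta(y)}{\eta(x)}\cdot(\text{coefficient of }y\text{ in }m\Delta_P(x))$. A stationary distribution is a probability distribution $\pi$ with $\sum_x\pi(x)\hat K(x,y)=\pi(y)$.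 *)

theory Defs
  imports
    "HOL-Probability.Probability"
    "HOL-Combinatorics.Permutations"
    "HOL-Library.Poly_Mapping"
begin

text \<open>
  Tensor powers. The type \<open>'a tensor\<close> is the direct sum of all tensor powers \<open>V\<^sup>\<otimes>\<^sup>l\<close> of the real vector
  space \<open>V = UNIV :: 'a set\<close>: the free vector space on lists over \<open>V\<close> modulo multilinearity.
  A pure tensor \<open>x\<^sub>1 \<otimes> \<dots> \<otimes> x\<^sub>l\<close> is the class of the list \<open>[x\<^sub>1, \<dots>, x\<^sub>l]\<close>, the empty list giving the
  unit of \<open>V\<^sup>\<otimes>\<^sup>0 = \<real>\<close>. This makes the number of tensor factors an ordinary natural number.
\<close>

instantiation poly_mapping :: (type, real_vector) real_vector
begin

lift_definition scaleR_poly_mapping :: "real \<Rightarrow> ('a \<Rightarrow>\<^sub>0 'b) \<Rightarrow> ('a \<Rightarrow>\<^sub>0 'b)"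
  is "\<lambda>r f k. r *\<^sub>R f k"
  by (erule finite_subset[rotated]) auto

instance
  by (standard; transfer) (auto simp: fun_eq_iff scaleR_add_right scaleR_add_left)

end

definition tensor_relations :: "('a::real_vector list \<Rightarrow>\<^sub>0 real) set" where
  "tensor_relations =
     {Poly_Mapping.single (xs @ (u + v) # ys) 1 - Poly_Mapping.single (xs @ u # ys) 1
        - Poly_Mapping.single (xs @ v # ys) 1 | xs u v ys. True} \<union>
     {Poly_Mapping.single (xs @ (r *\<^sub>R u) # ys) 1 - r *\<^sub>R Poly_Mapping.single (xs @ u # ys) 1
        | xs r u ys. True}"

quotient_type (overloaded) 'a tensor = "'a::real_vector list \<Rightarrow>\<^sub>0 real" /
  "\<lambda>p q. p - q \<in> span tensor_relations"
proof (rule equivpI)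
  show "reflp (\<lambda>p q. p - q \<in> span (tensor_relations :: ('a list \<Rightarrow>\<^sub>0 real) set))"
    by (rule reflpI) (simp add: span_zero)
  show "symp (\<lambda>p q. p - q \<in> span (tensor_relations :: ('a list \<Rightarrow>\<^sub>0 real) set))"
    by (rule sympI) (drule span_neg, simp)
  show "transp (\<lambda>p q. p - q \<in> span (tensor_relations :: ('a list \<Rightarrow>\<^sub>0 real) set))"
    by (rule transpI) (drule (1) span_add, simp)
qed

instantiation tensor :: (real_vector) real_vector
begin

lift_definition zero_tensor :: "'a tensor" is 0 .

lift_definition plus_tensor :: "'a tensor \<Rightarrow> 'a tensor \<Rightarrow> 'a tensor" is "(+)"
  by (simp add: add_diff_add span_add)

lift_definition uminus_tensor :: "'a tensor \<Rightarrow> 'a tensor" is uminus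
  by (simp only: minus_diff_minus span_neg)

lift_definition minus_tensor :: "'a tensor \<Rightarrow> 'a tensor \<Rightarrow> 'a tensor" is "(-)"
proof -
  fix p p' q q' :: "'a list \<Rightarrow>\<^sub>0 real"
  assume *: "p - p' \<in> span tensor_relations" "q - q' \<in> span tensor_relations"
  have "p - q - (p' - q') = (p - p') - (q - q')" by simp
  with * show "p - q - (p' - q') \<in> span tensor_relations" by (simp only: span_diff)
qed

lift_definition scaleR_tensor :: "real \<Rightarrow> 'a tensor \<Rightarrow> 'a tensor" is scaleR
  by (simp only: scaleR_diff_right[symmetric] span_scale)

instance
  by (standard; transfer) (simp_all add: span_zero algebra_simps)

end

lift_definition tens :: "'a::real_vector list \<Rightarrow> 'a tensor" is "\<lambda>xs. Poly_Mapping.single xs 1" .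

definition multilinear :: "('a::real_vector list \<Rightarrow> 'b::real_vector) \<Rightarrow> bool" where
  "multilinear f \<longleftrightarrow> (\<forall>xs ys. linear (\<lambda>x. f (xs @ x # ys)))"

definition free_ext :: "('a \<Rightarrow> 'b::real_vector) \<Rightarrow> ('a \<Rightarrow>\<^sub>0 real) \<Rightarrow> 'b" where
  "free_ext f p = (\<Sum>k\<in>Poly_Mapping.keys p. Poly_Mapping.lookup p k *\<^sub>R f k)"

lemma free_ext_superset:
  assumes "finite K" "Poly_Mapping.keys p \<subseteq> K"
  shows "free_ext f p = (\<Sum>k\<in>K. Poly_Mapping.lookup p k *\<^sub>R f k)"
  unfolding free_ext_def
  by (rule sum.mono_neutral_left) (use assms in \<open>auto simp: in_keys_iff\<close>)

lemma linear_free_ext: "linear (free_ext f)"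
proof (rule linearI)
  fix p q :: "'a \<Rightarrow>\<^sub>0 real"
  let ?K = "Poly_Mapping.keys p \<union> Poly_Mapping.keys q"
  have "free_ext f (p + q) = (\<Sum>k\<in>?K. Poly_Mapping.lookup (p + q) k *\<^sub>R f k)"
    by (rule free_ext_superset) (simp_all add: Poly_Mapping.keys_add)
  also have "\<dots> = (\<Sum>k\<in>?K. Poly_Mapping.lookup p k *\<^sub>R f k) + (\<Sum>k\<in>?K. Poly_Mapping.lookup q k *\<^sub>R f k)"
    by (simp add: lookup_add scaleR_add_left sum.distrib)
  also have "\<dots> = free_ext f p + free_ext f q"
    by (simp add: free_ext_superset[of ?K])
  finally show "free_ext f (p + q) = free_ext f p + free_ext f q" .
next
  fix r :: real and p :: "'a \<Rightarrow>\<^sub>0 real"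
  have "free_ext f (r *\<^sub>R p) = (\<Sum>k\<in>Poly_Mapping.keys p. Poly_Mapping.lookup (r *\<^sub>R p) k *\<^sub>R f k)"
    by (rule free_ext_superset) (auto simp: in_keys_iff scaleR_poly_mapping.rep_eq)
  then show "free_ext f (r *\<^sub>R p) = r *\<^sub>R free_ext f p"
    by (simp add: free_ext_def scaleR_poly_mapping.rep_eq scaleR_sum_right)
qed

lemma free_ext_single: "free_ext f (Poly_Mapping.single k 1) = f k"
  by (simp add: free_ext_def)

lemma free_ext_relations:
  assumes f: "multilinear f" and p: "p \<in> span tensor_relations"
  shows "free_ext f p = 0"
  using p
proof (induction rule: span_induct_alt)
  case base
  show ?case by (simp add: free_ext_def)
next
  case (step c x y)
  have lin: "linear (\<lambda>u. f (xs @ u # ys))" for xs ys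
    using f by (simp add: multilinear_def)
  have "free_ext f x = 0"
    using step(1) unfolding tensor_relations_def
    by (auto simp: linear_diff[OF linear_free_ext] linear_cmul[OF linear_free_ext]
        free_ext_single linear_add[OF lin] linear_cmul[OF lin])
  with step(2) show ?case
    by (simp add: linear_add[OF linear_free_ext] linear_cmul[OF linear_free_ext])
qed

text \<open>The linear map on tensors induced by a map that is multilinear on lists of each length; the
  value \<open>0\<close> for other maps is a dummy.\<close>

lift_definition tlift :: "('a::real_vector list \<Rightarrow> 'b::real_vector) \<Rightarrow> 'a tensor \<Rightarrow> 'b"
  is "\<lambda>f p. if multilinear f then free_ext f p else 0"
proof -
  fix f :: "'a list \<Rightarrow> 'b" and p q :: "'a list \<Rightarrow>\<^sub>0 real"
  assume "p - q \<in> span tensor_relations"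
  then have "free_ext f p - free_ext f q = 0" if "multilinear f"
    using free_ext_relations[OF that] by (simp only: linear_diff[OF linear_free_ext, symmetric])
  then show "(if multilinear f then free_ext f p else 0) = (if multilinear f then free_ext f q else 0)"
    by simp
qed

lemma tlift_tens: "multilinear f \<Longrightarrow> tlift f (tens xs) = f xs"
  by transfer (simp add: free_ext_single)

lemma linear_tlift: "linear (tlift f)"
  by (rule linearI; transfer)
    (auto simp: linear_add[OF linear_free_ext] linear_cmul[OF linear_free_ext])

lemma multilinear_tens: "multilinear tens"
  unfolding multilinear_def
proof (intro allI linearI; transfer)
  fix xs ys :: "'a list" and u v :: 'a and r :: real
  show "Poly_Mapping.single (xs @ (u + v) # ys) 1
      - (Poly_Mapping.single (xs @ u # ys) 1 + Poly_Mapping.single (xs @ v # ys) 1)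
      \<in> span (tensor_relations :: ('a list \<Rightarrow>\<^sub>0 real) set)"
    unfolding tensor_relations_def diff_diff_eq[symmetric] by (intro span_base UnI1) blast
  show "Poly_Mapping.single (xs @ (r *\<^sub>R u) # ys) 1 - r *\<^sub>R Poly_Mapping.single (xs @ u # ys) 1
      \<in> span (tensor_relations :: ('a list \<Rightarrow>\<^sub>0 real) set)"
    unfolding tensor_relations_def by (intro span_base UnI2) blast
qed

abbreviation tens1 :: "'a::real_vector \<Rightarrow> 'a tensor" where
  "tens1 x \<equiv> tens [x]"

definition tconc :: "'a::real_vector tensor \<Rightarrow> 'a tensor \<Rightarrow> 'a tensor" where
  "tconc s t = tlift (\<lambda>xs. tlift (\<lambda>ys. tens (xs @ ys)) t) s"

lemma multilinear_linear: "multilinear f \<Longrightarrow> linear (\<lambda>x. f (xs @ x # ys))"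
  by (simp add: multilinear_def)

lemma multilinear_tens_append: "multilinear (\<lambda>ys. tens (xs @ ys))"
  using multilinear_linear[OF multilinear_tens, of "xs @ _"] by (simp add: multilinear_def)

lemma tlift_linear_param:
  assumes "\<And>xs. linear (\<lambda>x. f x xs)" and "\<And>x. multilinear (f x)"
  shows "linear (\<lambda>x. tlift (f x) t)"
proof -
  have *: "tlift (f x) t = free_ext (f x) (rep_tensor t)" for x
    using assms(2) by (simp add: tlift_def)
  have "linear (\<lambda>x. \<Sum>k\<in>K. c k *\<^sub>R f x k)" for K and c :: "_ \<Rightarrow> real"
    by (intro linear_compose_sum ballI linear_compose_scale_right assms(1))
  then show ?thesis unfolding * free_ext_def .
qed

lemma multilinear_tconc: "multilinear (\<lambda>xs. tlift (\<lambda>ys. tens (xs @ ys)) t)"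
  unfolding multilinear_def
  by (intro allI tlift_linear_param multilinear_tens_append)
    (use multilinear_linear[OF multilinear_tens] in simp)

lemma linear_tconc_left: "linear (\<lambda>s. tconc s t)"
  unfolding tconc_def by (rule linear_tlift)

lemma linear_tconc_right: "linear (tconc s)"
  unfolding tconc_def by (intro tlift_linear_param linear_tlift multilinear_tconc)

lemma tconc_tens: "tconc (tens xs) (tens ys) = tens (xs @ ys)"
  unfolding tconc_def
  by (rule trans[OF tlift_tens[OF multilinear_tconc] tlift_tens[OF multilinear_tens_append]])

text \<open>\<open>tmap [f\<^sub>1, \<dots>, f\<^sub>l]\<close> is \<open>f\<^sub>1 \<otimes> \<dots> \<otimes> f\<^sub>l\<close> on \<open>V\<^sup>\<otimes>\<^sup>l\<close>, each linear \<open>f\<^sub>i\<close> mapping \<open>V\<close> to some tensor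
  power of \<open>V\<close>; the identity of \<open>V\<close> appears as \<^const>\<open>tens1\<close>.\<close>

definition tmap :: "('a::real_vector \<Rightarrow> 'a tensor) list \<Rightarrow> 'a tensor \<Rightarrow> 'a tensor" where
  "tmap fs = tlift (\<lambda>xs. if length xs = length fs
                         then foldr tconc (map2 (\<lambda>f x. f x) fs xs) (tens []) else 0)"

lemma multilinear_tmap:
  assumes "\<And>f. f \<in> set fs \<Longrightarrow> linear f"
  shows "multilinear (\<lambda>xs. if length xs = length fs
                         then foldr tconc (map2 (\<lambda>f x. f x) fs xs) (tens []) else 0)"
  unfolding multilinear_def
proof (intro allI)
  fix xs ys :: "'a list"
  show "linear (\<lambda>x. if length (xs @ x # ys) = length fs
          then foldr tconc (map2 (\<lambda>f x. f x) fs (xs @ x # ys)) (tens []) else 0)"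
    using assms
  proof (induction xs arbitrary: fs)
    case Nil
    show ?case
    proof (cases fs)
      case (Cons f gs)
      then have "linear f" using Nil by simp
      from linear_compose[OF this linear_tconc_left] show ?thesis
        unfolding Cons by (cases "length ys = length gs") (simp_all add: o_def linear_zero)
    qed (simp add: linear_zero)
  next
    case (Cons z xs)
    show ?case
    proof (cases fs)
      case fs: (Cons f gs)
      show ?thesis
      proof (cases "length (xs @ undefined # ys) = length gs")
        case True
        have "linear (\<lambda>x. if length (xs @ x # ys) = length gs
          then foldr tconc (map2 (\<lambda>f x. f x) gs (xs @ x # ys)) (tens []) else 0)"
          by (rule Cons.IH) (use Cons.prems fs in auto)
        then have "linear (\<lambda>x. foldr tconc (map2 (\<lambda>f x. f x) gs (xs @ x # ys)) (tens []))"
          using True by simp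
        from linear_compose[OF this linear_tconc_right] show ?thesis
          using True fs by (simp add: o_def)
      qed (use fs in \<open>simp add: linear_zero\<close>)
    qed (simp add: linear_zero)
  qed
qed

lemma tmap_tens:
  assumes "\<And>f. f \<in> set fs \<Longrightarrow> linear f" "length xs = length fs"
  shows "tmap fs (tens xs) = foldr tconc (map2 (\<lambda>f x. f x) fs xs) (tens [])"
  unfolding tmap_def using assms by (simp add: tlift_tens[OF multilinear_tmap])

definition tprod :: "'a::real_algebra_1 tensor \<Rightarrow> 'a tensor \<Rightarrow> 'a tensor" where
  "tprod s t = tlift (\<lambda>xs. tlift (\<lambda>ys. if length xs = length ys
                                       then tens (map2 (*) xs ys) else 0) t) s"

lemma linear_tens_map2:
  fixes xs ys :: "'a::real_algebra_1 list"
  shows "linear (\<lambda>x. if length (xs @ x # ys) = length zs then tens (map2 (*) (xs @ x # ys) zs) else 0)"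
    and "linear (\<lambda>x. if length zs = length (xs @ x # ys) then tens (map2 (*) zs (xs @ x # ys)) else 0)"
proof -
  have "linear (\<lambda>x. if length (xs @ x # ys) = length zs then tens (map2 (*) (xs @ x # ys) zs) else 0)
     \<and> linear (\<lambda>x. if length zs = length (xs @ x # ys) then tens (map2 (*) zs (xs @ x # ys)) else 0)"
  proof (cases "length zs = length xs + Suc (length ys)")
    case True
    define us z vs where "us = take (length xs) zs" and "z = zs ! length xs"
      and "vs = drop (Suc (length xs)) zs"
    have zs: "zs = us @ z # vs" "length us = length xs"
      using True by (auto simp: us_def z_def vs_def id_take_nth_drop)
    have "linear (\<lambda>x. x * z)" "linear (\<lambda>x. z * x)"
      by (auto intro!: linearI simp: algebra_simps)
    from this[THEN linear_compose, OF multilinear_linear[OF multilinear_tens]]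
    show ?thesis using zs True by (simp add: o_def)
  qed (simp add: linear_zero)
  then show "linear (\<lambda>x. if length (xs @ x # ys) = length zs then tens (map2 (*) (xs @ x # ys) zs) else 0)"
    and "linear (\<lambda>x. if length zs = length (xs @ x # ys) then tens (map2 (*) zs (xs @ x # ys)) else 0)"
    by blast+
qed

lemma tprod_tens:
  fixes xs ys :: "'a::real_algebra_1 list"
  assumes "length xs = length ys"
  shows "tprod (tens xs) (tens ys) = tens (map2 (*) xs ys)"
proof -
  have inner: "multilinear (\<lambda>ys. if length xs = length ys then tens (map2 (*) xs ys) else 0)"
    for xs :: "'a list"
    unfolding multilinear_def using linear_tens_map2(2) by blast
  have "multilinear (\<lambda>xs. tlift (\<lambda>ys. if length xs = length ys then tens (map2 (*) xs ys) else 0) t)"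
    for t :: "'a tensor"
    unfolding multilinear_def
    by (intro allI tlift_linear_param inner linear_tens_map2(1))
  from trans[OF tlift_tens[OF this] tlift_tens[OF inner]] show ?thesis
    unfolding tprod_def by (simp only: assms refl if_True)
qed

definition tmult :: "'a::real_algebra_1 tensor \<Rightarrow> 'a" where
  "tmult = tlift prod_list"

lemma tmult_tens: "tmult (tens xs) = prod_list xs"
  unfolding tmult_def
  by (rule tlift_tens)
    (auto simp: multilinear_def distrib_left distrib_right mult_scaleR_left mult_scaleR_right intro!: linearI)

locale hopf_algebra =
  fixes \<Delta> :: "'a::real_algebra_1 \<Rightarrow> 'a tensor"
    and \<epsilon> :: "'a \<Rightarrow> real"
    and S :: "'a \<Rightarrow> 'a"
  assumes linear_coproduct: "linear \<Delta>"
    and coproduct_in: "\<Delta> x \<in> span {tens [y, z] | y z. True}"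
    and coassoc: "tmap [\<Delta>, tens1] (\<Delta> x) = tmap [tens1, \<Delta>] (\<Delta> x)"
    and linear_counit: "linear \<epsilon>"
    and counit_left: "tmap [\<lambda>y. \<epsilon> y *\<^sub>R tens [], tens1] (\<Delta> x) = tens1 x"
    and counit_right: "tmap [tens1, \<lambda>y. \<epsilon> y *\<^sub>R tens []] (\<Delta> x) = tens1 x"
    and coproduct_mult: "\<Delta> (x * y) = tprod (\<Delta> x) (\<Delta> y)"
    and coproduct_one: "\<Delta> 1 = tens [1, 1]"
    and counit_mult: "\<epsilon> (x * y) = \<epsilon> x * \<epsilon> y"
    and counit_one: "\<epsilon> 1 = 1"
    and linear_antipode: "linear S"
    and antipode_left: "tmult (tmap [\<lambda>y. tens1 (S y), tens1] (\<Delta> x)) = \<epsilon> x *\<^sub>R 1"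
    and antipode_right: "tmult (tmap [tens1, \<lambda>y. tens1 (S y)] (\<Delta> x)) = \<epsilon> x *\<^sub>R 1"

definition homogeneous_decomp :: "(nat \<Rightarrow> 'a::real_vector set) \<Rightarrow> 'a \<Rightarrow> (nat \<Rightarrow> 'a) \<Rightarrow> bool" where
  "homogeneous_decomp H x f \<longleftrightarrow>
     (\<forall>m. f m \<in> H m) \<and> finite {m. f m \<noteq> 0} \<and> x = (\<Sum>m | f m \<noteq> 0. f m)"

definition hcomp :: "(nat \<Rightarrow> 'a::real_vector set) \<Rightarrow> nat \<Rightarrow> 'a \<Rightarrow> 'a" where
  "hcomp H m x = (THE f. homogeneous_decomp H x f) m"

locale graded_connected_hopf_algebra = hopf_algebra \<Delta> \<epsilon> S
  for \<Delta> :: "'a::real_algebra_1 \<Rightarrow> 'a tensor" and \<epsilon> S +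
  fixes H :: "nat \<Rightarrow> 'a set"
  assumes subspace_H: "subspace (H m)"
    and direct_sum: "\<exists>!f. homogeneous_decomp H x f"
    and mult_graded: "x \<in> H i \<Longrightarrow> y \<in> H j \<Longrightarrow> x * y \<in> H (i + j)"
    and coproduct_graded:
      "x \<in> H m \<Longrightarrow> \<Delta> x \<in> span {tens [y, z] | y z i j. i + j = m \<and> y \<in> H i \<and> z \<in> H j}"
    and counit_graded: "x \<in> H m \<Longrightarrow> 0 < m \<Longrightarrow> \<epsilon> x = 0"
    and antipode_graded: "x \<in> H m \<Longrightarrow> S x \<in> H m"
    and connected: "H 0 = range (\<lambda>r. r *\<^sub>R 1)"

definition graded_basis :: "(nat \<Rightarrow> 'a::real_algebra_1 set) \<Rightarrow> (nat \<Rightarrow> 'a set) \<Rightarrow> bool" where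
  "graded_basis H B \<longleftrightarrow> (\<forall>m. independent (B m) \<and> span (B m) = H m) \<and> B 0 = {1}"

definition basis_coeff :: "(nat \<Rightarrow> 'a::real_vector set) \<Rightarrow> 'a \<Rightarrow> 'a \<Rightarrow> real" where
  "basis_coeff B z y = representation (\<Union>m. B m) z y"

definition weak_compositions :: "nat \<Rightarrow> nat list set" where
  "weak_compositions n = {D. sum_list D = n}"

text \<open>The iterated coproduct, with \<open>\<Delta>\<^sup>[\<^sup>1\<^sup>] = id\<close> and the usual convention \<open>\<Delta>\<^sup>[\<^sup>0\<^sup>] = \<epsilon>\<close>.\<close>

fun iter_coproduct ::
    "('a::real_vector \<Rightarrow> 'a tensor) \<Rightarrow> ('a \<Rightarrow> real) \<Rightarrow> nat \<Rightarrow> 'a \<Rightarrow> 'a tensor" where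
  "iter_coproduct \<Delta> \<epsilon> 0 x = \<epsilon> x *\<^sub>R tens []"
| "iter_coproduct \<Delta> \<epsilon> (Suc 0) x = tens1 x"
| "iter_coproduct \<Delta> \<epsilon> (Suc (Suc l)) x = tmap (\<Delta> # replicate l tens1) (iter_coproduct \<Delta> \<epsilon> (Suc l) x)"

definition coproduct_comp ::
    "('a::real_vector \<Rightarrow> 'a tensor) \<Rightarrow> ('a \<Rightarrow> real) \<Rightarrow> (nat \<Rightarrow> 'a set) \<Rightarrow> nat list \<Rightarrow> 'a \<Rightarrow> 'a tensor" where
  "coproduct_comp \<Delta> \<epsilon> H D x =
     tmap (map (\<lambda>d y. tens1 (hcomp H d y)) D) (iter_coproduct \<Delta> \<epsilon> (length D) x)"

definition tensor_basis :: "(nat \<Rightarrow> 'a::real_vector set) \<Rightarrow> nat list \<Rightarrow> 'a tensor set" where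
  "tensor_basis B D = {tens bs | bs. list_all2 (\<lambda>d b. b \<in> B d) D bs}"

definition multinomial :: "nat \<Rightarrow> nat list \<Rightarrow> real" where
  "multinomial n D = fact n / prod_list (map fact D)"

text \<open>There are infinitely many weak compositions of \<open>n\<close> (zero parts are unrestricted), so the sum
  defining \<open>m\<Delta>\<^sub>P\<close> may be infinite; it is taken coordinatewise in the finite-dimensional space \<open>H n\<close>.
  This is meant for \<open>x \<in> H n\<close>.\<close>

definition mDeltaP ::
    "('a::real_algebra_1 \<Rightarrow> 'a tensor) \<Rightarrow> ('a \<Rightarrow> real) \<Rightarrow> (nat \<Rightarrow> 'a set) \<Rightarrow> (nat \<Rightarrow> 'a set) \<Rightarrow>
     nat \<Rightarrow> nat list pmf \<Rightarrow> 'a \<Rightarrow> 'a" where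
  "mDeltaP \<Delta> \<epsilon> H B n P x =
     (\<Sum>y\<in>B n. (\<Sum>\<^sub>\<infinity>D\<in>weak_compositions n.
        pmf P D / multinomial n D * basis_coeff B (tmult (coproduct_comp \<Delta> \<epsilon> H D x)) y) *\<^sub>R y)"

text \<open>On \<open>H m\<close> this is the sum of the coefficients of \<open>\<Delta>\<^sub>(\<^sub>1\<^sub>,\<^sub>\<dots>\<^sub>,\<^sub>1\<^sub>) x\<close> (\<open>m\<close> ones), extended linearly.\<close>

definition eta ::
    "('a::real_vector \<Rightarrow> 'a tensor) \<Rightarrow> ('a \<Rightarrow> real) \<Rightarrow> (nat \<Rightarrow> 'a set) \<Rightarrow> (nat \<Rightarrow> 'a set) \<Rightarrow> 'a \<Rightarrow> real"
  where
  "eta \<Delta> \<epsilon> H B x =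
     (\<Sum>m | hcomp H m x \<noteq> 0. \<Sum>t\<in>tensor_basis B (replicate m 1).
        representation (tensor_basis B (replicate m 1))
          (coproduct_comp \<Delta> \<epsilon> H (replicate m 1) (hcomp H m x)) t)"

definition state_space_basis ::
    "('a::real_algebra_1 \<Rightarrow> 'a tensor) \<Rightarrow> ('a \<Rightarrow> real) \<Rightarrow> (nat \<Rightarrow> 'a set) \<Rightarrow> (nat \<Rightarrow> 'a set) \<Rightarrow>
     nat list \<Rightarrow> bool" where
  "state_space_basis \<Delta> \<epsilon> H B D \<longleftrightarrow>
     (\<forall>bs. list_all2 (\<lambda>d b. b \<in> B d) D bs \<longrightarrow>
        (\<forall>y\<in>B (sum_list D). 0 \<le> basis_coeff B (prod_list bs) y)) \<and>
     (\<forall>x\<in>B (sum_list D). \<forall>t\<in>tensor_basis B D.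
        0 \<le> representation (tensor_basis B D) (coproduct_comp \<Delta> \<epsilon> H D x) t) \<and>
     (\<forall>x\<in>(\<Union>m. B m). 0 < eta \<Delta> \<epsilon> H B x)"

definition state_space_basis_for ::
    "('a::real_algebra_1 \<Rightarrow> 'a tensor) \<Rightarrow> ('a \<Rightarrow> real) \<Rightarrow> (nat \<Rightarrow> 'a set) \<Rightarrow> (nat \<Rightarrow> 'a set) \<Rightarrow>
     nat list pmf \<Rightarrow> bool" where
  "state_space_basis_for \<Delta> \<epsilon> H B P \<longleftrightarrow> (\<forall>D. 0 < pmf P D \<longrightarrow> state_space_basis \<Delta> \<epsilon> H B D)"

definition transition_matrix ::
    "('a::real_algebra_1 \<Rightarrow> 'a tensor) \<Rightarrow> ('a \<Rightarrow> real) \<Rightarrow> (nat \<Rightarrow> 'a set) \<Rightarrow> (nat \<Rightarrow> 'a set) \<Rightarrow>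
     nat \<Rightarrow> nat list pmf \<Rightarrow> 'a \<Rightarrow> 'a \<Rightarrow> real" where
  "transition_matrix \<Delta> \<epsilon> H B n P x y =
     eta \<Delta> \<epsilon> H B y / eta \<Delta> \<epsilon> H B x * basis_coeff B (mDeltaP \<Delta> \<epsilon> H B n P x) y"

definition stationary_distribution :: "'s set \<Rightarrow> ('s \<Rightarrow> 's \<Rightarrow> real) \<Rightarrow> ('s \<Rightarrow> real) \<Rightarrow> bool" where
  "stationary_distribution X K \<pi> \<longleftrightarrow>
     (\<forall>x\<in>X. 0 \<le> \<pi> x) \<and> (\<Sum>x\<in>X. \<pi> x) = 1 \<and> (\<forall>y\<in>X. (\<Sum>x\<in>X. \<pi> x * K x y) = \<pi> y)"

definition pi_list ::
    "('a::real_algebra_1 \<Rightarrow> 'a tensor) \<Rightarrow> ('a \<Rightarrow> real) \<Rightarrow> (nat \<Rightarrow> 'a set) \<Rightarrow> (nat \<Rightarrow> 'a set) \<Rightarrow>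
     'a list \<Rightarrow> 'a \<Rightarrow> real" where
  "pi_list \<Delta> \<epsilon> H B cs x =
     eta \<Delta> \<epsilon> H B x / (fact (length cs))\<^sup>2 *
     (\<Sum>\<sigma> | \<sigma> permutes {..<length cs}. basis_coeff B (prod_list (permute_list \<sigma> cs)) x)"

definition pi_mset ::
    "('a::real_algebra_1 \<Rightarrow> 'a tensor) \<Rightarrow> ('a \<Rightarrow> real) \<Rightarrow> (nat \<Rightarrow> 'a set) \<Rightarrow> (nat \<Rightarrow> 'a set) \<Rightarrow>
     'a multiset \<Rightarrow> 'a \<Rightarrow> real" where
  "pi_mset \<Delta> \<epsilon> H B M = pi_list \<Delta> \<epsilon> H B (SOME cs. mset cs = M)"

lemma pi_list_mset_cong:
  assumes "mset cs = mset ds"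
  shows "pi_list \<Delta> \<epsilon> H B cs = pi_list \<Delta> \<epsilon> H B ds"
proof
  fix x
  obtain \<tau> where \<tau>: "\<tau> permutes {..<length ds}" and cs: "permute_list \<tau> ds = cs"
    using mset_eq_permutation[OF assms] by blast
  have len: "length cs = length ds" using assms by (rule mset_eq_length)
  have "(\<Sum>\<sigma> | \<sigma> permutes {..<length ds}. basis_coeff B (prod_list (permute_list \<sigma> ds)) x) =
        (\<Sum>\<sigma> | \<sigma> permutes {..<length ds}. basis_coeff B (prod_list (permute_list (\<tau> \<circ> \<sigma>) ds)) x)"
    by (rule setum_permutations_compose_left[OF \<tau>])
  also have "\<dots> = (\<Sum>\<sigma> | \<sigma> permutes {..<length ds}. basis_coeff B (prod_list (permute_list \<sigma> cs)) x)"
    using \<tau> by (intro sum.cong refl) (simp add: permute_list_compose cs)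
  finally show "pi_list \<Delta> \<epsilon> H B cs x = pi_list \<Delta> \<epsilon> H B ds x"
    by (simp add: pi_list_def len)
qed

lemma pi_mset_mset: "pi_mset \<Delta> \<epsilon> H B (mset cs) = pi_list \<Delta> \<epsilon> H B cs"
  unfolding pi_mset_def by (rule pi_list_mset_cong) (rule someI, rule refl)

end

theory Submission
  imports Defs
begin

text \<open>
  After removing zero parts, \<open>m\<Delta>\<^sub>P\<close> acts on \<open>H n\<close> as a finite sum \<open>T\<close> of convolution products of the
  projections onto the graded pieces. Let \<open>x\<^sub>1, \<dots>, x\<^sub>k\<close> be homogeneous of positive degree. Modulo products
  of more than \<open>k\<close> such elements, each \<open>x\<^sub>i\<close> behaves as a primitive element, so \<open>T (x\<^sub>1 \<cdots> x\<^sub>k)\<close> is a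
  combination of permuted products with non-negative weights. The total weight is \<open>1\<close> if all degrees
  are \<open>1\<close> (then the formula is exact), and smaller than \<open>1\<close> otherwise, since some composition with two
  non-zero parts would split a factor of degree at least two.

  Let \<open>\<phi>\<close> be a functional on \<open>H n\<close> with \<open>\<phi> \<circ> T = \<phi>\<close>. On products of \<open>n\<close> elements of degree \<open>1\<close> it is
  harmonic for a random walk generating the symmetric group, hence symmetric. If it also vanishes on
  the symmetrised products, it therefore vanishes on all such products, and the maximum principle shows by
  descending induction on \<open>k\<close> that it vanishes on all products of \<open>k\<close> factors. Thus \<open>H n\<close> is the sum of the
  span of the symmetrised products, which are fixed by \<open>T\<close>, and the range of \<open>1 - T\<close>; by rank-nullity
  the fixed space of \<open>T\<close> is exactly that span. The symmetrised products are linearly independent because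
  \<open>\<Delta>\<^sub>(\<^sub>1\<^sub>,\<^sub>\<dots>\<^sub>,\<^sub>1\<^sub>)\<close> maps them to positive combinations of disjoint sets of basis tensors.
\<close>

section \<open>Linear algebra and tensors\<close>

text \<open>The number \<open>multinomial n E\<close> counts the ways of dealing n letters into
  piles of sizes E. On a word in \<open>B 1\<close> all these deals occur, so the weights add up to
  one; a factor of higher degree acts as a block of letters that has to stay in one pile, so fewer
  deals are available and mass is lost. This separates the layer that carries the fixed vectors from
  all others. H may be neither commutative nor cocommutative, so no eigenbasis of \<open>T\<close>
  is written down: the number of factors gives only a filtration, and products of basis elements
  satisfy unknown linear relations. Functionals get around both obstacles, since they can be
  evaluated on products without knowing which of these are independent, and products with more
  factors have already been sent to zero by the induction.\<close>

lemma span_bilinear_image: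
  fixes h :: "'a::real_vector \<Rightarrow> 'b::real_vector \<Rightarrow> 'c::real_vector"
  assumes l: "\<And>b. linear (\<lambda>a. h a b)" and r: "\<And>a. linear (h a)"
    and a: "a \<in> span A" and b: "b \<in> span B"
    and gen: "\<And>a b. a \<in> A \<Longrightarrow> b \<in> B \<Longrightarrow> h a b \<in> span C"
  shows "h a b \<in> span C"
proof -
  have "h x b \<in> span C" if "x \<in> A" for x
    using b by (rule span_induct_alt)
      (auto simp: linear_0[OF r] linear_add[OF r] linear_cmul[OF r] intro: span_zero span_add span_scale gen that)
  with a show ?thesis
    by (induction rule: span_induct_alt)
      (auto simp: linear_0[OF l] linear_add[OF l] linear_cmul[OF l] intro: span_zero span_add span_scale)
qed

lemma linear_image_span:
  assumes "linear f" "x \<in> span A" "\<And>a. a \<in> A \<Longrightarrow> f a \<in> span C"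
  shows "f x \<in> span C"
  using assms(2) by (induction rule: span_induct_alt)
    (auto simp: linear_0[OF assms(1)] linear_add[OF assms(1)] linear_cmul[OF assms(1)]
       intro: span_zero span_add span_scale assms(3))

lemma linear_sum_list: "linear f \<Longrightarrow> f (sum_list (map g xs)) = (\<Sum>x\<leftarrow>xs. f (g x))"
  by (induction xs) (simp_all add: linear_0 linear_add)

lemma span_sum_list: "(\<And>x. x \<in> set xs \<Longrightarrow> g x \<in> span A) \<Longrightarrow> (\<Sum>x\<leftarrow>xs. g x) \<in> span A"
  by (induction xs) (simp_all add: span_zero span_add)

lemma span_image_sum:
  assumes "finite A" "v \<in> span (f ` A)"
  shows "\<exists>a. v = (\<Sum>x\<in>A. a x *\<^sub>R f x)"
  using assms(2)
proof (induction rule: span_induct_alt)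
  case base
  show ?case by (rule exI[of _ "\<lambda>_. 0"]) simp
next
  case (step c x y)
  from step obtain a z where a: "y = (\<Sum>x\<in>A. a x *\<^sub>R f x)" and z: "z \<in> A" "x = f z" by blast
  have "c *\<^sub>R x = (\<Sum>x\<in>A. (if x = z then c else 0) *\<^sub>R f x)"
    using assms(1) z by (simp add: if_distrib[of "\<lambda>r. r *\<^sub>R _"] cong: if_cong)
  then have "c *\<^sub>R x + y = (\<Sum>x\<in>A. ((if x = z then c else 0) + a x) *\<^sub>R f x)"
    by (simp only: a scaleR_add_left sum.distrib)
  then show ?case by (intro exI[of _ "\<lambda>x. (if x = z then c else 0) + a x"])
qed

text \<open>A basis of \<open>U\<close> stays independent when \<open>z\<close> is added, so the
  values 0 on it and 1 at \<open>z\<close> can be prescribed.\<close>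

lemma separating_functional:
  fixes U :: "'a::real_vector set"
  assumes "subspace U" "z \<notin> U"
  obtains \<phi> :: "'a \<Rightarrow> real" where "linear \<phi>" "\<And>u. u \<in> U \<Longrightarrow> \<phi> u = 0" "\<phi> z \<noteq> 0"
proof -
  obtain A where A: "independent A" "span A = U" "A \<subseteq> U"
    using basis_exists[of U] assms(1) by (metis span_minimal subset_antisym)
  have "independent (insert z A)"
    using A assms(2) by (simp add: independent_insert)
  from linear_independent_extend[OF this, of "\<lambda>x. if x = z then 1 else 0 :: real"]
  obtain \<phi> :: "'a \<Rightarrow> real" where \<phi>: "linear \<phi>" "\<And>x. x \<in> insert z A \<Longrightarrow> \<phi> x = (if x = z then 1 else 0)" by blast
  have "\<phi> u = 0" if "u \<in> U" for u
  proof -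
    have "u \<in> span A" using that A by simp
    then show ?thesis
      by (rule linear_eq_0_on_span[OF \<phi>(1), rotated]) (use \<phi>(2) assms(2) A in auto)
  qed
  with \<phi> show thesis by (intro that[of \<phi>]) auto
qed

text \<open>A dimension count. If \<open>v\<close> lay outside \<open>Sp\<close>, some basis
  \<open>Z\<close> of \<open>V\<close> would contain \<open>v\<close> and a basis \<open>A\<close>
  of \<open>Sp\<close>. Since \<open>E\<close> kills \<open>insert v A\<close>, the images of the
  other members of \<open>Z\<close> span the range; together with \<open>A\<close> they would span
  \<open>V\<close> by fewer than \<open>card Z\<close> vectors.\<close>

lemma kernel_subset_complement_of_range:
  fixes E :: "'a::real_vector \<Rightarrow> 'a"
  assumes lin: "linear E" and fin: "finite C" and V: "V = span C"
    and sub: "subspace Sp" "Sp \<subseteq> V" and ker: "\<And>s. s \<in> Sp \<Longrightarrow> E s = 0"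
    and cover: "\<And>v. v \<in> V \<Longrightarrow> \<exists>s\<in>Sp. \<exists>u\<in>V. v = s + E u"
    and v: "v \<in> V" "E v = 0"
  shows "v \<in> Sp"
proof (rule ccontr)
  assume nv: "v \<notin> Sp"
  obtain A where A: "independent A" "span A = Sp" "A \<subseteq> Sp"
    using basis_exists[of Sp] sub(1) by (metis span_minimal subset_antisym)
  have ind: "independent (insert v A)" and vA: "v \<notin> A"
    using A nv by (auto simp: independent_insert)
  have "insert v A \<subseteq> V" using A sub v by auto
  with ind obtain Z where Z: "insert v A \<subseteq> Z" "Z \<subseteq> V" "independent Z" "V \<subseteq> span Z"
    using maximal_independent_subset_extend by metis
  have finZ: "finite Z" using Z V independent_span_bound[OF fin] by blast
  have finA: "finite A" using Z(1) finZ by (auto intro: finite_subset)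
  define R where "R = Z - insert v A"
  have "E u \<in> span (E ` R)" if "u \<in> V" for u
  proof -
    have "u \<in> span Z" using that Z by auto
    then show ?thesis
    proof (rule linear_image_span[OF lin])
      fix a assume "a \<in> Z"
      then show "E a \<in> span (E ` R)"
        using v(2) ker A(3) by (cases "a \<in> R") (auto simp: R_def span_base span_zero)
    qed
  qed
  moreover have "s \<in> span (A \<union> E ` R)" if "s \<in> Sp" for s
    using that A(2) span_mono[of A "A \<union> E ` R"] by auto
  moreover have "span (E ` R) \<subseteq> span (A \<union> E ` R)" by (rule span_mono) auto
  ultimately have "V \<subseteq> span (A \<union> E ` R)"
    by - (rule subsetI, drule cover, auto intro: span_add)
  then have "Z \<subseteq> span (A \<union> E ` R)" using Z by auto
  moreover have "finite (A \<union> E ` R)" using finZ Z(1) by (auto simp: R_def intro: finite_subset)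
  ultimately have "card Z \<le> card (A \<union> E ` R)"
    using independent_span_bound[OF _ Z(3)] by blast
  also have "\<dots> \<le> card A + card R"
    using card_Un_le[of A "E ` R"] card_image_le[of R E] finZ by (simp add: R_def)
  also have "card R = card Z - card (insert v A)"
    unfolding R_def using Z(1) finZ by (intro card_Diff_subset) (auto intro: finite_subset)
  also have "card (insert v A) = Suc (card A)"
    using vA finA by simp
  finally have "card Z \<le> card A + (card Z - Suc (card A))" .
  moreover have "Suc (card A) \<le> card Z"
    using card_mono[OF finZ Z(1)] vA finA by simp
  ultimately show False by simp
qed


section \<open>Pure tensors and linear maps on tensors\<close>

lemma poly_mapping_sum_singles:
  "p = (\<Sum>k\<in>Poly_Mapping.keys p. Poly_Mapping.lookup p k *\<^sub>R Poly_Mapping.single k (1::real))"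
  by (rule poly_mapping_eqI)
    (auto simp: lookup_sum scaleR_poly_mapping.rep_eq lookup_single when_def in_keys_iff
      if_distrib[of "\<lambda>r. _ * r"] cong: if_cong)

lemma tensor_in_span: "t \<in> span (range tens)"
proof -
  have lin: "linear (abs_tensor :: ('a list \<Rightarrow>\<^sub>0 real) \<Rightarrow> 'a tensor)"
    by (rule linearI) (simp_all add: plus_tensor.abs_eq scaleR_tensor.abs_eq)
  obtain p where p: "t = abs_tensor p"
    using tensor.abs_induct[of "\<lambda>t. \<exists>p. t = abs_tensor p" t] by blast
  have "abs_tensor p = (\<Sum>k\<in>Poly_Mapping.keys p. Poly_Mapping.lookup p k *\<^sub>R abs_tensor (Poly_Mapping.single k 1))"
    by (subst poly_mapping_sum_singles) (simp add: linear_sum[OF lin] linear_cmul[OF lin])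
  also have "\<dots> = (\<Sum>k\<in>Poly_Mapping.keys p. Poly_Mapping.lookup p k *\<^sub>R tens k)"
    by (simp add: tens.abs_eq)
  also have "\<dots> \<in> span (range tens)"
    by (intro span_sum span_scale span_base) auto
  finally show ?thesis using p by simp
qed

lemma tensor_linear_eqI:
  assumes "linear f" "linear g" "\<And>xs. f (tens xs) = g (tens xs)"
  shows "f t = g t"
  by (rule linear_eq_on_span[OF assms(1,2) _ tensor_in_span]) (use assms(3) in auto)

lemma tconc_Nil_left: "tconc (tens []) t = t"
  by (rule tensor_linear_eqI[OF linear_tconc_right module_hom_ident])
    (simp add: tconc_tens)

lemma tconc_Nil_right: "tconc t (tens []) = t"
  by (rule tensor_linear_eqI[OF linear_tconc_left module_hom_ident])
    (simp add: tconc_tens)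

lemma tconc_assoc: "tconc (tconc s t) u = tconc s (tconc t u)"
proof (rule tensor_linear_eqI[where t = s])
  show "linear (\<lambda>s. tconc (tconc s t) u)" "linear (\<lambda>s. tconc s (tconc t u))"
    using linear_compose[OF linear_tconc_left linear_tconc_left] by (simp_all add: o_def linear_tconc_left)
  fix xs
  show "tconc (tconc (tens xs) t) u = tconc (tens xs) (tconc t u)"
  proof (rule tensor_linear_eqI[where t = t])
    show "linear (\<lambda>t. tconc (tconc (tens xs) t) u)" "linear (\<lambda>t. tconc (tens xs) (tconc t u))"
      using linear_compose[OF linear_tconc_right linear_tconc_left]
        linear_compose[OF linear_tconc_left linear_tconc_right] by (simp_all add: o_def)
    fix ys
    show "tconc (tconc (tens xs) (tens ys)) u = tconc (tens xs) (tconc (tens ys) u)"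
    proof (rule tensor_linear_eqI[where t = u])
      show "linear (\<lambda>u. tconc (tconc (tens xs) (tens ys)) u)" "linear (\<lambda>u. tconc (tens xs) (tconc (tens ys) u))"
        using linear_compose[OF linear_tconc_right linear_tconc_right] by (simp_all add: o_def linear_tconc_right)
    qed (simp add: tconc_tens)
  qed
qed

lemma linear_tens1: "linear tens1"
  using multilinear_linear[OF multilinear_tens, of "[]" "[]"] by simp

lemma linear_tmap: "linear (tmap fs)"
  unfolding tmap_def by (rule linear_tlift)

lemma tmap_pair: "linear f \<Longrightarrow> linear g \<Longrightarrow> tmap [f, g] (tens [y, z]) = tconc (f y) (g z)"
  by (subst tmap_tens) (auto simp: tconc_Nil_right)

lemma tmap_single: "linear f \<Longrightarrow> tmap [f] (tens1 y) = f y"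
  by (subst tmap_tens) (auto simp: tconc_Nil_right)

lemma linear_tmult: "linear tmult"
  unfolding tmult_def by (rule linear_tlift)

lemma tmult_tconc: "tmult (tconc s t) = tmult s * tmult t"
proof (rule tensor_linear_eqI[where t = s])
  have *: "linear (\<lambda>x. x * tmult t)" "linear (\<lambda>x. y * x)" for y :: 'a
    by (auto intro!: linearI simp: algebra_simps)
  show "linear (\<lambda>s. tmult (tconc s t))" "linear (\<lambda>s. tmult s * tmult t)"
    using linear_compose[OF linear_tconc_left linear_tmult] linear_compose[OF linear_tmult *(1)]
    by (simp_all add: o_def)
  fix xs :: "'a list"
  show "tmult (tconc (tens xs) t) = tmult (tens xs) * tmult t"
    by (rule tensor_linear_eqI[where t = t])
      (use linear_compose[OF linear_tconc_right linear_tmult] linear_compose[OF linear_tmult *(2)]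
       in \<open>simp_all add: o_def tconc_tens tmult_tens\<close>)
qed

lemma linear_tprod_left: "linear (\<lambda>s. tprod s t)"
  unfolding tprod_def by (rule linear_tlift)

lemma linear_tprod_right: "linear (tprod s)"
proof -
  have inner: "multilinear (\<lambda>ys. if length xs = length ys then tens (map2 (*) xs ys) else 0)"
    for xs :: "'a list"
    unfolding multilinear_def using linear_tens_map2(2) by blast
  have "multilinear (\<lambda>xs. tlift (\<lambda>ys. if length xs = length ys then tens (map2 (*) xs ys) else 0) t)"
    for t :: "'a tensor"
    unfolding multilinear_def
    by (intro allI tlift_linear_param inner linear_tens_map2(1))
  then show ?thesis
    unfolding tprod_def by (intro tlift_linear_param linear_tlift)
qed

lemma foldr_tconc_tens1: "foldr tconc (map2 (\<lambda>f x. f x) (replicate (length xs) tens1) xs) (tens []) = tens xs"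
  by (induction xs) (simp_all add: tconc_tens)

lemma tmult_tmap_linear: "linear (\<lambda>t. tmult (tmap fs t))"
  using linear_compose[OF linear_tmap linear_tmult] by (simp add: o_def)

section \<open>Dealing words into piles\<close>

text \<open>The pairs index the terms in the expansion of the ordered product of the elements x
  \<otimes> 1 + 1 \<otimes> x. A list keeps the multiplicities that a set would lose when letters
  repeat.\<close>

fun splits :: "'b list \<Rightarrow> ('b list \<times> 'b list) list" where
  "splits [] = [([], [])]"
| "splits (x # xs) = map (\<lambda>(a, b). (x # a, b)) (splits xs) @ map (\<lambda>(a, b). (a, x # b)) (splits xs)"

text \<open>\<open>deals f D xs\<close> lists, with multiplicity, the words obtained by dealing \<open>xs\<close> into piles of total
  weights \<open>D\<close> (keeping the order within each pile) and stacking the piles.\<close>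

fun deals :: "('b \<Rightarrow> nat) \<Rightarrow> nat list \<Rightarrow> 'b list \<Rightarrow> 'b list list" where
  "deals f [] xs = (if xs = [] then [[]] else [])"
| "deals f (d # D) xs = concat (map (\<lambda>(a, b).
     if sum_list (map f a) = d then map ((@) a) (deals f D b) else []) (splits xs))"

lemma splits_mset: "(a, b) \<in> set (splits xs) \<Longrightarrow> mset a + mset b = mset xs"
  by (induction xs arbitrary: a b) auto

lemma splits_length: "(a, b) \<in> set (splits xs) \<Longrightarrow> length a + length b = length xs"
  by (metis splits_mset size_mset size_union)

lemma splits_set: "(a, b) \<in> set (splits xs) \<Longrightarrow> set a \<union> set b = set xs"
  by (metis splits_mset set_mset_mset set_mset_union)

lemma splits_sum: "(a, b) \<in> set (splits xs) \<Longrightarrow>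
    sum_list (map f a) + sum_list (map f b) = (sum_list (map f xs) :: nat)"
  by (induction xs arbitrary: a b) fastforce+

lemma splits_map: "splits (map g xs) = map (\<lambda>(a, b). (map g a, map g b)) (splits xs)"
  by (induction xs) (auto simp: case_prod_unfold)

lemma splits_append: "(a, b) \<in> set (splits xs) \<Longrightarrow> (a', b') \<in> set (splits ys) \<Longrightarrow>
    (a @ a', b @ b') \<in> set (splits (xs @ ys))"
  by (induction xs arbitrary: a b) force+

lemma splits_extreme: "([], xs) \<in> set (splits xs)" "(xs, []) \<in> set (splits xs)"
  by (induction xs) force+

lemma splits_take_drop: "(take j xs, drop j xs) \<in> set (splits xs)"
  using splits_append[OF splits_extreme(2)[of "take j xs"] splits_extreme(1)[of "drop j xs"]] by simp

lemma deals_mset: "ys \<in> set (deals f D xs) \<Longrightarrow> mset ys = mset xs"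
proof (induction D arbitrary: xs ys)
  case (Cons d D)
  then obtain a b zs where "(a, b) \<in> set (splits xs)" "zs \<in> set (deals f D b)" "ys = a @ zs"
    by (auto split: if_splits)
  with Cons.IH splits_mset show ?case by fastforce
qed (auto split: if_splits)

lemma deals_map: "deals f D (map g xs) = map (map g) (deals (\<lambda>x. f (g x)) D xs)"
proof (induction D arbitrary: xs)
  case (Cons d D)
  show ?case
    by (simp add: splits_map case_prod_unfold map_concat o_def Cons if_distrib[of "map (map g)"] cong: if_cong)
qed simp

section \<open>Counting deals\<close>

definition num_splits :: "('b \<Rightarrow> nat) \<Rightarrow> nat \<Rightarrow> 'b list \<Rightarrow> nat" where
  "num_splits f d xs = length (filter (\<lambda>(a, b). sum_list (map f a) = d) (splits xs))"

lemma num_splits_Nil: "num_splits f d [] = (if d = 0 then 1 else 0)"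
  by (simp add: num_splits_def)

lemma num_splits_Cons:
  "num_splits f d (x # xs) = (if f x \<le> d then num_splits f (d - f x) xs else 0) + num_splits f d xs"
proof -
  have "(\<lambda>(a, b). f x + sum_list (map f a) = d) = 
    (if f x \<le> d then (\<lambda>(a::'a list, b::'a list). sum_list (map f a) = d - f x) else (\<lambda>_. False))"
    by (auto simp: fun_eq_iff)
  then show ?thesis
    by (simp add: num_splits_def filter_map o_def case_prod_unfold)
qed

text \<open>Replace each letter \<open>x\<close> by a block of \<open>f x\<close> units: splits of
  weight \<open>d\<close> correspond to those sets of \<open>d\<close> units that are unions of
  blocks. In Vandermonde's sum over the share of the first block, only the terms "none" and "all"
  are used; they differ because \<open>f x\<close> is positive.\<close>

lemma num_splits_le:
  "(\<And>x. x \<in> set xs \<Longrightarrow> 0 < f x) \<Longrightarrow> num_splits f d xs \<le> sum_list (map f xs) choose d"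
proof (induction xs arbitrary: d)
  case (Cons x xs)
  let ?b = "sum_list (map f xs)"
  have x: "0 < f x" using Cons.prems by simp
  have "num_splits f d (x # xs) \<le> (if f x \<le> d then ?b choose (d - f x) else 0) + (?b choose d)"
    using Cons by (auto simp: num_splits_Cons intro: add_mono)
  also have "\<dots> = (\<Sum>k\<in>{0} \<union> (if f x \<le> d then {f x} else {}). (f x choose k) * (?b choose (d - k)))"
    using x by auto
  also have "\<dots> \<le> (\<Sum>k\<le>d. (f x choose k) * (?b choose (d - k)))"
    by (rule sum_mono2) (auto split: if_splits)
  also have "\<dots> = (f x + ?b) choose d" by (rule vandermonde)
  finally show ?case by simp
qed (simp add: num_splits_Nil)

text \<open>Strictness comes from sets that cut a block. If the first block has size at least two,
  an intermediate Vandermonde term is non-zero; if it has size one, Pascal's rule inherits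
  strictness from one of its two summands.\<close>

lemma num_splits_less:
  "(\<And>x. x \<in> set xs \<Longrightarrow> 0 < f x) \<Longrightarrow> \<exists>x\<in>set xs. 2 \<le> f x \<Longrightarrow> 0 < d \<Longrightarrow> d < sum_list (map f xs) \<Longrightarrow>
    num_splits f d xs < sum_list (map f xs) choose d"
proof (induction xs arbitrary: d)
  case (Cons x xs)
  let ?b = "sum_list (map f xs)"
  have x: "0 < f x" using Cons.prems by simp
  have le: "num_splits f e xs \<le> ?b choose e" for e
    by (rule num_splits_le) (use Cons.prems in auto)
  show ?case
  proof (cases "2 \<le> f x")
    case True
    \<comment> \<open>The least positive share of the first block for which the other
      \<open>d - j\<close> units still fit into \<open>?b\<close>; \<open>d < f x + ?b\<close> and
      \<open>2 \<le> f x\<close> keep it below \<open>f x\<close>.\<close>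
    define j where "j = max 1 (d - ?b)"
    have j: "j \<noteq> 0" "j \<noteq> f x" "j \<le> d" "j \<le> f x" "d - j \<le> ?b"
      using True Cons.prems(3,4) by (auto simp: j_def)
    have "num_splits f d (x # xs) \<le> (if f x \<le> d then ?b choose (d - f x) else 0) + (?b choose d)"
      using le by (auto simp: num_splits_Cons intro: add_mono)
    also have "\<dots> = (\<Sum>k\<in>{0} \<union> (if f x \<le> d then {f x} else {}). (f x choose k) * (?b choose (d - k)))"
      using x by auto
    also have "\<dots> < (f x choose j) * (?b choose (d - j)) + \<dots>"
      using j by simp
    also have "\<dots> = (\<Sum>k\<in>insert j ({0} \<union> (if f x \<le> d then {f x} else {})). (f x choose k) * (?b choose (d - k)))"
      using j by (subst sum.insert) auto
    also have "\<dots> \<le> (\<Sum>k\<le>d. (f x choose k) * (?b choose (d - k)))"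
      by (rule sum_mono2) (use j in \<open>auto split: if_splits\<close>)
    also have "\<dots> = (f x + ?b) choose d" by (rule vandermonde)
    finally show ?thesis by simp
  next
    case False
    then have fx: "f x = 1" using x by simp
    have ex: "\<exists>x\<in>set xs. 2 \<le> f x" using Cons.prems(2) False by auto
    then have b: "2 \<le> ?b" using member_le_sum_list[of _ "map f xs"] by fastforce
    have IH: "num_splits f e xs < ?b choose e" if "0 < e" "e < ?b" for e
      by (rule Cons.IH) (use Cons.prems ex that in auto)
    have "num_splits f d (x # xs) = num_splits f (d - 1) xs + num_splits f d xs"
      using Cons.prems(3) fx by (simp add: num_splits_Cons)
    also have "\<dots> < (?b choose (d - 1)) + (?b choose d)"
    \<comment> \<open>At \<open>d = ?b\<close> the second summand is not strict, but
      \<open>2 \<le> ?b\<close> puts \<open>d - 1\<close> strictly between 0 and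
      \<open>?b\<close>.\<close>
    proof (cases "d < ?b")
      case True
      then show ?thesis using le[of "d - 1"] IH[of d] Cons.prems(3) by simp
    next
      case False
      then show ?thesis using le[of d] IH[of "d - 1"] Cons.prems(4) b fx
        by (intro add_less_le_mono) auto
    qed
    also have "\<dots> = Suc ?b choose d" using Cons.prems(3) by (cases d) simp_all
    finally show ?thesis using fx by simp
  qed
qed simp

lemma num_splits_one: "num_splits (\<lambda>_. 1) d xs = length xs choose d"
proof (induction xs arbitrary: d)
  case (Cons x xs)
  then show ?case by (cases d) (simp_all add: num_splits_Cons)
qed (simp add: num_splits_Nil)

lemma multinomial_pos: "0 < multinomial n D"
proof -
  have "0 < (prod_list (map fact D) :: real)" by (induction D) simp_all
  then show ?thesis by (simp add: multinomial_def)
qed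

lemma multinomial_Cons: "multinomial (d + s) (d # D) = real ((d + s) choose d) * multinomial s D"
  by (simp add: multinomial_def binomial_fact)

lemma multinomial_filter_pos: "multinomial n (filter ((<) 0) D) = multinomial n D"
proof -
  have "prod_list (map fact (filter ((<) 0) D)) = (prod_list (map fact D) :: real)"
    by (induction D) simp_all
  then show ?thesis by (simp add: multinomial_def)
qed

lemma length_deals_Cons:
  "length (deals f (d # D) xs) =
     (\<Sum>(a, b)\<leftarrow>filter (\<lambda>(a, b). sum_list (map f a) = d) (splits xs). length (deals f D b))"
proof -
  have "length (concat (map (\<lambda>(a, b). if sum_list (map f a) = d then map ((@) a) (deals f D b) else []) S)) =
     (\<Sum>(a, b)\<leftarrow>filter (\<lambda>(a, b). sum_list (map f a) = d) S. length (deals f D b))" for S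
    by (induction S) auto
  then show ?thesis by simp
qed

lemma sum_list_le_const:
  fixes h :: "'b \<Rightarrow> nat"
  assumes "\<And>s. s \<in> set L \<Longrightarrow> real (h s) \<le> c"
  shows "real (\<Sum>s\<leftarrow>L. h s) \<le> real (length L) * c"
  using assms by (induction L) (auto simp: algebra_simps intro: add_mono)

lemma sum_list_eq_const:
  fixes h :: "'b \<Rightarrow> nat"
  assumes "\<And>s. s \<in> set L \<Longrightarrow> real (h s) = c"
  shows "real (\<Sum>s\<leftarrow>L. h s) = real (length L) * c"
  using assms by (induction L) (auto simp: algebra_simps)

lemma length_deals_Cons_le:
  assumes "\<And>a b. (a, b) \<in> set (splits xs) \<Longrightarrow> sum_list (map f a) = d \<Longrightarrow> real (length (deals f D b)) \<le> c"
  shows "real (length (deals f (d # D) xs)) \<le> real (num_splits f d xs) * c"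
  unfolding length_deals_Cons num_splits_def
  by (rule sum_list_le_const) (use assms in auto)

text \<open>The multinomial coefficient factors into the choice of the first pile and the deals of
  the rest; each factor is bounded separately.\<close>

lemma length_deals_le:
  "(\<And>x. x \<in> set xs \<Longrightarrow> 0 < f x) \<Longrightarrow> sum_list (map f xs) = sum_list D \<Longrightarrow>
    real (length (deals f D xs)) \<le> multinomial (sum_list D) D"
proof (induction D arbitrary: xs)
  case Nil
  then show ?case by (simp add: multinomial_def)
next
  case (Cons d D)
  have "real (length (deals f (d # D) xs)) \<le> real (num_splits f d xs) * multinomial (sum_list D) D"
  proof (rule length_deals_Cons_le)
    fix a b assume ab: "(a, b) \<in> set (splits xs)" "sum_list (map f a) = d"
    show "real (length (deals f D b)) \<le> multinomial (sum_list D) D"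
      using splits_sum[OF ab(1), of f] splits_set[OF ab(1)] ab(2) Cons.prems by (intro Cons.IH) auto
  qed
  also have "\<dots> \<le> real ((d + sum_list D) choose d) * multinomial (sum_list D) D"
    using num_splits_le[of xs f d] Cons.prems multinomial_pos[of "sum_list D" D]
    by (intro mult_right_mono) auto
  finally show ?case by (simp add: multinomial_Cons)
qed

text \<open>A strict bound for the first pile suffices, since the other piles contribute a positive
  factor. That \<open>d\<close> and the rest are both positive puts \<open>d\<close> in the range
  where a pile can cut a block.\<close>

lemma length_deals_less:
  assumes pos: "\<And>x. x \<in> set xs \<Longrightarrow> 0 < f x" and sum: "sum_list (map f xs) = sum_list (d # D)"
    and "\<exists>x\<in>set xs. 2 \<le> f x" "0 < d" "0 < sum_list D"
  shows "real (length (deals f (d # D) xs)) < multinomial (sum_list (d # D)) (d # D)"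
proof -
  have "real (length (deals f (d # D) xs)) \<le> real (num_splits f d xs) * multinomial (sum_list D) D"
  proof (rule length_deals_Cons_le)
    fix a b assume ab: "(a, b) \<in> set (splits xs)" "sum_list (map f a) = d"
    show "real (length (deals f D b)) \<le> multinomial (sum_list D) D"
      using splits_sum[OF ab(1), of f] splits_set[OF ab(1)] ab(2) pos sum by (intro length_deals_le) auto
  qed
  also have "\<dots> < real ((d + sum_list D) choose d) * multinomial (sum_list D) D"
    using num_splits_less[of xs f d] assms multinomial_pos[of "sum_list D" D]
    by (intro mult_strict_right_mono) auto
  finally show ?thesis by (simp add: multinomial_Cons)
qed

text \<open>This equality makes the deals of a word of unit weights a probability distribution after
  division by the multinomial coefficient.\<close>

lemma length_deals_one:
  "length xs = sum_list D \<Longrightarrow> real (length (deals (\<lambda>_. 1) D xs)) = multinomial (sum_list D) D"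
proof (induction D arbitrary: xs)
  case Nil
  then show ?case by (simp add: multinomial_def)
next
  case (Cons d D)
  have "real (length (deals (\<lambda>_. 1) (d # D) xs)) = real (num_splits (\<lambda>_. 1) d xs) * multinomial (sum_list D) D"
    unfolding length_deals_Cons num_splits_def
  proof (rule sum_list_eq_const)
    fix s assume "s \<in> set (filter (\<lambda>(a, b). sum_list (map (\<lambda>_. 1) a) = d) (splits xs))"
    then obtain a b where s: "s = (a, b)" "(a, b) \<in> set (splits xs)" "length a = d"
      by (auto simp: sum_list_triv)
    have "real (length (deals (\<lambda>_. 1) D b)) = multinomial (sum_list D) D"
      using splits_length[OF s(2)] s(3) Cons.prems by (intro Cons.IH) simp
    then show "real (case s of (a, b) \<Rightarrow> length (deals (\<lambda>_. 1) D b)) = multinomial (sum_list D) D"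
      by (simp add: s(1))
  qed
  also have "\<dots> = multinomial (sum_list (d # D)) (d # D)"
    using Cons.prems by (simp add: multinomial_Cons num_splits_one del: One_nat_def)
  finally show ?case .
qed

section \<open>Deals as permutations of places\<close>

text \<open>With unit weights dealing does not look at the letters. Dealing the index word
  \<open>[0..<n]\<close> records the positions once and for all, and any other word is dealt by
  reading its letters there.\<close>

lemma deals_permutations:
  obtains L where "\<And>\<tau>. \<tau> \<in> set L \<Longrightarrow> \<tau> permutes {..<n}"
    "\<And>xs :: 'b list. length xs = n \<Longrightarrow> deals (\<lambda>_. 1) D xs = map (\<lambda>\<tau>. permute_list \<tau> xs) L"
proof -
  \<comment> \<open>A dealt index word read as a function; the second branch fixes everything
    outside \<open>{..<n}\<close>, as \<open>permutes\<close> demands.\<close>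
  define p where "p js = (\<lambda>i. if i < n then js ! i else (i::nat))" for js :: "nat list"
  define L where "L = map p (deals (\<lambda>_. 1) D [0..<n])"
  have ms: "mset js = mset [0..<n]" if "js \<in> set (deals (\<lambda>_. 1) D [0..<n])" for js
    using deals_mset[OF that] .
  have len: "length js = n" and set: "set js = {..<n}" if "js \<in> set (deals (\<lambda>_. 1) D [0..<n])" for js
    using mset_eq_length[OF ms[OF that]] mset_eq_setD[OF ms[OF that]]
    by (simp_all only: length_upt set_upt atLeast0LessThan diff_zero)
  have perm: "p js permutes {..<n}" if js: "js \<in> set (deals (\<lambda>_. 1) D [0..<n])" for js
  proof (rule bij_imp_permutes)
    have "distinct js" using mset_eq_imp_distinct_iff[OF ms[OF js]] by simp
    then have "bij_betw ((!) js) {..<n} {..<n}"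
      by (rule bij_betw_nth) (simp_all only: len[OF js] set[OF js])
    then show "bij_betw (p js) {..<n} {..<n}"
      by (rule bij_betw_cong[THEN iffD1, rotated]) (simp add: p_def)
  qed (simp add: p_def)
  show thesis
  proof (rule that[of L])
    show "\<tau> permutes {..<n}" if "\<tau> \<in> set L" for \<tau>
      using that perm by (auto simp: L_def)
    fix xs :: "'b list" assume n: "length xs = n"
    have "deals (\<lambda>_. 1) D xs = deals (\<lambda>_. 1) D (map ((!) xs) [0..<n])"
      using map_nth[of xs] n by simp
    also have "\<dots> = map (map ((!) xs)) (deals (\<lambda>_. 1) D [0..<n])"
      by (rule deals_map)
    also have "\<dots> = map (\<lambda>\<tau>. permute_list \<tau> xs) L"
      unfolding L_def map_map o_def
    proof (rule map_cong[OF refl])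
      fix js assume js: "js \<in> set (deals (\<lambda>_. 1) D [0..<n])"
      show "map ((!) xs) js = permute_list (p js) xs"
        using len[OF js] n by (auto simp: permute_list_def p_def intro: nth_equalityI)
    qed
    finally show "deals (\<lambda>_. 1) D xs = map (\<lambda>\<tau>. permute_list \<tau> xs) L" .
  qed
qed

text \<open>Two elements dealt to different piles may be interchanged beforehand without changing the result.\<close>

lemma deals_swap_common:
  assumes "length (u @ p # q # w) = sum_list (d # D)" "0 < d" "0 < sum_list D"
  obtains ys where "ys \<in> set (deals (\<lambda>_. 1) (d # D) (u @ p # q # w))"
    "ys \<in> set (deals (\<lambda>_. 1) (d # D) (u @ q # p # w))"
proof -
  \<comment> \<open>The first pile is to hold \<open>p\<close>, \<open>i\<close> letters of
    \<open>u\<close> and \<open>j\<close> letters of \<open>w\<close>. There are enough letters in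
    \<open>w\<close> because the other piles are not all empty.\<close>
  define i where "i = min (length u) (d - 1)"
  define j where "j = d - 1 - i"
  have ij: "i \<le> length u" "j \<le> length w" "i + j = d - 1"
    using assms by (auto simp: i_def j_def)
  define a b where "a = take i u @ [p] @ take j w" and "b = drop i u @ [q] @ drop j w"
  \<comment> \<open>Both \<open>[p, q]\<close> and \<open>[q, p]\<close> split into
    \<open>[p]\<close> and \<open>[q]\<close>; the surrounding letters are split in the same
    way.\<close>
  have "(a, b) \<in> set (splits (u @ [p, q] @ w))" "(a, b) \<in> set (splits (u @ [q, p] @ w))"
    unfolding a_def b_def by (intro splits_append splits_take_drop; simp)+
  then have ab: "(a, b) \<in> set (splits (u @ p # q # w))" "(a, b) \<in> set (splits (u @ q # p # w))"
    by simp_all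
  have la: "length a = d" using ij assms(2) by (simp add: a_def)
  have "length b = sum_list D"
    using splits_length[OF ab(1)] la assms(1) by simp
  from length_deals_one[OF this] multinomial_pos[of "sum_list D" D]
  have "deals (\<lambda>_. 1) D b \<noteq> []" by auto
  then obtain ys where "ys \<in> set (deals (\<lambda>_. 1) D b)" by (meson list.set_sel(1))
  with ab la have "a @ ys \<in> set (deals (\<lambda>_. 1) (d # D) (u @ p # q # w))"
    "a @ ys \<in> set (deals (\<lambda>_. 1) (d # D) (u @ q # p # w))"
    by (fastforce simp: sum_list_triv)+
  then show thesis by (rule that)
qed

text \<open>The prefix \<open>u\<close> is the part already in place: the next letter is brought to
  the front of the remainder by adjacent swaps and then joins the prefix. \<open>M\<close> confines
  the hypothesis to rearrangements of one word.\<close>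

lemma adjacent_swap_invariant_imp_permutation_invariant:
  assumes swap: "\<And>u p q w. mset (u @ p # q # w) = M \<Longrightarrow> g (u @ p # q # w) = g (u @ q # p # w)"
  shows "mset (u @ xs) = M \<Longrightarrow> mset xs = mset ys \<Longrightarrow> g (u @ xs) = g (u @ ys)"
proof (induction xs arbitrary: u ys)
  case (Cons x xs)
  have move: "mset (u @ v @ x # w) = M \<Longrightarrow> g (u @ v @ x # w) = g (u @ x # v @ w)" for u v w
  proof (induction v arbitrary: u)
    case (Cons y v)
    have "g (u @ (y # v) @ x # w) = g ((u @ [y]) @ v @ x # w)" by simp
    also have "\<dots> = g ((u @ [y]) @ x # v @ w)" by (rule Cons.IH) (use Cons.prems in simp)
    also have "\<dots> = g (u @ y # x # v @ w)" by simp
    also have "\<dots> = g (u @ x # y # v @ w)" by (rule swap) (use Cons.prems in simp)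
    finally show ?case by simp
  qed simp
  from Cons.prems(2) have "x \<in> set ys" using mset_eq_setD by fastforce
  then obtain v w where ys: "ys = v @ x # w" by (meson split_list)
  have "g (u @ ys) = g ((u @ [x]) @ v @ w)"
    unfolding ys using move[of u v w] Cons.prems ys by simp
  also have "\<dots> = g ((u @ [x]) @ xs)"
    by (rule Cons.IH[symmetric]) (use Cons.prems ys in auto)
  finally show ?case by simp
qed simp

section \<open>Convolution\<close>

lemma tmap_tens_length_neq:
  assumes "\<And>f. f \<in> set fs \<Longrightarrow> linear f" "length xs \<noteq> length fs"
  shows "tmap fs (tens xs) = 0"
  unfolding tmap_def using assms by (simp add: tlift_tens[OF multilinear_tmap])

lemma tmap_Nil: "tmap [] (tens []) = tens []"
  by (subst tmap_tens) auto

lemma tmap_Cons: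
  "linear f \<Longrightarrow> \<forall>h\<in>set fs. linear h \<Longrightarrow> length xs = length fs \<Longrightarrow>
    tmap (f # fs) (tens (x # xs)) = tconc (f x) (tmap fs (tens xs))"
  by (subst (1 2) tmap_tens) auto

lemma linear_scaleR_const: "linear f \<Longrightarrow> linear (\<lambda>x. f x *\<^sub>R v)"
  by (intro linearI) (simp_all add: linear_add linear_cmul scaleR_add_left)

lemma tmap_tconc_pair:
  assumes "\<And>h. h \<in> set (f # g # fs) \<Longrightarrow> linear h" "length ys = length fs"
    and t: "t \<in> span {tens [y, z] | y z. True}"
  shows "tmap (f # g # fs) (tconc t (tens ys)) = tconc (tmap [f, g] t) (tmap fs (tens ys))"
proof (rule linear_eq_on_span[OF _ _ _ t])
  show "linear (\<lambda>t. tmap (f # g # fs) (tconc t (tens ys)))"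
    using linear_compose[OF linear_tconc_left linear_tmap] by (simp add: o_def)
  show "linear (\<lambda>t. tconc (tmap [f, g] t) (tmap fs (tens ys)))"
    using linear_compose[OF linear_tmap linear_tconc_left] by (simp add: o_def)
  show "\<And>t. t \<in> {tens [y, z] | y z. True} \<Longrightarrow>
    tmap (f # g # fs) (tconc t (tens ys)) = tconc (tmap [f, g] t) (tmap fs (tens ys))"
    using assms(1,2) by (auto simp: tconc_tens tmap_Cons tmap_Nil tconc_assoc tconc_Nil_right tconc_Nil_left)
qed

lemma tmap_tconc_single:
  assumes "linear f" "linear g" "linear h"
    and t: "t \<in> span {tens [y, z] | y z. True}"
  shows "tmap [f, g, h] (tconc (tens1 x) t) = tconc (f x) (tmap [g, h] t)"
proof (rule linear_eq_on_span[OF _ _ _ t])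
  show "linear (\<lambda>t. tmap [f, g, h] (tconc (tens1 x) t))"
    using linear_compose[OF linear_tconc_right linear_tmap] by (simp add: o_def)
  show "linear (\<lambda>t. tconc (f x) (tmap [g, h] t))"
    using linear_compose[OF linear_tmap linear_tconc_right] by (simp add: o_def)
  show "\<And>t. t \<in> {tens [y, z] | y z. True} \<Longrightarrow>
    tmap [f, g, h] (tconc (tens1 x) t) = tconc (f x) (tmap [g, h] t)"
    using assms(1-3) by (auto simp: tconc_tens tmap_Cons tmap_Nil tconc_Nil_right)
qed

context hopf_algebra
begin

text \<open>The convolution product of maps into the tensor algebra, whose multiplication is
  \<open>tconc\<close>; \<open>conv_unit\<close> is its unit.\<close>

definition conv :: "('a \<Rightarrow> 'a tensor) \<Rightarrow> ('a \<Rightarrow> 'a tensor) \<Rightarrow> 'a \<Rightarrow> 'a tensor" where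
  "conv f g x = tmap [f, g] (\<Delta> x)"

definition conv_unit :: "'a \<Rightarrow> 'a tensor" where
  "conv_unit x = \<epsilon> x *\<^sub>R tens []"

lemma linear_conv: "linear (conv f g)"
  using linear_compose[OF linear_coproduct linear_tmap] by (simp add: o_def conv_def[abs_def])

lemma linear_conv_unit: "linear conv_unit"
  unfolding conv_unit_def[abs_def] by (intro linear_scaleR_const linear_counit)

lemma conv_unit_right: "linear f \<Longrightarrow> conv f conv_unit = f"
proof
  fix x assume f: "linear f"
  have "tmap [f, conv_unit] (\<Delta> x) = tmap [f] (tmap [tens1, conv_unit] (\<Delta> x))"
  proof (rule linear_eq_on_span[OF linear_tmap _ _ coproduct_in])
    show "linear (\<lambda>t. tmap [f] (tmap [tens1, conv_unit] t))"
      using linear_compose[OF linear_tmap linear_tmap] by (simp add: o_def)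
  qed (clarsimp simp: tmap_pair f linear_conv_unit linear_tens1, simp add: conv_unit_def tmap_single f
        linear_cmul[OF linear_tconc_right] tconc_Nil_right linear_cmul[OF linear_tmap])
  also have "\<dots> = f x"
    using counit_right[of x] by (simp add: conv_unit_def[abs_def] tmap_single f)
  finally show "conv f conv_unit x = f x" by (simp add: conv_def)
qed

lemma conv_unit_left: "linear f \<Longrightarrow> conv conv_unit f = f"
proof
  fix x assume f: "linear f"
  have "tmap [conv_unit, f] (\<Delta> x) = tmap [f] (tmap [conv_unit, tens1] (\<Delta> x))"
  proof (rule linear_eq_on_span[OF linear_tmap _ _ coproduct_in])
    show "linear (\<lambda>t. tmap [f] (tmap [conv_unit, tens1] t))"
      using linear_compose[OF linear_tmap linear_tmap] by (simp add: o_def)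
  qed (clarsimp simp: tmap_pair f linear_conv_unit linear_tens1, simp add: conv_unit_def tmap_single f
        linear_cmul[OF linear_tconc_left] tconc_Nil_left linear_cmul[OF linear_tmap])
  also have "\<dots> = f x"
    using counit_left[of x] by (simp add: conv_unit_def[abs_def] tmap_single f)
  finally show "conv conv_unit f x = f x" by (simp add: conv_def)
qed

text \<open>The two legs made by the last coproduct are absorbed into one convolution factor. It
  sits at the head because \<open>iter_coproduct\<close> always splits the first leg.\<close>

lemma tmap_conv_Cons:
  assumes "\<And>h. h \<in> set (f # g # fs) \<Longrightarrow> linear h"
  shows "tmap (f # g # fs) (tmap (\<Delta> # replicate (length fs) tens1) t) = tmap (conv f g # fs) t"
proof (rule tensor_linear_eqI[where t = t])
  show "linear (\<lambda>t. tmap (f # g # fs) (tmap (\<Delta> # replicate (length fs) tens1) t))"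
    using linear_compose[OF linear_tmap linear_tmap] by (simp add: o_def)
  show "linear (tmap (conv f g # fs))" by (rule linear_tmap)
  fix xs
  have l1: "\<And>h. h \<in> set (\<Delta> # replicate (length fs) tens1) \<Longrightarrow> linear h"
    using linear_coproduct linear_tens1 by (auto split: if_splits)
  have l2: "\<And>h. h \<in> set (conv f g # fs) \<Longrightarrow> linear h"
    using assms linear_conv by auto
  show "tmap (f # g # fs) (tmap (\<Delta> # replicate (length fs) tens1) (tens xs)) = tmap (conv f g # fs) (tens xs)"
  proof (cases "length xs = Suc (length fs)")
    case True
    then obtain x ys where xs: "xs = x # ys" "length ys = length fs" by (cases xs) auto
    have "tmap (\<Delta> # replicate (length fs) tens1) (tens xs) = tconc (\<Delta> x) (tens ys)"
      using foldr_tconc_tens1[of ys] xs by (subst tmap_tens[OF l1]) auto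
    also have "tmap (f # g # fs) \<dots> = tconc (conv f g x) (tmap fs (tens ys))"
      unfolding conv_def by (rule tmap_tconc_pair[OF assms xs(2) coproduct_in])
    also have "\<dots> = tmap (conv f g # fs) (tens xs)"
      using xs assms by (simp add: tmap_Cons linear_conv)
    finally show ?thesis .
  next
    case False
    then have "tmap (\<Delta> # replicate (length fs) tens1) (tens xs) = 0" "tmap (conv f g # fs) (tens xs) = 0"
      by (intro tmap_tens_length_neq l1 l2; simp)+
    then show ?thesis by (simp add: linear_0[OF linear_tmap])
  qed
qed

lemma tmap_conv_right:
  assumes "linear f" "linear g" "linear h" and t: "t \<in> span {tens [y, z] | y z. True}"
  shows "tmap [f, g, h] (tmap [tens1, \<Delta>] t) = tmap [f, conv g h] t"
proof (rule linear_eq_on_span[OF _ linear_tmap _ t])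
  show "linear (\<lambda>t. tmap [f, g, h] (tmap [tens1, \<Delta>] t))"
    using linear_compose[OF linear_tmap linear_tmap] by (simp add: o_def)
qed (auto simp: tmap_pair assms linear_tens1 linear_coproduct linear_conv conv_def
  tmap_tconc_single[OF assms(1-3) coproduct_in])

lemma conv_assoc:
  assumes "linear f" "linear g" "linear h"
  shows "conv (conv f g) h = conv f (conv g h)"
proof
  fix x
  have "tmap [f, g, h] (tmap (\<Delta> # replicate (length [h]) tens1) (\<Delta> x)) = tmap [conv f g, h] (\<Delta> x)"
    by (rule tmap_conv_Cons) (use assms in auto)
  then have "conv (conv f g) h x = tmap [f, g, h] (tmap [\<Delta>, tens1] (\<Delta> x))"
    by (simp add: conv_def)
  also have "\<dots> = conv f (conv g h) x"
    using tmap_conv_right[OF assms coproduct_in] by (simp add: coassoc conv_def)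
  finally show "conv (conv f g) h x = conv f (conv g h) x" .
qed

lemma linear_foldr_conv: "linear (foldr conv fs conv_unit)"
  by (cases fs) (simp_all add: linear_conv linear_conv_unit)

text \<open>Repeated absorption at the head yields a product bracketed to the left; associativity
  turns it into \<open>foldr\<close>, so that later inductions can peel off the first part of
  \<open>D\<close>. The final \<open>conv_unit\<close> matches the counit as the empty iterated
  coproduct.\<close>

lemma tmap_iter_coproduct:
  assumes "\<And>f. f \<in> set fs \<Longrightarrow> linear f"
  shows "tmap fs (iter_coproduct \<Delta> \<epsilon> (length fs) x) = foldr conv fs conv_unit x"
proof (cases fs)
  case Nil
  then show ?thesis by (simp add: conv_unit_def linear_cmul[OF linear_tmap] tmap_Nil)
next
  case (Cons f gs)
  have "linear f \<Longrightarrow> (\<And>g. g \<in> set gs \<Longrightarrow> linear g) \<Longrightarrow>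
    tmap (f # gs) (iter_coproduct \<Delta> \<epsilon> (Suc (length gs)) x) = conv f (foldr conv gs conv_unit) x"
  proof (induction gs arbitrary: f)
    case Nil
    then show ?case by (simp add: tmap_single conv_unit_right)
  next
    case (Cons g gs)
    have "\<And>k. k \<in> set (f # g # gs) \<Longrightarrow> linear k" using Cons.prems by auto
    from tmap_conv_Cons[OF this]
    have "tmap (f # g # gs) (iter_coproduct \<Delta> \<epsilon> (Suc (length (g # gs))) x) =
        tmap (conv f g # gs) (iter_coproduct \<Delta> \<epsilon> (Suc (length gs)) x)"
      by simp
    also have "\<dots> = conv (conv f g) (foldr conv gs conv_unit) x"
      using Cons.prems by (intro Cons.IH linear_conv) auto
    also have "\<dots> = conv f (conv g (foldr conv gs conv_unit)) x"
      using Cons.prems by (simp add: conv_assoc linear_foldr_conv)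
    finally show ?case by simp
  qed
  with Cons assms show ?thesis by simp
qed

end

section \<open>Homogeneous components\<close>

text \<open>Allowing any finite set that contains the support lets two decompositions be added over
  a union, whatever cancels.\<close>

lemma homogeneous_decomp_iff:
  "homogeneous_decomp H x f \<longleftrightarrow>
     (\<forall>m. f m \<in> H m) \<and> (\<exists>K. finite K \<and> (\<forall>m. m \<notin> K \<longrightarrow> f m = 0) \<and> x = (\<Sum>m\<in>K. f m))"
proof
  assume "homogeneous_decomp H x f"
  then show "(\<forall>m. f m \<in> H m) \<and> (\<exists>K. finite K \<and> (\<forall>m. m \<notin> K \<longrightarrow> f m = 0) \<and> x = (\<Sum>m\<in>K. f m))"
    unfolding homogeneous_decomp_def by (intro conjI exI[of _ "{m. f m \<noteq> 0}"]) auto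
next
  assume *: "(\<forall>m. f m \<in> H m) \<and> (\<exists>K. finite K \<and> (\<forall>m. m \<notin> K \<longrightarrow> f m = 0) \<and> x = (\<Sum>m\<in>K. f m))"
  then obtain K where K: "finite K" "\<forall>m. m \<notin> K \<longrightarrow> f m = 0" "x = (\<Sum>m\<in>K. f m)" by blast
  have "{m. f m \<noteq> 0} \<subseteq> K" using K by auto
  with K * show "homogeneous_decomp H x f"
    unfolding homogeneous_decomp_def
    by (auto intro: finite_subset sum.mono_neutral_right)
qed

context graded_connected_hopf_algebra
begin

lemma hcomp_decomp: "homogeneous_decomp H x (\<lambda>m. hcomp H m x)"
  unfolding hcomp_def using theI'[OF direct_sum] by simp

lemma hcomp_eqI: "homogeneous_decomp H x f \<Longrightarrow> hcomp H m x = f m"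
  using hcomp_decomp direct_sum by metis

lemma hcomp_homogeneous: "x \<in> H m \<Longrightarrow> hcomp H k x = (if k = m then x else 0)"
  by (rule hcomp_eqI)
    (auto simp: homogeneous_decomp_iff subspace_0[OF subspace_H] intro!: exI[of _ "{m}"])

lemma hcomp_in: "hcomp H m x \<in> H m"
  using hcomp_decomp[of x] by (simp add: homogeneous_decomp_def)

lemma linear_hcomp: "linear (hcomp H m)"
proof (rule linearI)
  fix x y
  obtain K L where K: "finite K" "\<forall>m. m \<notin> K \<longrightarrow> hcomp H m x = 0" "x = (\<Sum>m\<in>K. hcomp H m x)"
    and L: "finite L" "\<forall>m. m \<notin> L \<longrightarrow> hcomp H m y = 0" "y = (\<Sum>m\<in>L. hcomp H m y)"
    using hcomp_decomp[of x] hcomp_decomp[of y] unfolding homogeneous_decomp_iff by blast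
  have s: "(\<Sum>m\<in>K. hcomp H m x) = (\<Sum>m\<in>K \<union> L. hcomp H m x)"
    "(\<Sum>m\<in>L. hcomp H m y) = (\<Sum>m\<in>K \<union> L. hcomp H m y)"
    using K(1,2) L(1,2) by (intro sum.mono_neutral_left; auto)+
  have "x = (\<Sum>m\<in>K \<union> L. hcomp H m x)" "y = (\<Sum>m\<in>K \<union> L. hcomp H m y)"
    by (rule trans[OF K(3) s(1)], rule trans[OF L(3) s(2)])
  from arg_cong2[OF this, of "(+)"]
  have "x + y = (\<Sum>m\<in>K \<union> L. hcomp H m x + hcomp H m y)" unfolding sum.distrib .
  then have "homogeneous_decomp H (x + y) (\<lambda>m. hcomp H m x + hcomp H m y)"
    unfolding homogeneous_decomp_iff using K L
    by (auto intro!: subspace_add[OF subspace_H] hcomp_in exI[of _ "K \<union> L"])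
  then show "hcomp H m (x + y) = hcomp H m x + hcomp H m y" by (rule hcomp_eqI)
next
  fix r x
  obtain K where K: "finite K" "\<forall>m. m \<notin> K \<longrightarrow> hcomp H m x = 0" "x = (\<Sum>m\<in>K. hcomp H m x)"
    using hcomp_decomp[of x] unfolding homogeneous_decomp_iff by blast
  then have "r *\<^sub>R x = (\<Sum>m\<in>K. r *\<^sub>R hcomp H m x)" by (metis scaleR_sum_right)
  with K have "homogeneous_decomp H (r *\<^sub>R x) (\<lambda>m. r *\<^sub>R hcomp H m x)"
    unfolding homogeneous_decomp_iff
    by (auto intro!: subspace_scale[OF subspace_H] hcomp_in exI[of _ K])
  then show "hcomp H m (r *\<^sub>R x) = r *\<^sub>R hcomp H m x" by (rule hcomp_eqI)
qed

lemma span_homogeneous: "x \<in> span (\<Union>m. H m)"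
proof -
  have "x = (\<Sum>m | hcomp H m x \<noteq> 0. hcomp H m x)"
    using hcomp_decomp[of x] by (simp add: homogeneous_decomp_def)
  also have "\<dots> \<in> span (\<Union>m. H m)"
    by (intro span_sum span_base) (use hcomp_in in blast)
  finally show ?thesis .
qed

lemma one_in_H0: "1 \<in> H 0"
  unfolding connected by (auto intro: range_eqI[of _ _ 1])

lemma hcomp_0: "hcomp H 0 x = \<epsilon> x *\<^sub>R 1"
proof (rule linear_eq_on_span[OF linear_hcomp _ _ span_homogeneous])
  show "linear (\<lambda>x. \<epsilon> x *\<^sub>R 1 :: 'a)" by (intro linear_scaleR_const linear_counit)
  fix y assume "y \<in> (\<Union>m. H m)"
  then obtain m where m: "y \<in> H m" by blast
  show "hcomp H 0 y = \<epsilon> y *\<^sub>R 1"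
  proof (cases "m = 0")
    case True
    with m connected obtain r where "y = r *\<^sub>R 1" by auto
    then show ?thesis
      using hcomp_homogeneous[OF one_in_H0]
      by (simp add: linear_cmul[OF linear_hcomp] linear_cmul[OF linear_counit] counit_one)
  next
    case False
    with m show ?thesis by (simp add: hcomp_homogeneous counit_graded)
  qed
qed

abbreviation coprod :: "nat list \<Rightarrow> 'a \<Rightarrow> 'a tensor" where
  "coprod \<equiv> coproduct_comp \<Delta> \<epsilon> H"

lemma linear_tens1_hcomp: "linear (\<lambda>y. tens1 (hcomp H d y))"
  using linear_compose[OF linear_hcomp linear_tens1] by (simp add: o_def)

lemma coprod_foldr: "coprod D = foldr conv (map (\<lambda>d y. tens1 (hcomp H d y)) D) conv_unit"
proof
  fix x
  have "linear f" if "f \<in> set (map (\<lambda>d y. tens1 (hcomp H d y)) D)" for f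
    using that linear_tens1_hcomp by auto
  then have "tmap (map (\<lambda>d y. tens1 (hcomp H d y)) D)
      (iter_coproduct \<Delta> \<epsilon> (length (map (\<lambda>d y. tens1 (hcomp H d y)) D)) x) =
    foldr conv (map (\<lambda>d y. tens1 (hcomp H d y)) D) conv_unit x"
    by (rule tmap_iter_coproduct)
  then show "coprod D x = foldr conv (map (\<lambda>d y. tens1 (hcomp H d y)) D) conv_unit x"
    by (simp add: coproduct_comp_def)
qed

lemma linear_coprod: "linear (coprod D)"
  by (simp add: coprod_foldr linear_foldr_conv)

lemma coprod_Nil: "coprod [] x = \<epsilon> x *\<^sub>R tens []"
  by (simp add: coprod_foldr conv_unit_def)

lemma coprod_Cons: "coprod (d # D) = conv (\<lambda>y. tens1 (hcomp H d y)) (coprod D)"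
  by (simp add: coprod_foldr)

section \<open>Multiplication after a graded coproduct\<close>

definition mcop :: "nat list \<Rightarrow> 'a \<Rightarrow> 'a" where
  "mcop D x = tmult (coprod D x)"

text \<open>One convolution step as a linear map on tensors, so that it can be applied separately to
  an approximation of \<open>\<Delta> x\<close> and to the error.\<close>

definition mcop_step :: "nat \<Rightarrow> nat list \<Rightarrow> 'a tensor \<Rightarrow> 'a" where
  "mcop_step d D t = tmult (tmap [\<lambda>y. tens1 (hcomp H d y), coprod D] t)"

lemma linear_mcop: "linear (mcop D)"
  using linear_compose[OF linear_coprod linear_tmult] by (simp add: o_def mcop_def[abs_def])

lemma linear_mcop_step: "linear (mcop_step d D)"
  unfolding mcop_step_def[abs_def] by (rule tmult_tmap_linear)

lemma mcop_step_tens: "mcop_step d D (tens [y, z]) = hcomp H d y * mcop D z"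
  by (simp add: mcop_step_def mcop_def tmap_pair linear_coprod linear_tens1_hcomp tmult_tconc tmult_tens)

lemma mcop_Nil: "mcop [] x = \<epsilon> x *\<^sub>R 1"
  by (simp add: mcop_def coprod_Nil linear_cmul[OF linear_tmult] tmult_tens)

lemma mcop_Cons: "mcop (d # D) x = mcop_step d D (\<Delta> x)"
  by (simp add: mcop_def mcop_step_def coprod_Cons conv_def)

text \<open>The tensors \<open>coprod (0 # D) x\<close> and \<open>coprod D x\<close> live in
  different tensor powers; they agree only after \<open>tmult\<close>, which does not distinguish
  \<open>tens1 1\<close> from \<open>tens []\<close>.\<close>

lemma mcop_Cons_0: "mcop (0 # D) = mcop D"
proof
  fix x
  have "mcop_step 0 D (\<Delta> x) = tmult (tmap [conv_unit, coprod D] (\<Delta> x))"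
    by (rule linear_eq_on_span[OF linear_mcop_step tmult_tmap_linear _ coproduct_in])
      (auto simp: mcop_step_tens hcomp_0 tmap_pair linear_conv_unit linear_coprod tmult_tconc
        conv_unit_def linear_cmul[OF linear_tmult] tmult_tens mcop_def)
  also have "\<dots> = mcop D x"
    using conv_unit_left[OF linear_coprod, of D] by (simp add: mcop_def conv_def[symmetric])
  finally show "mcop (0 # D) x = mcop D x" by (simp add: mcop_Cons)
qed

lemma mcop_Cons_cong: "mcop D = mcop D' \<Longrightarrow> mcop (d # D) = mcop (d # D')"
proof
  fix x assume "mcop D = mcop D'"
  then show "mcop (d # D) x = mcop (d # D') x"
    unfolding mcop_Cons
    by (intro linear_eq_on_span[OF linear_mcop_step linear_mcop_step _ coproduct_in])
      (auto simp: mcop_step_tens)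
qed

lemma mcop_filter_pos: "mcop (filter ((<) 0) D) = mcop D"
  by (induction D) (auto simp: mcop_Cons_0 intro: mcop_Cons_cong)

text \<open>As \<open>H 0\<close> consists of scalars, the grading leaves
  \<open>tens [u, 1] + tens [1, w]\<close> and terms with both factors of positive degree. The
  counit kills the latter, and the two counit axioms force \<open>u = x\<close> and
  \<open>w = x\<close>.\<close>

lemma coproduct_primitive_mod:
  assumes x: "x \<in> H d" and d: "0 < d"
  shows "\<Delta> x - (tens [x, 1] + tens [1, x]) \<in>
    span {tens [y, z] | y z i j. 0 < i \<and> 0 < j \<and> i + j = d \<and> y \<in> H i \<and> z \<in> H j}" (is "_ \<in> span ?M")
proof -
  have lin1: "linear (\<lambda>u::'a. tens [u, 1])" "linear (\<lambda>w::'a. tens [1, w])"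
    using multilinear_linear[OF multilinear_tens, of "[]" "[1]"]
      multilinear_linear[OF multilinear_tens, of "[1]" "[]"] by simp_all
  have "\<exists>u w r. u \<in> H d \<and> w \<in> H d \<and> r \<in> span ?M \<and> t = tens [u, 1] + tens [1, w] + r"
    if "t \<in> span {tens [y, z] | y z i j. i + j = d \<and> y \<in> H i \<and> z \<in> H j}" for t
    using that
  proof (induction rule: span_induct_alt)
    case base
    have "0 = tens [0, 1] + tens [1, 0] + (0 :: 'a tensor)"
      using linear_0[OF lin1(1)] linear_0[OF lin1(2)] by simp
    then show ?case using subspace_0[OF subspace_H] span_zero by blast
  next
    case (step c t s)
    from step(2) obtain u w r where IH: "u \<in> H d" "w \<in> H d" "r \<in> span ?M" "s = tens [u, 1] + tens [1, w] + r"
      by blast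
    from step(1) obtain y z i j where g: "i + j = d" "y \<in> H i" "z \<in> H j" "t = tens [y, z]" by blast
    consider "i = 0" | "j = 0" | "0 < i" "0 < j" by blast
    then show ?case
    proof cases
      case 1
      then obtain a where a: "y = a *\<^sub>R 1" using g connected by auto
      have "t = a *\<^sub>R tens [1, z]"
        using linear_cmul[OF multilinear_linear[OF multilinear_tens, of "[]" "[z]"], of a 1] by (simp add: g a)
      also have "\<dots> = tens [1, a *\<^sub>R z]" by (simp add: linear_cmul[OF lin1(2)])
      finally have "c *\<^sub>R t + s = tens [u, 1] + tens [1, c *\<^sub>R a *\<^sub>R z + w] + r"
        by (simp add: linear_add[OF lin1(2)] linear_cmul[OF lin1(2)] IH)
      moreover have "c *\<^sub>R a *\<^sub>R z + w \<in> H d"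
        using 1 g IH by (auto intro!: subspace_add[OF subspace_H] subspace_scale[OF subspace_H])
      ultimately show ?thesis using IH by blast
    next
      case 2
      then obtain a where a: "z = a *\<^sub>R 1" using g connected by auto
      have "t = a *\<^sub>R tens [y, 1]"
        using linear_cmul[OF multilinear_linear[OF multilinear_tens, of "[y]" "[]"], of a 1] by (simp add: g a)
      also have "\<dots> = tens [a *\<^sub>R y, 1]" by (simp add: linear_cmul[OF lin1(1)])
      finally have "c *\<^sub>R t + s = tens [c *\<^sub>R a *\<^sub>R y + u, 1] + tens [1, w] + r"
        by (simp add: linear_add[OF lin1(1)] linear_cmul[OF lin1(1)] IH)
      moreover have "c *\<^sub>R a *\<^sub>R y + u \<in> H d"
        using 2 g IH by (auto intro!: subspace_add[OF subspace_H] subspace_scale[OF subspace_H])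
      ultimately show ?thesis using IH by blast
    next
      case 3
      then have "t \<in> ?M" using g by blast
      then have "c *\<^sub>R t + r \<in> span ?M" using IH by (intro span_add span_scale[OF span_base]) auto
      moreover have "c *\<^sub>R t + s = tens [u, 1] + tens [1, w] + (c *\<^sub>R t + r)" by (simp add: IH)
      ultimately show ?thesis using IH by blast
    qed
  qed
  from this[OF coproduct_graded[OF x]] obtain u w r where
    uwr: "u \<in> H d" "w \<in> H d" "r \<in> span ?M" "\<Delta> x = tens [u, 1] + tens [1, w] + r" by blast
  have eps: "\<epsilon> y = 0" if "y \<in> H i" "0 < i" for y i using that by (rule counit_graded)
  have "tmap [conv_unit, tens1] r = 0" "tmap [tens1, conv_unit] r = 0"
    by (rule linear_eq_0_on_span[OF linear_tmap _ uwr(3)];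
      auto simp: tmap_pair linear_conv_unit linear_tens1 conv_unit_def eps
        linear_0[OF linear_tconc_left] linear_0[OF linear_tconc_right])+
  then have "tens1 w = tens1 x" "tens1 u = tens1 x"
    using counit_left[of x] counit_right[of x] uwr d
    by (auto simp: conv_unit_def[symmetric] linear_add[OF linear_tmap] tmap_pair linear_conv_unit linear_tens1)
      (auto simp: conv_unit_def eps counit_one tconc_Nil_left tconc_Nil_right
        linear_0[OF linear_tconc_left] linear_0[OF linear_tconc_right])
  \<comment> \<open>\<open>tmult\<close> is a left inverse of \<open>tens1\<close>, so the equations
    descend to the elements.\<close>
  then have "tmult (tens1 w) = tmult (tens1 x)" "tmult (tens1 u) = tmult (tens1 x)" by simp_all
  then have "w = x" "u = x" by (simp_all add: tmult_tens)
  with uwr show ?thesis by simp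
qed

end

section \<open>Powers of the augmentation ideal\<close>

locale graded_hopf_basis = graded_connected_hopf_algebra \<Delta> \<epsilon> S H
  for \<Delta> :: "'a::real_algebra_1 \<Rightarrow> 'a tensor" and \<epsilon> S H +
  fixes B :: "nat \<Rightarrow> 'a set"
  assumes basis: "graded_basis H B"
    and finite_dim: "\<exists>T. finite T \<and> H m = span T"
begin

lemma independent_B: "independent (B m)" and span_B: "span (B m) = H m" and B_0: "B 0 = {1}"
  using basis by (auto simp: graded_basis_def)

lemma B_in_H: "b \<in> B m \<Longrightarrow> b \<in> H m"
  using span_B span_base by blast

lemma finite_B: "finite (B m)"
proof -
  obtain T where "finite T" "H m = span T" using finite_dim by blast
  then show ?thesis
    using independent_span_bound[of T "B m"] independent_B span_B span_superset by blast
qed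

text \<open>The maps \<open>hcomp H m\<close> reduce a relation to one inside a single
  \<open>B m\<close>. Independence is also what makes the \<open>representation\<close> inside
  \<open>basis_coeff\<close> genuine coordinates and not the default zero.\<close>

lemma independent_Union_B: "independent (\<Union>m. B m)"
  unfolding independent_explicit_module
proof (intro allI impI)
  fix t u v assume t: "finite t" "t \<subseteq> (\<Union>m. B m)" "(\<Sum>v\<in>t. u v *\<^sub>R v) = 0" "v \<in> t"
  then obtain m where m: "v \<in> B m" by blast
  have "0 = hcomp H m (\<Sum>v\<in>t. u v *\<^sub>R v)" by (simp add: t linear_0[OF linear_hcomp])
  also have "\<dots> = (\<Sum>v\<in>t. u v *\<^sub>R hcomp H m v)"
    by (simp add: linear_sum[OF linear_hcomp] linear_cmul[OF linear_hcomp])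
  also have "\<dots> = (\<Sum>v\<in>t \<inter> B m. u v *\<^sub>R hcomp H m v)"
  proof (rule sum.mono_neutral_right)
    show "\<forall>i\<in>t - t \<inter> B m. u i *\<^sub>R hcomp H m i = 0"
    proof
      fix i assume i: "i \<in> t - t \<inter> B m"
      then obtain k where k: "i \<in> B k" using t by blast
      then have "k \<noteq> m" using i by auto
      with hcomp_homogeneous[OF B_in_H[OF k], of m] show "u i *\<^sub>R hcomp H m i = 0" by simp
    qed
  qed (use t in auto)
  also have "\<dots> = (\<Sum>v\<in>t \<inter> B m. u v *\<^sub>R v)"
    by (rule sum.cong) (auto simp: hcomp_homogeneous[OF B_in_H])
  finally show "u v = 0"
    using independentD[OF independent_B, of "t \<inter> B m" m u v] t m by auto
qed

lemma span_Union_B: "span (\<Union>m. B m) = UNIV"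
proof -
  have "H m \<subseteq> span (\<Union>m. B m)" for m
    unfolding span_B[symmetric] by (rule span_mono) auto
  then have "span (\<Union>m. H m) \<subseteq> span (\<Union>m. B m)" by (intro span_minimal) auto
  with span_homogeneous show ?thesis by auto
qed

lemma linear_basis_coeff: "linear (\<lambda>z. basis_coeff B z y)"
  unfolding basis_coeff_def
  by (rule linearI) (simp_all add: representation_add[OF independent_Union_B]
      representation_scale[OF independent_Union_B] span_Union_B)

lemma basis_coeff_basis: "b \<in> B m \<Longrightarrow> basis_coeff B b y = (if y = b then 1 else 0)"
  unfolding basis_coeff_def by (subst representation_basis[OF independent_Union_B]) auto

lemma basis_expansion:
  assumes "z \<in> H n"
  shows "(\<Sum>y\<in>B n. basis_coeff B z y *\<^sub>R y) = z"
proof (rule linear_eq_on_span)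
  show "linear (\<lambda>z. \<Sum>y\<in>B n. basis_coeff B z y *\<^sub>R y)"
    by (intro linear_compose_sum ballI linear_scaleR_const linear_basis_coeff)
  show "linear (\<lambda>z::'a. z)" by (rule module_hom_ident)
  show "z \<in> span (B n)" using assms span_B by simp
  show "\<And>b. b \<in> B n \<Longrightarrow> (\<Sum>y\<in>B n. basis_coeff B b y *\<^sub>R y) = b"
    by (simp add: basis_coeff_basis finite_B if_distrib[of "\<lambda>r. r *\<^sub>R _"] cong: if_cong)
qed

text \<open>Each factor carries its degree along, because \<open>deals fst\<close> weighs letters by
  it.\<close>

definition factors :: "(nat \<times> 'a) list \<Rightarrow> bool" where
  "factors zs \<longleftrightarrow> (\<forall>(d, x)\<in>set zs. 0 < d \<and> x \<in> B d)"

abbreviation fval :: "(nat \<times> 'a) list \<Rightarrow> 'a" where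
  "fval zs \<equiv> prod_list (map snd zs)"

abbreviation fdeg :: "(nat \<times> 'a) list \<Rightarrow> nat" where
  "fdeg zs \<equiv> sum_list (map fst zs)"

text \<open>The degree \<open>n\<close> part of the \<open>k\<close>-th power of the augmentation ideal.\<close>

definition aug_pow :: "nat \<Rightarrow> nat \<Rightarrow> 'a set" where
  "aug_pow k n = span {fval zs | zs. factors zs \<and> fdeg zs = n \<and> k \<le> length zs}"

lemma factors_append: "factors (zs @ ws) \<longleftrightarrow> factors zs \<and> factors ws"
  by (auto simp: factors_def)

lemma factors_Cons: "factors ((d, x) # zs) \<longleftrightarrow> 0 < d \<and> x \<in> B d \<and> factors zs"
  by (auto simp: factors_def)

lemma factors_mset: "mset zs = mset ws \<Longrightarrow> factors zs \<longleftrightarrow> factors ws"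
  unfolding factors_def using mset_eq_setD[of zs ws] by simp

lemma factors_length: "factors zs \<Longrightarrow> length zs \<le> fdeg zs"
  by (induction zs) (auto simp: factors_def)

lemma fval_aug_pow: "factors zs \<Longrightarrow> k \<le> length zs \<Longrightarrow> fval zs \<in> aug_pow k (fdeg zs)"
  unfolding aug_pow_def by (intro span_base) blast

lemma subspace_aug_pow: "subspace (aug_pow k n)"
  unfolding aug_pow_def by (rule subspace_span)

lemma aug_pow_antimono: "k \<le> l \<Longrightarrow> aug_pow l n \<subseteq> aug_pow k n"
  unfolding aug_pow_def by (rule span_mono) auto

text \<open>Factors have degree at least one, so there are at most \<open>n\<close> of them. The
  filtration is therefore finite, and a congruence modulo one more factor is an equality for
  products of \<open>n\<close> elements of \<open>B 1\<close>.\<close>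

lemma aug_pow_trivial: "n < k \<Longrightarrow> aug_pow k n = {0}"
  unfolding aug_pow_def using factors_length by (subst span_empty[symmetric], intro arg_cong[of _ _ span]) force

lemma linear_mult: "linear (\<lambda>x::'a. x * y)" "linear ((*) (x::'a))"
  by (auto intro!: linearI simp: algebra_simps)

lemma aug_pow_mult:
  assumes "y \<in> aug_pow i p" "z \<in> aug_pow j q"
  shows "y * z \<in> aug_pow (i + j) (p + q)"
  using assms unfolding aug_pow_def
proof (rule span_bilinear_image[of "(*)", OF linear_mult])
  fix a b
  assume "a \<in> {fval zs |zs. factors zs \<and> fdeg zs = p \<and> i \<le> length zs}"
    "b \<in> {fval zs |zs. factors zs \<and> fdeg zs = q \<and> j \<le> length zs}"
  then obtain zs ws where "a = fval zs" "factors zs" "fdeg zs = p" "i \<le> length zs"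
    "b = fval ws" "factors ws" "fdeg ws = q" "j \<le> length ws" by blast
  then show "a * b \<in> span {fval zs |zs. factors zs \<and> fdeg zs = p + q \<and> i + j \<le> length zs}"
    by (intro span_base CollectI exI[of _ "zs @ ws"]) (simp add: factors_append)
qed

lemma prod_in_H: "factors zs \<Longrightarrow> fval zs \<in> H (fdeg zs)"
  by (induction zs) (auto simp: factors_Cons one_in_H0 intro!: mult_graded intro: B_in_H)

lemma aug_pow_in_H: "aug_pow k n \<subseteq> H n"
  unfolding aug_pow_def using prod_in_H by (intro span_minimal subspace_H) auto

lemma H_in_aug_pow: "0 < n \<Longrightarrow> H n \<subseteq> aug_pow 1 n"
proof -
  assume n: "0 < n"
  have "B n \<subseteq> {fval zs | zs. factors zs \<and> fdeg zs = n \<and> 1 \<le> length zs}"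
  proof
    fix b assume "b \<in> B n"
    with n show "b \<in> {fval zs | zs. factors zs \<and> fdeg zs = n \<and> 1 \<le> length zs}"
      by (intro CollectI exI[of _ "[(n, b)]"]) (simp add: factors_def)
  qed
  then show ?thesis unfolding span_B[symmetric] aug_pow_def by (rule span_mono)
qed

section \<open>Coproducts of products modulo more factors\<close>

text \<open>The filtration of the tensor square by the total number of factors, in a fixed total
  degree so that the top layers vanish.\<close>

definition aug_tensor :: "nat \<Rightarrow> nat \<Rightarrow> 'a tensor set" where
  "aug_tensor k n = span {tens [y, z] | y z i j p q. y \<in> aug_pow i p \<and> z \<in> aug_pow j q \<and> k \<le> i + j \<and> p + q = n}"

lemma tens_aug_tensor:
  "y \<in> aug_pow i p \<Longrightarrow> z \<in> aug_pow j q \<Longrightarrow> k \<le> i + j \<Longrightarrow> p + q = n \<Longrightarrow> tens [y, z] \<in> aug_tensor k n"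
  unfolding aug_tensor_def by (intro span_base) blast

lemma subspace_aug_tensor: "subspace (aug_tensor k n)"
  unfolding aug_tensor_def by (rule subspace_span)

lemma aug_tensor_tprod:
  assumes "s \<in> aug_tensor k m" "t \<in> aug_tensor l n"
  shows "tprod s t \<in> aug_tensor (k + l) (m + n)"
  using assms unfolding aug_tensor_def[of k m] aug_tensor_def[of l n] aug_tensor_def[of "k + l"]
proof (rule span_bilinear_image[of tprod, OF linear_tprod_left linear_tprod_right])
  fix a b
  assume "a \<in> {tens [y, z] | y z i j p q. y \<in> aug_pow i p \<and> z \<in> aug_pow j q \<and> k \<le> i + j \<and> p + q = m}"
    "b \<in> {tens [y, z] | y z i j p q. y \<in> aug_pow i p \<and> z \<in> aug_pow j q \<and> l \<le> i + j \<and> p + q = n}"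
  then obtain y z i j p q y' z' i' j' p' q' where
    a: "a = tens [y, z]" "y \<in> aug_pow i p" "z \<in> aug_pow j q" "k \<le> i + j" "p + q = m" and
    b: "b = tens [y', z']" "y' \<in> aug_pow i' p'" "z' \<in> aug_pow j' q'" "l \<le> i' + j'" "p' + q' = n" by blast
  have "tens [y * y', z * z'] \<in> aug_tensor (k + l) (m + n)"
    by (rule tens_aug_tensor[OF aug_pow_mult[OF a(2) b(2)] aug_pow_mult[OF a(3) b(3)]]) (use a b in auto)
  then show "tprod a b \<in> span {tens [y, z] | y z i j p q. y \<in> aug_pow i p \<and> z \<in> aug_pow j q \<and> k + l \<le> i + j \<and> p + q = m + n}"
    unfolding a b by (simp add: tprod_tens aug_tensor_def)
qed

lemma one_aug_pow: "1 \<in> aug_pow 0 0"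
  using fval_aug_pow[of "[]" 0] by (simp add: factors_def)

lemma splits_factors: "(a, b) \<in> set (splits zs) \<Longrightarrow> factors zs \<Longrightarrow> factors a \<and> factors b"
  using splits_set unfolding factors_def by fast

text \<open>The coproduct is multiplicative, and that of one factor is primitive up to an error with
  two factors. Expanding the product, every term that involves an error has at least one factor more
  than the main term.\<close>

lemma coproduct_fval:
  "factors zs \<Longrightarrow> \<Delta> (fval zs) - (\<Sum>(a, b)\<leftarrow>splits zs. tens [fval a, fval b])
     \<in> aug_tensor (Suc (length zs)) (fdeg zs)"
proof (induction zs)
  case Nil
  show ?case by (simp add: coproduct_one subspace_0[OF subspace_aug_tensor])
next
  case (Cons dx zs)
  obtain d x where dx: "dx = (d, x)" by force
  with Cons.prems have d: "0 < d" and x: "x \<in> B d" and zs: "factors zs" by (auto simp: factors_Cons)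
  define P where "P = tens [x, 1] + tens [1, x]"
  define Q where "Q = (\<Sum>(a, b)\<leftarrow>splits zs. tens [fval a, fval b])"
  define r where "r = \<Delta> x - P"
  define r' where "r' = \<Delta> (fval zs) - Q"
  have x1: "x \<in> aug_pow 1 d" using H_in_aug_pow[OF d] B_in_H[OF x] by auto
  have "r \<in> span {tens [y, z] | y z i j. 0 < i \<and> 0 < j \<and> i + j = d \<and> y \<in> H i \<and> z \<in> H j}"
    unfolding r_def P_def by (rule coproduct_primitive_mod[OF B_in_H[OF x] d])
  also have "\<dots> \<subseteq> aug_tensor 2 d"
  proof (rule span_minimal[OF _ subspace_aug_tensor], rule subsetI, clarify)
    fix y z i j assume "0 < i" "0 < j" "y \<in> H i" "z \<in> H j" "d = i + j"
    then show "tens [y, z] \<in> aug_tensor 2 (i + j)"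
      using H_in_aug_pow[of i] H_in_aug_pow[of j] by (intro tens_aug_tensor[of y 1 i z 1 j]) auto
  qed
  finally have r: "r \<in> aug_tensor 2 d" .
  have r': "r' \<in> aug_tensor (Suc (length zs)) (fdeg zs)"
    unfolding r'_def Q_def by (rule Cons.IH[OF zs])
  have P: "P \<in> aug_tensor 1 d"
    unfolding P_def
    by (intro subspace_add[OF subspace_aug_tensor] tens_aug_tensor[OF x1 one_aug_pow] tens_aug_tensor[OF one_aug_pow x1]) auto
  have Q: "Q \<in> aug_tensor (length zs) (fdeg zs)"
    unfolding Q_def aug_tensor_def
  proof (rule span_sum_list)
    fix s assume s: "s \<in> set (splits zs)"
    obtain a b where ab: "s = (a, b)" by force
    have "tens [fval a, fval b] \<in> aug_tensor (length zs) (fdeg zs)"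
      using splits_factors[of a b zs] splits_length[of a b zs] splits_sum[of a b zs fst] s ab zs
      by (intro tens_aug_tensor[OF fval_aug_pow[OF _ order_refl] fval_aug_pow[OF _ order_refl]]) auto
    then show "(case s of (a, b) \<Rightarrow> tens [fval a, fval b]) \<in> span {tens [y, z] | y z i j p q.
        y \<in> aug_pow i p \<and> z \<in> aug_pow j q \<and> length zs \<le> i + j \<and> p + q = fdeg zs}"
      by (simp add: ab aug_tensor_def)
  qed
  \<comment> \<open>Left multiplication by \<open>tens [x, 1] + tens [1, x]\<close> is the recursion
    of \<open>splits\<close>.\<close>
  have PQ: "tprod P Q = (\<Sum>(a, b)\<leftarrow>splits (dx # zs). tens [fval a, fval b])"
    unfolding P_def Q_def dx
    by (simp add: linear_add[OF linear_tprod_left] linear_sum_list[OF linear_tprod_right] case_prod_unfold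
        o_def tprod_tens sum_list_addf)
  have "\<Delta> (fval (dx # zs)) = tprod (P + r) (Q + r')"
    by (simp add: dx coproduct_mult r_def r'_def)
  also have "\<dots> = tprod P Q + (tprod P r' + tprod r Q + tprod r r')"
    by (simp add: linear_add[OF linear_tprod_left] linear_add[OF linear_tprod_right])
  finally have "\<Delta> (fval (dx # zs)) - (\<Sum>(a, b)\<leftarrow>splits (dx # zs). tens [fval a, fval b]) =
      tprod P r' + tprod r Q + tprod r r'" by (simp add: PQ)
  moreover have "tprod P r' \<in> aug_tensor (Suc (length (dx # zs))) (fdeg (dx # zs))"
    using aug_tensor_tprod[OF P r'] by (simp add: dx)
  moreover have "tprod r Q \<in> aug_tensor (Suc (length (dx # zs))) (fdeg (dx # zs))"
    using aug_tensor_tprod[OF r Q] by (simp add: dx)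
  moreover have "tprod r r' \<in> aug_tensor (Suc (length (dx # zs))) (fdeg (dx # zs))"
  proof -
    have "aug_tensor (Suc (Suc (Suc (length zs)))) n \<subseteq> aug_tensor (Suc (Suc (length zs))) n" for n
      unfolding aug_tensor_def by (rule span_mono) force
    with aug_tensor_tprod[OF r r'] show ?thesis by (auto simp: dx)
  qed
  ultimately show ?case by (simp only: subspace_add[OF subspace_aug_tensor])
qed

lemma deals_factors: "ys \<in> set (deals fst D zs) \<Longrightarrow> factors zs \<Longrightarrow> factors ys"
  using factors_mset[OF deals_mset] by blast

lemma deals_fdeg: "ys \<in> set (deals fst D zs) \<Longrightarrow> fdeg ys = fdeg zs"
  using deals_mset by (metis mset_map sum_mset_sum_list)

text \<open>The projection \<open>hcomp H d\<close> keeps the splits whose left half has degree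
  \<open>d\<close>; the induction hypothesis deals the right half. The error of the coproduct also
  passes through \<open>mcop D\<close>, so that map has to respect the filtration.\<close>

lemma mcop_fval:
  "factors zs \<Longrightarrow> fdeg zs = sum_list D \<Longrightarrow>
     mcop D (fval zs) - (\<Sum>ys\<leftarrow>deals fst D zs. fval ys) \<in> aug_pow (Suc (length zs)) (fdeg zs)"
proof (induction D arbitrary: zs)
  case Nil
  then have "length zs \<le> 0" using factors_length[of zs] by (simp del: sum_list_eq_0_iff)
  then have "zs = []" by simp
  then show ?case by (simp add: mcop_Nil counit_one subspace_0[OF subspace_aug_pow])
next
  case (Cons d D)
  let ?J = "aug_pow (Suc (length zs)) (fdeg zs)"
  \<comment> \<open>Main term and error in the induction hypothesis both keep at least as many
    factors as the argument.\<close>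
  have mcop_aug: "mcop D z \<in> aug_pow k (sum_list D)" if "z \<in> aug_pow k (sum_list D)" for k z
    using that unfolding aug_pow_def
  proof (rule linear_image_span[OF linear_mcop])
    fix a assume "a \<in> {fval zs |zs. factors zs \<and> fdeg zs = sum_list D \<and> k \<le> length zs}"
    then obtain ws where ws: "a = fval ws" "factors ws" "fdeg ws = sum_list D" "k \<le> length ws" by blast
    have "(\<Sum>ys\<leftarrow>deals fst D ws. fval ys) \<in> aug_pow k (sum_list D)"
      unfolding aug_pow_def
    proof (rule span_sum_list)
      fix ys assume ys: "ys \<in> set (deals fst D ws)"
      show "fval ys \<in> span {fval zs |zs. factors zs \<and> fdeg zs = sum_list D \<and> k \<le> length zs}"
        using deals_factors[OF ys ws(2)] deals_fdeg[OF ys] mset_eq_length[OF deals_mset[OF ys]] ws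
        by (intro span_base) auto
    qed
    moreover have "mcop D a - (\<Sum>ys\<leftarrow>deals fst D ws. fval ys) \<in> aug_pow k (sum_list D)"
      using Cons.IH[OF ws(2,3)] aug_pow_antimono[of k "Suc (length ws)" "fdeg ws"] ws by auto
    ultimately show "mcop D a \<in> span {fval zs |zs. factors zs \<and> fdeg zs = sum_list D \<and> k \<le> length zs}"
      using subspace_add[OF subspace_aug_pow[of k "sum_list D"]] unfolding aug_pow_def by fastforce
  qed
  have err: "mcop_step d D t \<in> ?J" if "t \<in> aug_tensor (Suc (length zs)) (fdeg zs)" for t
    using that unfolding aug_tensor_def aug_pow_def[of "Suc (length zs)"]
  proof (rule linear_image_span[OF linear_mcop_step])
    fix t assume "t \<in> {tens [y, z] | y z i j p q. y \<in> aug_pow i p \<and> z \<in> aug_pow j q \<and> Suc (length zs) \<le> i + j \<and> p + q = fdeg zs}"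
    then obtain y z i j p q where t: "t = tens [y, z]" "y \<in> aug_pow i p" "z \<in> aug_pow j q"
      "Suc (length zs) \<le> i + j" "p + q = fdeg zs" by blast
    have "hcomp H d y * mcop D z \<in> ?J"
    \<comment> \<open>Only \<open>p = d\<close> survives the projection, and then \<open>z\<close>
      has degree \<open>sum_list D\<close>, where \<open>mcop_aug\<close> applies.\<close>
    proof (cases "p = d")
      case True
      then have q: "q = sum_list D" using t(5) Cons.prems(2) by simp
      have "hcomp H d y = y" using subsetD[OF aug_pow_in_H t(2)] True by (simp add: hcomp_homogeneous)
      then have "hcomp H d y * mcop D z \<in> aug_pow (i + j) (p + q)"
        using aug_pow_mult[OF t(2) mcop_aug] t(3) q by auto
      then show ?thesis using aug_pow_antimono[OF t(4)] t(5) by auto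
    next
      case False
      have "hcomp H d y = 0" using t(2) aug_pow_in_H False hcomp_homogeneous[of y p d] by auto
      then show ?thesis by (simp add: subspace_0[OF subspace_aug_pow])
    qed
    then show "mcop_step d D t \<in> span {fval ws |ws. factors ws \<and> fdeg ws = fdeg zs \<and> Suc (length zs) \<le> length ws}"
      by (simp add: t(1) mcop_step_tens aug_pow_def)
  qed
  define g where "g = (\<lambda>(a, b). \<Sum>ys\<leftarrow>(if fdeg a = d then map ((@) a) (deals fst D b) else []). fval ys)"
  have split: "mcop_step d D (case s of (a, b) \<Rightarrow> tens [fval a, fval b]) - g s \<in> ?J"
    if "s \<in> set (splits zs)" for s
  proof -
    obtain a b where s: "s = (a, b)" by force
    have fab: "factors a" "factors b" using splits_factors[of a b zs] that s Cons.prems by auto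
    have len: "length a + length b = length zs" using splits_length that s by blast
    have deg: "fdeg a + fdeg b = fdeg zs" using splits_sum that s by blast
    show ?thesis
    proof (cases "fdeg a = d")
      case True
      have "hcomp H d (fval a) = fval a" using prod_in_H[OF fab(1)] True hcomp_homogeneous by auto
      then have "mcop_step d D (case s of (a, b) \<Rightarrow> tens [fval a, fval b]) - g s =
          fval a * (mcop D (fval b) - (\<Sum>ys\<leftarrow>deals fst D b. fval ys))"
        using True by (simp add: s g_def mcop_step_tens right_diff_distrib sum_list_const_mult o_def)
      moreover have "fval a * (mcop D (fval b) - (\<Sum>ys\<leftarrow>deals fst D b. fval ys)) \<in>
          aug_pow (length a + Suc (length b)) (fdeg a + fdeg b)"
        by (intro aug_pow_mult fval_aug_pow Cons.IH fab) (use True deg Cons.prems in auto)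
      ultimately show ?thesis using len deg by simp
    next
      case False
      then have "hcomp H d (fval a) = 0" using hcomp_homogeneous[OF prod_in_H[OF fab(1)], of d] by auto
      with False show ?thesis by (simp add: s g_def mcop_step_tens subspace_0[OF subspace_aug_pow])
    qed
  qed
  let ?R = "\<Delta> (fval zs) - (\<Sum>(a, b)\<leftarrow>splits zs. tens [fval a, fval b])"
  have "(\<Sum>ys\<leftarrow>concat (map (\<lambda>(a, b). if fdeg a = d then map ((@) a) (deals fst D b) else []) L). fval ys) =
      (\<Sum>s\<leftarrow>L. g s)" for L
    by (induction L) (auto simp: g_def)
  then have deal: "(\<Sum>ys\<leftarrow>deals fst (d # D) zs. fval ys) = (\<Sum>s\<leftarrow>splits zs. g s)" by simp
  have "mcop (d # D) (fval zs) = mcop_step d D (?R + (\<Sum>(a, b)\<leftarrow>splits zs. tens [fval a, fval b]))"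
    by (simp add: mcop_Cons)
  also have "\<dots> = mcop_step d D ?R +
      (\<Sum>s\<leftarrow>splits zs. mcop_step d D (case s of (a, b) \<Rightarrow> tens [fval a, fval b]))"
    unfolding linear_add[OF linear_mcop_step] linear_sum_list[OF linear_mcop_step] ..
  finally have "mcop (d # D) (fval zs) - (\<Sum>ys\<leftarrow>deals fst (d # D) zs. fval ys) = mcop_step d D ?R +
      (\<Sum>s\<leftarrow>splits zs. mcop_step d D (case s of (a, b) \<Rightarrow> tens [fval a, fval b]) - g s)"
    unfolding deal sum_list_subtractf by simp
  moreover have "mcop_step d D ?R \<in> ?J"
    by (rule err) (rule coproduct_fval[OF Cons.prems(1)])
  moreover have "(\<Sum>s\<leftarrow>splits zs. mcop_step d D (case s of (a, b) \<Rightarrow> tens [fval a, fval b]) - g s) \<in> ?J"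
    using split unfolding aug_pow_def by (rule span_sum_list)
  ultimately show ?case by (simp only: subspace_add[OF subspace_aug_pow])
qed

end

section \<open>Products of elements of degree one\<close>

lemma permute_sum_mset_cong:
  fixes h :: "'b list \<Rightarrow> 'c::comm_monoid_add"
  assumes "mset cs = mset ds"
  shows "(\<Sum>\<sigma> | \<sigma> permutes {..<length cs}. h (permute_list \<sigma> cs)) =
    (\<Sum>\<sigma> | \<sigma> permutes {..<length ds}. h (permute_list \<sigma> ds))"
proof -
  obtain \<tau> where \<tau>: "\<tau> permutes {..<length ds}" and cs: "permute_list \<tau> ds = cs"
    using mset_eq_permutation[OF assms] by blast
  have "(\<Sum>\<sigma> | \<sigma> permutes {..<length ds}. h (permute_list \<sigma> ds)) =
      (\<Sum>\<sigma> | \<sigma> permutes {..<length ds}. h (permute_list (\<tau> \<circ> \<sigma>) ds))"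
    by (rule setum_permutations_compose_left[OF \<tau>])
  also have "\<dots> = (\<Sum>\<sigma> | \<sigma> permutes {..<length ds}. h (permute_list \<sigma> cs))"
    using \<tau> by (intro sum.cong refl) (simp add: permute_list_compose cs)
  finally show ?thesis using mset_eq_length[OF assms] by simp
qed

context graded_hopf_basis
begin

declare One_nat_def [simp del]

lemma factors_Pair_1: "set cs \<subseteq> B 1 \<Longrightarrow> factors (map (Pair 1) cs)"
  by (auto simp: factors_def)

lemma fval_Pair: "fval (map (Pair d) cs) = prod_list cs"
  by (simp add: o_def)

lemma fdeg_Pair_1: "fdeg (map (Pair 1) cs) = length cs"
  by (simp add: o_def sum_list_triv)

lemma deals_Pair_1: "deals fst D (map (Pair 1) cs) = map (map (Pair 1)) (deals (\<lambda>_. 1) D cs)"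
  using deals_map[of fst D "Pair 1" cs] by simp

text \<open>The error has more factors than its degree permits, hence is zero.\<close>

lemma mcop_prod_list:
  assumes "set cs \<subseteq> B 1" "length cs = sum_list D"
  shows "mcop D (prod_list cs) = (\<Sum>ys\<leftarrow>deals (\<lambda>_. 1) D cs. prod_list ys)"
proof -
  have "mcop D (fval (map (Pair 1) cs)) - (\<Sum>ys\<leftarrow>deals fst D (map (Pair 1) cs). fval ys) \<in>
      aug_pow (Suc (length (map (Pair (1::nat)) cs))) (fdeg (map (Pair 1) cs))"
    by (rule mcop_fval[OF factors_Pair_1[OF assms(1)]]) (simp only: fdeg_Pair_1 assms(2))
  then show ?thesis
    unfolding fval_Pair fdeg_Pair_1 deals_Pair_1 length_map aug_pow_trivial[OF lessI] by (simp add: o_def)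
qed

lemma aug_tensor_trivial: "aug_tensor (Suc n) n = {0}"
proof -
  have "tens [y, z] = 0" if "y \<in> aug_pow i p" "z \<in> aug_pow j q" "Suc n \<le> i + j" "p + q = n" for y z i j p q
  proof -
    have "p < i \<or> q < j" using that by linarith
    then have "y = 0 \<or> z = 0" using aug_pow_trivial that by blast
    then show ?thesis
      using linear_0[OF multilinear_linear[OF multilinear_tens, of "[]" "[z]"]]
        linear_0[OF multilinear_linear[OF multilinear_tens, of "[y]" "[]"]] by auto
  qed
  then have "{tens [y, z] | y z i j p q. y \<in> aug_pow i p \<and> z \<in> aug_pow j q \<and> Suc n \<le> i + j \<and> p + q = n} \<subseteq> {0}"
    by blast
  from span_mono[OF this] have "aug_tensor (Suc n) n \<subseteq> {0}" by (simp add: aug_tensor_def)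
  then show ?thesis using subspace_0[OF subspace_aug_tensor] by auto
qed

lemma coproduct_prod_list:
  assumes "set cs \<subseteq> B 1"
  shows "\<Delta> (prod_list cs) = (\<Sum>(a, b)\<leftarrow>splits cs. tens [prod_list a, prod_list b])"
proof -
  have "\<Delta> (fval (map (Pair 1) cs)) - (\<Sum>(a, b)\<leftarrow>splits (map (Pair 1) cs). tens [fval a, fval b]) \<in>
      aug_tensor (Suc (length (map (Pair (1::nat)) cs))) (fdeg (map (Pair 1) cs))"
    by (rule coproduct_fval[OF factors_Pair_1[OF assms(1)]])
  then show ?thesis
    unfolding fval_Pair fdeg_Pair_1 splits_map length_map aug_tensor_trivial
    by (simp add: case_prod_unfold o_def)
qed

lemma prod_list_in_H: "set cs \<subseteq> B 1 \<Longrightarrow> prod_list cs \<in> H (length cs)"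
  using prod_in_H[OF factors_Pair_1, of cs] unfolding fval_Pair fdeg_Pair_1 .

text \<open>Every pile is a single letter, as \<open>hcomp H 1\<close> kills all products of another
  length. The result is an identity of tensors, before any multiplication, as needed for
  \<open>eta\<close> and for independence.\<close>

lemma coprod_ones_prod_list:
  "set cs \<subseteq> B 1 \<Longrightarrow> length cs = n \<Longrightarrow>
    coprod (replicate n 1) (prod_list cs) = (\<Sum>ys\<leftarrow>deals (\<lambda>_. 1) (replicate n 1) cs. tens ys)"
proof (induction n arbitrary: cs)
  case 0
  then show ?case by (simp add: coprod_Nil counit_one)
next
  case (Suc n)
  let ?D = "replicate n 1"
  let ?f = "\<lambda>y. tens1 (hcomp H 1 y)"
  have step: "tconc (?f (prod_list a)) (coprod ?D (prod_list b)) =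
      (\<Sum>ys\<leftarrow>(if length a = 1 then map ((@) a) (deals (\<lambda>_. 1) ?D b) else []). tens ys)"
    if ab: "(a, b) \<in> set (splits cs)" for a b
  proof (cases "length a = 1")
    case True
    then obtain c where a: "a = [c]" by (cases a) auto
    have sub: "set a \<subseteq> B 1" "set b \<subseteq> B 1" using splits_set[OF ab] Suc.prems by auto
    have "length b = n" using splits_length[OF ab] True Suc.prems by simp
    then have "coprod ?D (prod_list b) = (\<Sum>ys\<leftarrow>deals (\<lambda>_. 1) ?D b. tens ys)" by (rule Suc.IH[OF sub(2)])
    moreover have "?f (prod_list a) = tens1 c"
      using sub a by (simp add: hcomp_homogeneous[OF B_in_H])
    ultimately show ?thesis
      using True a by (simp add: linear_sum_list[OF linear_tconc_right] tconc_tens o_def)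
  next
    case False
    have "set a \<subseteq> B 1" using splits_set[OF ab] Suc.prems by auto
    then have "hcomp H 1 (prod_list a) = 0" using hcomp_homogeneous[OF prod_list_in_H] False by auto
    then show ?thesis using False
      by (simp add: linear_0[OF linear_tens1] linear_0[OF linear_tconc_left] sum_list_triv)
  qed
  have "coprod (replicate (Suc n) 1) (prod_list cs) = tmap [?f, coprod ?D] (\<Delta> (prod_list cs))"
    by (simp add: coprod_Cons conv_def)
  also have "\<dots> = (\<Sum>(a, b)\<leftarrow>splits cs. tconc (?f (prod_list a)) (coprod ?D (prod_list b)))"
    unfolding coproduct_prod_list[OF Suc.prems(1)] linear_sum_list[OF linear_tmap] case_prod_unfold
    by (simp add: tmap_pair[OF linear_tens1_hcomp linear_coprod])
  also have "\<dots> = (\<Sum>(a, b)\<leftarrow>splits cs. \<Sum>ys\<leftarrow>(if length a = 1 then map ((@) a) (deals (\<lambda>_. 1) ?D b) else []). tens ys)"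
    by (intro arg_cong[of _ _ sum_list] map_cong refl) (use step in auto)
  also have "\<dots> = (\<Sum>ys\<leftarrow>deals (\<lambda>_. 1) (replicate (Suc n) 1) cs. tens ys)"
  proof -
    have "(\<Sum>ys\<leftarrow>concat (map (\<lambda>(a, b). if length a = 1 then map ((@) a) (deals (\<lambda>_. 1) ?D b) else []) L). tens ys) =
      (\<Sum>(a, b)\<leftarrow>L. \<Sum>ys\<leftarrow>(if length a = 1 then map ((@) a) (deals (\<lambda>_. 1) ?D b) else []). tens ys)" for L :: "('a list \<times> 'a list) list"
      by (induction L) auto
    then show ?thesis by (simp add: sum_list_triv)
  qed
  finally show ?case .
qed

section \<open>Dual words and the functional eta\<close>

definition words :: "nat \<Rightarrow> 'a list set" where
  "words n = {bs. set bs \<subseteq> B 1 \<and> length bs = n}"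

lemma finite_words: "finite (words n)"
  unfolding words_def by (rule finite_lists_length_eq[OF finite_B])

lemma tensor_basis_ones: "tensor_basis B (replicate n 1) = tens ` words n"
proof -
  have "list_all2 (\<lambda>d b. b \<in> B d) (replicate n 1) bs \<longleftrightarrow> bs \<in> words n" for bs
    unfolding words_def by (induction n arbitrary: bs) (auto simp: list_all2_Cons1 length_Suc_conv)
  then show ?thesis by (auto simp: tensor_basis_def)
qed

text \<open>The coordinate functional of \<open>tens ds\<close>: a product of coordinates, zero on
  tensors of any other length.\<close>

definition word_dual :: "'a list \<Rightarrow> 'a tensor \<Rightarrow> real" where
  "word_dual ds = tlift (\<lambda>xs. if length xs = length ds
     then prod_list (map2 (\<lambda>d x. basis_coeff B x d) ds xs) else 0)"

lemma linear_word_dual: "linear (word_dual ds)"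
  unfolding word_dual_def by (rule linear_tlift)

lemma multilinear_word_dual:
  "multilinear (\<lambda>xs. if length xs = length ds
     then prod_list (map2 (\<lambda>d x. basis_coeff B x d) ds xs) else 0)"
  unfolding multilinear_def
proof (intro allI)
  fix xs ys
  show "linear (\<lambda>x. if length (xs @ x # ys) = length ds
     then prod_list (map2 (\<lambda>d x. basis_coeff B x d) ds (xs @ x # ys)) else 0)"
  proof (induction xs arbitrary: ds)
    case Nil
    show ?case
    proof (cases "length ds = Suc (length ys)")
      case True
      then obtain e es where ds: "ds = e # es" "length es = length ys" by (cases ds) auto
      have "linear (\<lambda>x. basis_coeff B x e *\<^sub>R prod_list (map2 (\<lambda>d x. basis_coeff B x d) es ys))"
        by (intro linear_scaleR_const linear_basis_coeff)
      then show ?thesis using ds by simp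
    qed (auto simp: linear_zero)
  next
    case (Cons z xs)
    show ?case
    proof (cases ds)
      case ds: (Cons e es)
      have "linear (\<lambda>x. basis_coeff B z e *\<^sub>R (if length (xs @ x # ys) = length es
        then prod_list (map2 (\<lambda>d x. basis_coeff B x d) es (xs @ x # ys)) else 0))"
        by (intro linear_compose_scale_right Cons.IH)
      then show ?thesis using ds by (simp add: if_distrib cong: if_cong)
    qed (simp add: linear_zero)
  qed
qed

lemma word_dual_tens:
  assumes "set bs \<subseteq> B 1"
  shows "word_dual ds (tens bs) = (if bs = ds then 1 else 0)"
proof -
  have "set bs \<subseteq> B 1 \<Longrightarrow> length bs = length ds \<Longrightarrow>
      prod_list (map2 (\<lambda>d x. basis_coeff B x d) ds bs) = (if bs = ds then 1 else 0)" for bs ds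
  proof (induction bs arbitrary: ds)
    case (Cons b bs)
    then obtain e es where "ds = e # es" "length es = length bs" by (cases ds) auto
    with Cons show ?case by (simp add: basis_coeff_basis[of _ 1])
  qed simp
  with assms show ?thesis
    unfolding word_dual_def by (auto simp: tlift_tens[OF multilinear_word_dual])
qed

lemma word_dual_tens_eq:
  assumes "set bs \<subseteq> B 1" "set ds \<subseteq> B 1"
  shows "word_dual ds (tens bs) = (if tens bs = tens ds then 1 else 0)"
  using word_dual_tens[OF assms(1), of ds] word_dual_tens[OF assms(2), of ds] by (auto split: if_splits)

text \<open>The functionals \<open>word_dual ds\<close> are biorthogonal to these tensors.\<close>

lemma independent_tensor_basis_ones: "independent (tensor_basis B (replicate n 1))"
  unfolding independent_explicit_module tensor_basis_ones
proof (intro allI impI)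
  fix t u v assume t: "finite t" "t \<subseteq> tens ` words n" "(\<Sum>v\<in>t. u v *\<^sub>R v) = 0" "v \<in> t"
  then obtain ds where ds: "ds \<in> words n" "v = tens ds" by blast
  have "0 = word_dual ds (\<Sum>v\<in>t. u v *\<^sub>R v)" by (simp add: t linear_0[OF linear_word_dual])
  also have "\<dots> = (\<Sum>w\<in>t. u w * word_dual ds w)"
    by (simp add: linear_sum[OF linear_word_dual] linear_cmul[OF linear_word_dual])
  also have "\<dots> = (\<Sum>w\<in>t. u w * (if w = v then 1 else 0))"
  proof (rule sum.cong[OF refl])
    fix w assume "w \<in> t"
    then obtain bs where "bs \<in> words n" "w = tens bs" using t by blast
    then show "u w * word_dual ds w = u w * (if w = v then 1 else 0)"
      using ds word_dual_tens_eq by (auto simp: words_def)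
  qed
  also have "\<dots> = u v" using t by (simp add: if_distrib cong: if_cong)
  finally show "u v = 0" by simp
qed

text \<open>Together with independence this ensures that the \<open>representation\<close> in
  \<open>eta\<close> consists of true coordinates.\<close>

lemma coprod_ones_in_span: "coprod (replicate n 1) x \<in> span (tensor_basis B (replicate n 1))"
proof (induction n arbitrary: x)
  case 0
  show ?case by (auto simp: coprod_Nil tensor_basis_def intro: span_scale span_base)
next
  case (Suc n)
  have "tmap [\<lambda>y. tens1 (hcomp H 1 y), coprod (replicate n 1)] (\<Delta> x) \<in> span (tensor_basis B (replicate (Suc n) 1))"
  proof (rule linear_image_span[OF linear_tmap coproduct_in], clarify)
    fix y z
    have "tconc (tens1 (hcomp H 1 y)) (coprod (replicate n 1) z) \<in> span (tensor_basis B (replicate (Suc n) 1))"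
    proof (rule span_bilinear_image[of "\<lambda>a. tconc (tens1 a)", OF _ linear_tconc_right _ Suc.IH])
      show "linear (\<lambda>a. tconc (tens1 a) t)" for t
        using linear_compose[OF linear_tens1 linear_tconc_left] by (simp add: o_def)
      show "hcomp H 1 y \<in> span (B 1)" by (simp add: span_B hcomp_in)
      fix a b assume "a \<in> B 1" "b \<in> tensor_basis B (replicate n 1)"
      then obtain bs where "b = tens bs" "a # bs \<in> words (Suc n)"
        unfolding tensor_basis_ones by (auto simp: words_def)
      then show "tconc (tens1 a) b \<in> span (tensor_basis B (replicate (Suc n) 1))"
        unfolding tensor_basis_ones by (intro span_base) (auto simp: tconc_tens)
    qed
    then show "tmap [\<lambda>y. tens1 (hcomp H 1 y), coprod (replicate n 1)] (tens [y, z]) \<in> span (tensor_basis B (replicate (Suc n) 1))"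
      by (simp add: tmap_pair linear_tens1_hcomp linear_coprod)
  qed
  then show ?case by (simp add: coprod_Cons conv_def)
qed

abbreviation \<eta> :: "'a \<Rightarrow> real" where
  "\<eta> \<equiv> eta \<Delta> \<epsilon> H B"

text \<open>A linear functional that agrees with \<open>\<eta>\<close> on \<open>H n\<close>; it
  avoids the sum over degrees in \<open>eta\<close>.\<close>

definition eta_deg :: "nat \<Rightarrow> 'a \<Rightarrow> real" where
  "eta_deg n x = (\<Sum>ds\<in>words n. word_dual ds (coprod (replicate n 1) x))"

lemma linear_eta_deg: "linear (eta_deg n)"
  unfolding eta_deg_def[abs_def]
  using linear_compose[OF linear_coprod linear_word_dual] by (intro linear_compose_sum) (simp add: o_def)

lemma eta_eq_eta_deg:
  assumes "x \<in> H n"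
  shows "\<eta> x = eta_deg n x"
proof (cases "x = 0")
  case True
  then show ?thesis
    using linear_0[OF linear_eta_deg] by (simp add: eta_def linear_0[OF linear_hcomp])
next
  case False
  let ?TB = "tensor_basis B (replicate n 1)" and ?t = "coprod (replicate n 1) x"
  have fin: "finite ?TB" by (simp add: tensor_basis_ones finite_words)
  have one: "(\<Sum>ds\<in>words n. word_dual ds s) = 1" if s: "s \<in> ?TB" for s
  proof -
    obtain bs where bs: "bs \<in> words n" "s = tens bs" using s unfolding tensor_basis_ones by blast
    then have "(\<Sum>ds\<in>words n. word_dual ds s) = (\<Sum>ds\<in>words n. if bs = ds then 1 else 0)"
      by (intro sum.cong refl) (auto simp: word_dual_tens words_def)
    also have "\<dots> = 1" using bs finite_words by simp
    finally show ?thesis .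
  qed
  have "{m. hcomp H m x \<noteq> 0} = {n}" using False assms by (auto simp: hcomp_homogeneous)
  then have "\<eta> x = (\<Sum>s\<in>?TB. representation ?TB ?t s)"
    using assms by (simp add: eta_def hcomp_homogeneous)
  also have "\<dots> = (\<Sum>s\<in>?TB. representation ?TB ?t s * (\<Sum>ds\<in>words n. word_dual ds s))"
    by (simp add: one)
  also have "\<dots> = (\<Sum>ds\<in>words n. word_dual ds (\<Sum>s\<in>?TB. representation ?TB ?t s *\<^sub>R s))"
    unfolding linear_sum[OF linear_word_dual] linear_cmul[OF linear_word_dual] sum_distrib_left
    by (subst sum.swap) simp
  also have "\<dots> = eta_deg n x"
    unfolding sum_representation_eq[OF independent_tensor_basis_ones coprod_ones_in_span fin order_refl]
      eta_deg_def ..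
  finally show ?thesis .
qed

lemma multinomial_ones: "multinomial n (replicate n 1) = fact n"
  by (simp add: multinomial_def)

text \<open>Each of the \<open>fact n\<close> deals into single letters contributes one basis tensor
  with coefficient one.\<close>

lemma eta_deg_prod_list:
  assumes "cs \<in> words n"
  shows "eta_deg n (prod_list cs) = fact n"
proof -
  have cs: "set cs \<subseteq> B 1" "length cs = n" using assms by (auto simp: words_def)
  have "eta_deg n (prod_list cs) = (\<Sum>ys\<leftarrow>deals (\<lambda>_. 1) (replicate n 1) cs. \<Sum>ds\<in>words n. word_dual ds (tens ys))"
    unfolding eta_deg_def coprod_ones_prod_list[OF cs]
    by (rule linear_sum_list[of "\<lambda>t. \<Sum>ds\<in>words n. word_dual ds t"]) (intro linear_compose_sum ballI linear_word_dual)
  also have "\<dots> = (\<Sum>ys\<leftarrow>deals (\<lambda>_. 1) (replicate n 1) cs. 1)"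
  proof (intro arg_cong[of _ _ sum_list] map_cong refl)
    fix ys assume "ys \<in> set (deals (\<lambda>_. 1) (replicate n 1) cs)"
    then have "mset ys = mset cs" by (rule deals_mset)
    from mset_eq_setD[OF this] mset_eq_length[OF this] have ys: "ys \<in> words n" using cs by (simp add: words_def)
    then have "(\<Sum>ds\<in>words n. word_dual ds (tens ys)) = (\<Sum>ds\<in>words n. if ys = ds then 1 else 0)"
      by (intro sum.cong refl) (auto simp: word_dual_tens words_def)
    then show "(\<Sum>ds\<in>words n. word_dual ds (tens ys)) = 1" using ys finite_words by simp
  qed
  also have "\<dots> = multinomial n (replicate n 1)"
    using length_deals_one[of cs "replicate n 1"] cs by (simp add: sum_list_triv sum_list_replicate)
  finally show ?thesis by (simp add: multinomial_ones)
qed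

section \<open>Symmetrised products\<close>

definition sym_prod :: "'a list \<Rightarrow> 'a" where
  "sym_prod cs = (\<Sum>\<sigma> | \<sigma> permutes {..<length cs}. prod_list (permute_list \<sigma> cs))"

lemma permute_list_words: "cs \<in> words n \<Longrightarrow> \<sigma> permutes {..<n} \<Longrightarrow> permute_list \<sigma> cs \<in> words n"
  by (auto simp: words_def)

lemma sym_prod_in_H: "cs \<in> words n \<Longrightarrow> sym_prod cs \<in> H n"
  unfolding sym_prod_def
proof (rule subspace_sum[OF subspace_H])
  fix \<sigma> assume "cs \<in> words n" "\<sigma> \<in> {\<sigma>. \<sigma> permutes {..<length cs}}"
  then have "permute_list \<sigma> cs \<in> words n" by (intro permute_list_words) (auto simp: words_def)
  then show "prod_list (permute_list \<sigma> cs) \<in> H n" using prod_list_in_H[of "permute_list \<sigma> cs"] by (simp add: words_def)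
qed

lemma pi_list_eq:
  "cs \<in> words n \<Longrightarrow> pi_list \<Delta> \<epsilon> H B cs x = \<eta> x / (fact n)\<^sup>2 * basis_coeff B (sym_prod cs) x"
  by (simp add: pi_list_def sym_prod_def words_def linear_sum[OF linear_basis_coeff])

text \<open>One \<open>fact n\<close> comes from the permutations and one from the deals of each
  word; this explains the constant in \<open>pi_list\<close>.\<close>

lemma eta_deg_sym_prod: "cs \<in> words n \<Longrightarrow> eta_deg n (sym_prod cs) = (fact n)\<^sup>2"
proof -
  assume cs: "cs \<in> words n"
  then have n: "length cs = n" by (simp add: words_def)
  have "eta_deg n (sym_prod cs) = (\<Sum>\<sigma> | \<sigma> permutes {..<n}. fact n)"
    unfolding sym_prod_def linear_sum[OF linear_eta_deg] n
    by (intro sum.cong refl) (simp add: eta_deg_prod_list permute_list_words[OF cs])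
  then show ?thesis by (simp add: card_permutations[of "{..<n}" n] power2_eq_square)
qed

lemma sum_pi_list:
  assumes cs: "cs \<in> words n"
  shows "(\<Sum>x\<in>B n. pi_list \<Delta> \<epsilon> H B cs x) = 1"
proof -
  have "(\<Sum>x\<in>B n. pi_list \<Delta> \<epsilon> H B cs x) = (\<Sum>x\<in>B n. basis_coeff B (sym_prod cs) x * eta_deg n x) / (fact n)\<^sup>2"
    unfolding sum_divide_distrib
    by (intro sum.cong refl) (simp add: pi_list_eq[OF cs] eta_eq_eta_deg[OF B_in_H] mult.commute)
  also have "(\<Sum>x\<in>B n. basis_coeff B (sym_prod cs) x * eta_deg n x) =
      eta_deg n (\<Sum>x\<in>B n. basis_coeff B (sym_prod cs) x *\<^sub>R x)"
    by (simp add: linear_sum[OF linear_eta_deg] linear_cmul[OF linear_eta_deg])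
  also have "\<dots> = (fact n)\<^sup>2"
    by (simp add: basis_expansion[OF sym_prod_in_H[OF cs]] eta_deg_sym_prod[OF cs])
  finally show ?thesis by simp
qed

text \<open>The value counts the pairs of a permutation of \<open>cs\<close> and a deal of the
  permuted word that produce \<open>ds\<close>. Dealing preserves the multiset, and as a permutation
  it can be undone beforehand.\<close>

lemma word_dual_sym_prod:
  assumes cs: "cs \<in> words n" and ds: "ds \<in> words n"
  shows "mset cs \<noteq> mset ds \<Longrightarrow> word_dual ds (coprod (replicate n 1) (sym_prod cs)) = 0"
    and "mset cs = mset ds \<Longrightarrow> word_dual ds (coprod (replicate n 1) (sym_prod cs)) > 0"
proof -
  have n: "length cs = n" using cs by (simp add: words_def)
  define A where "A \<sigma> = deals (\<lambda>_. 1) (replicate n 1) (permute_list \<sigma> cs)" for \<sigma>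
  have eq: "word_dual ds (coprod (replicate n 1) (sym_prod cs)) =
      (\<Sum>\<sigma> | \<sigma> permutes {..<n}. \<Sum>ys\<leftarrow>A \<sigma>. if ys = ds then 1 else 0)"
    unfolding sym_prod_def linear_sum[OF linear_coprod] linear_sum[OF linear_word_dual] n
  proof (rule sum.cong[OF refl])
    fix \<sigma> assume "\<sigma> \<in> {\<sigma>. \<sigma> permutes {..<n}}"
    then have p: "permute_list \<sigma> cs \<in> words n" using permute_list_words[OF cs] by simp
    then have "word_dual ds (coprod (replicate n 1) (prod_list (permute_list \<sigma> cs))) =
        (\<Sum>ys\<leftarrow>A \<sigma>. word_dual ds (tens ys))"
      by (subst coprod_ones_prod_list) (auto simp: words_def A_def linear_sum_list[OF linear_word_dual])
    also have "\<dots> = (\<Sum>ys\<leftarrow>A \<sigma>. if ys = ds then 1 else 0)"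
    proof (intro arg_cong[of _ _ sum_list] map_cong refl)
      fix ys assume "ys \<in> set (A \<sigma>)"
      then have "set ys = set (permute_list \<sigma> cs)" unfolding A_def by (intro mset_eq_setD deals_mset)
      then show "word_dual ds (tens ys) = (if ys = ds then 1 else 0)"
        using p by (intro word_dual_tens) (simp add: words_def)
    qed
    finally show "word_dual ds (coprod (replicate n 1) (prod_list (permute_list \<sigma> cs))) =
      (\<Sum>ys\<leftarrow>A \<sigma>. if ys = ds then 1 else 0)" .
  qed
  have A: "mset ys = mset cs" if "ys \<in> set (A \<sigma>)" "\<sigma> permutes {..<n}" for ys \<sigma>
    using deals_mset[of ys _ _ "permute_list \<sigma> cs"] that n by (simp add: A_def)
  show "word_dual ds (coprod (replicate n 1) (sym_prod cs)) = 0" if "mset cs \<noteq> mset ds"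
    unfolding eq
  proof (rule sum.neutral, rule ballI)
    fix \<sigma> assume \<sigma>: "\<sigma> \<in> {\<sigma>. \<sigma> permutes {..<n}}"
    have "(\<Sum>ys\<leftarrow>A \<sigma>. if ys = ds then 1 else 0) = (\<Sum>ys\<leftarrow>A \<sigma>. 0 :: real)"
      using A \<sigma> that by (intro arg_cong[of _ _ sum_list] map_cong refl) auto
    then show "(\<Sum>ys\<leftarrow>A \<sigma>. if ys = ds then 1 else 0) = (0 :: real)" by simp
  qed
  show "word_dual ds (coprod (replicate n 1) (sym_prod cs)) > 0" if eq_ms: "mset cs = mset ds"
  proof -
    obtain L where L: "\<And>\<tau>. \<tau> \<in> set L \<Longrightarrow> \<tau> permutes {..<n}"
      "\<And>xs :: 'a list. length xs = n \<Longrightarrow> deals (\<lambda>_. 1) (replicate n 1) xs = map (\<lambda>\<tau>. permute_list \<tau> xs) L"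
      using deals_permutations[of n "replicate n 1"] by metis
    have "real (length L) = fact n"
      using length_deals_one[of cs "replicate n 1"] L(2)[OF n] n by (simp add: sum_list_replicate multinomial_ones)
    then have "L \<noteq> []" by auto
    then obtain \<tau> where \<tau>: "\<tau> \<in> set L" by (meson list.set_sel(1))
    obtain \<rho> where \<rho>: "\<rho> permutes {..<n}" "permute_list \<rho> cs = ds"
      using mset_eq_permutation[of ds cs] eq_ms n by metis
    \<comment> \<open>Permuting by \<open>\<sigma>\<close> and then dealing by \<open>\<tau>\<close>
      amounts to \<open>\<sigma> \<circ> \<tau>\<close>, which has to be
      \<open>\<rho>\<close>.\<close>
    define \<sigma> where "\<sigma> = \<rho> \<circ> inv \<tau>"
    have \<tau>p: "\<tau> permutes {..<n}" by (rule L(1)[OF \<tau>])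
    have \<sigma>: "\<sigma> permutes {..<n}" unfolding \<sigma>_def by (intro permutes_compose permutes_inv \<tau>p \<rho>)
    have "permute_list \<tau> (permute_list \<sigma> cs) = permute_list (\<sigma> \<circ> \<tau>) cs"
      using \<tau>p n by (simp add: permute_list_compose)
    also have "\<sigma> \<circ> \<tau> = \<rho>" unfolding \<sigma>_def using permutes_inv_o[OF \<tau>p] by (simp add: o_assoc[symmetric])
    finally have "ds \<in> set (A \<sigma>)"
      using L(2)[of "permute_list \<sigma> cs"] n \<tau> \<rho> by (force simp: A_def)
    moreover have "ds \<in> set L \<Longrightarrow> 0 < (\<Sum>ys\<leftarrow>L. if ys = ds then 1 else 0 :: real)" for L
      by (induction L) (auto intro!: add_pos_nonneg sum_list_nonneg)
    ultimately have "0 < (\<Sum>ys\<leftarrow>A \<sigma>. if ys = ds then 1 else 0 :: real)" by blast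
    then show ?thesis
      unfolding eq using \<sigma>
      by (intro sum_pos2[of _ \<sigma>] sum_list_nonneg) (auto simp: finite_permutations)
  qed
qed

end

section \<open>The Markov chain\<close>

definition compositions :: "nat \<Rightarrow> nat list set" where
  "compositions n = {E. sum_list E = n \<and> 0 \<notin> set E}"

lemma finite_compositions: "finite (compositions n)"
proof (rule finite_subset)
  have "length E \<le> sum_list E" if "0 \<notin> set E" for E :: "nat list"
    using that by (induction E) auto
  then show "compositions n \<subseteq> {E. set E \<subseteq> {..n} \<and> length E \<le> n}"
    using member_le_sum_list by (fastforce simp: compositions_def)
qed (rule finite_lists_length_le, simp)

lemma sum_list_filter_pos: "sum_list (filter ((<) 0) D) = sum_list (D :: nat list)"
  by (induction D) auto

text \<open>Deleting zero parts fibres the weak compositions over finitely many compositions.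
  \<open>g\<close> is constant on fibres, and the mass of a fibre is a value of the image
  distribution.\<close>

lemma infsum_pmf_compositions:
  fixes g :: "nat list \<Rightarrow> real"
  assumes supp: "set_pmf P \<subseteq> weak_compositions n"
    and g: "\<And>D. g (filter ((<) 0) D) = g D"
  shows "(\<Sum>\<^sub>\<infinity>D\<in>weak_compositions n. pmf P D * g D) =
    (\<Sum>E\<in>compositions n. pmf (map_pmf (filter ((<) 0)) P) E * g E)"
proof -
  let ?F = "filter ((<) (0::nat))"
  have summable: "pmf P summable_on A" for A
    using pmf_abs_summable[of P A] abs_summable_equivalent abs_summable_summable by blast
  have "?F D \<in> compositions n" if "D \<in> weak_compositions n" for D
    using that by (simp add: compositions_def weak_compositions_def sum_list_filter_pos)
  moreover have "D \<in> weak_compositions n" if "?F D \<in> compositions n" for D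
    using that sum_list_filter_pos[of D] by (simp add: compositions_def weak_compositions_def)
  ultimately have U: "weak_compositions n = (\<Union>E\<in>compositions n. ?F -` {E})" by auto
  have on: "pmf P D * g D = pmf P D * g E" if "D \<in> ?F -` {E}" for D E
    using that g[of D] by simp
  have "(\<Sum>\<^sub>\<infinity>D\<in>weak_compositions n. pmf P D * g D) =
      (\<Sum>E\<in>compositions n. \<Sum>\<^sub>\<infinity>D\<in>?F -` {E}. pmf P D * g D)"
    unfolding U
  proof (rule sum_infsum[symmetric])
    show "(\<lambda>D. pmf P D * g D) summable_on ?F -` {E}" for E
    proof -
      have "(\<lambda>D. pmf P D * g E) summable_on ?F -` {E}" by (rule summable_on_cmult_left[OF summable])
      then show ?thesis by (subst summable_on_cong[OF on])
    qed
  qed (auto simp: finite_compositions)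
  also have "\<dots> = (\<Sum>E\<in>compositions n. pmf (map_pmf ?F P) E * g E)"
  proof (rule sum.cong[OF refl])
    fix E
    have "(\<Sum>\<^sub>\<infinity>D\<in>?F -` {E}. pmf P D * g D) = (\<Sum>\<^sub>\<infinity>D\<in>?F -` {E}. pmf P D * g E)"
      by (rule infsum_cong) (rule on)
    also have "\<dots> = infsum (pmf P) (?F -` {E}) * g E" by (rule infsum_cmult_left')
    also have "infsum (pmf P) (?F -` {E}) = pmf (map_pmf ?F P) E"
      by (simp add: pmf_map measure_pmf_conv_infsetsum infsetsum_infsum[OF pmf_abs_summable])
    finally show "(\<Sum>\<^sub>\<infinity>D\<in>?F -` {E}. pmf P D * g D) = pmf (map_pmf ?F P) E * g E" .
  qed
  finally show ?thesis .
qed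

lemma sum_list_sum_swap: "(\<Sum>x\<leftarrow>xs. \<Sum>y\<in>Y. f x y) = (\<Sum>y\<in>Y. \<Sum>x\<leftarrow>xs. f x y)"
  for f :: "'a \<Rightarrow> 'b \<Rightarrow> 'c::comm_monoid_add"
  by (induction xs) (simp_all add: sum.distrib)

locale hopf_chain = graded_hopf_basis \<Delta> \<epsilon> S H B
  for \<Delta> :: "'a::real_algebra_1 \<Rightarrow> 'a tensor" and \<epsilon> S H B +
  fixes n :: nat and P :: "nat list pmf"
  assumes P_supp: "set_pmf P \<subseteq> weak_compositions n"
    and two_parts: "\<exists>D. 0 < pmf P D \<and> 2 \<le> card {i. i < length D \<and> D ! i \<noteq> 0}"
    and eta_pos: "x \<in> B n \<Longrightarrow> 0 < \<eta> x"
begin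

definition Q :: "nat list pmf" where
  "Q = map_pmf (filter ((<) 0)) P"

lemma Q_supp: "set_pmf Q \<subseteq> compositions n"
  using P_supp by (auto simp: Q_def compositions_def weak_compositions_def sum_list_filter_pos)

lemma Q_pos_composition: "0 < pmf Q E \<Longrightarrow> E \<in> compositions n"
  using Q_supp by (auto simp: pmf_positive_iff)

lemma sum_Q: "(\<Sum>E\<in>compositions n. pmf Q E) = 1"
  by (rule sum_pmf_eq_1[OF finite_compositions Q_supp])

text \<open>Here the first part and the rest are both positive, the form used for swapping letters
  and for cutting a block.\<close>

lemma ex_proper_composition: "\<exists>d D. 0 < pmf Q (d # D) \<and> 0 < d \<and> 0 < sum_list D"
proof -
  obtain D where D: "0 < pmf P D" "2 \<le> card {i. i < length D \<and> D ! i \<noteq> 0}" using two_parts by blast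
  define E where "E = filter ((<) 0) D"
  have "2 \<le> length E" using D(2) by (simp add: E_def length_filter_conv_card)
  then obtain d e F where E: "E = d # e # F" by (metis One_nat_def Suc_1 Suc_le_length_iff)
  have "D \<in> set_pmf P" using D(1) by (simp add: set_pmf_iff)
  then have "E \<in> set_pmf Q" by (auto simp: Q_def E_def)
  moreover have "0 \<notin> set E" by (simp add: E_def)
  ultimately show ?thesis using E by (intro exI[of _ d] exI[of _ "e # F"]) (auto simp: pmf_positive)
qed

lemma n_pos: "0 < n"
proof -
  obtain d D where "0 < pmf Q (d # D)" "0 < d" using ex_proper_composition by blast
  then have "d # D \<in> compositions n" by (intro Q_pos_composition)
  with \<open>0 < d\<close> show ?thesis by (auto simp: compositions_def)
qed

text \<open>The probability of \<open>E\<close>, divided evenly among the deals of a word of length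
  \<open>n\<close>.\<close>

definition weight :: "nat list \<Rightarrow> real" where
  "weight E = pmf Q E / multinomial n E"

definition T :: "'a \<Rightarrow> 'a" where
  "T x = (\<Sum>E\<in>compositions n. weight E *\<^sub>R mcop E x)"

lemma weight_nonneg: "0 \<le> weight E"
  using multinomial_pos[of n E] by (simp add: weight_def)

lemma weight_mult: "weight E * multinomial n E = pmf Q E"
  using multinomial_pos[of n E] by (simp add: weight_def)

lemma linear_T: "linear T"
  unfolding T_def[abs_def] by (intro linear_compose_sum ballI linear_compose_scale_right linear_mcop)

text \<open>A basis element is a one-factor product, so \<open>mcop_fval\<close> writes its image as
  one-factor products plus an error, all in degree \<open>n\<close>.\<close>

lemma mcop_in_H:
  assumes "E \<in> compositions n" "x \<in> H n"
  shows "mcop E x \<in> H n"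
proof -
  have "x \<in> span (B n)" using assms span_B by simp
  then have "mcop E x \<in> span (B n)"
  proof (rule linear_image_span[OF linear_mcop])
    fix b assume b: "b \<in> B n"
    have zs: "factors [(n, b)]" using b n_pos by (simp add: factors_def)
    have "(\<Sum>ys\<leftarrow>deals fst E [(n, b)]. fval ys) \<in> span (B n)"
      using prod_in_H deals_factors[OF _ zs] deals_fdeg span_B
      by (intro span_sum_list) fastforce
    moreover have "mcop E (fval [(n, b)]) - (\<Sum>ys\<leftarrow>deals fst E [(n, b)]. fval ys) \<in> span (B n)"
      using mcop_fval[OF zs, of E] aug_pow_in_H assms by (auto simp: span_B compositions_def)
    ultimately show "mcop E b \<in> span (B n)" using span_add by fastforce
  qed
  then show ?thesis by (simp add: span_B)
qed

lemma T_in_H: "x \<in> H n \<Longrightarrow> T x \<in> H n"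
  unfolding T_def by (intro subspace_sum subspace_scale subspace_H mcop_in_H)

lemma mDeltaP_eq_T:
  assumes x: "x \<in> H n"
  shows "mDeltaP \<Delta> \<epsilon> H B n P x = T x"
proof -
  have "(\<Sum>\<^sub>\<infinity>D\<in>weak_compositions n. pmf P D / multinomial n D *
      basis_coeff B (tmult (coproduct_comp \<Delta> \<epsilon> H D x)) y) = basis_coeff B (T x) y" for y
  proof -
    have "(\<Sum>\<^sub>\<infinity>D\<in>weak_compositions n. pmf P D / multinomial n D * basis_coeff B (tmult (coproduct_comp \<Delta> \<epsilon> H D x)) y) =
        (\<Sum>\<^sub>\<infinity>D\<in>weak_compositions n. pmf P D * (basis_coeff B (mcop D x) y / multinomial n D))"
      by (simp add: mcop_def)
    also have "\<dots> = (\<Sum>E\<in>compositions n. pmf Q E * (basis_coeff B (mcop E x) y / multinomial n E))"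
      unfolding Q_def
      by (rule infsum_pmf_compositions[OF P_supp]) (simp add: mcop_filter_pos multinomial_filter_pos)
    also have "\<dots> = basis_coeff B (T x) y"
      by (simp add: T_def linear_sum[OF linear_basis_coeff] linear_cmul[OF linear_basis_coeff] weight_def)
    finally show ?thesis .
  qed
  then show ?thesis
    unfolding mDeltaP_def by (simp add: basis_expansion[OF T_in_H[OF x]])
qed

section \<open>Action of \<open>T\<close> on words and invariant functionals\<close>

lemma T_prod_list:
  assumes "cs \<in> words n"
  shows "T (prod_list cs) = (\<Sum>E\<in>compositions n. weight E *\<^sub>R (\<Sum>ys\<leftarrow>deals (\<lambda>_. 1) E cs. prod_list ys))"
  unfolding T_def
  by (intro sum.cong refl) (use assms in \<open>simp add: mcop_prod_list words_def compositions_def\<close>)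

text \<open>Applying \<open>T\<close> to a word is one step of a random walk on the symmetric group;
  \<open>L E\<close> lists the possible steps for \<open>E\<close>, and the last clause gives their
  total mass.\<close>

lemma deal_permutations:
  obtains L where "\<And>E \<tau>. \<tau> \<in> set (L E) \<Longrightarrow> \<tau> permutes {..<n}"
    "\<And>E (xs :: 'a list). length xs = n \<Longrightarrow> deals (\<lambda>_. 1) E xs = map (\<lambda>\<tau>. permute_list \<tau> xs) (L E)"
    "\<And>E. E \<in> compositions n \<Longrightarrow> weight E * real (length (L E)) = pmf Q E"
proof -
  have "\<exists>L. (\<forall>\<tau>\<in>set L. \<tau> permutes {..<n}) \<and>
      (\<forall>xs :: 'a list. length xs = n \<longrightarrow> deals (\<lambda>_. 1) E xs = map (\<lambda>\<tau>. permute_list \<tau> xs) L)" for E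
    using deals_permutations[of n E] by metis
  then obtain L where L: "\<And>E \<tau>. \<tau> \<in> set (L E) \<Longrightarrow> \<tau> permutes {..<n}"
    "\<And>E (xs :: 'a list). length xs = n \<Longrightarrow> deals (\<lambda>_. 1) E xs = map (\<lambda>\<tau>. permute_list \<tau> xs) (L E)"
    by metis
  \<comment> \<open>\<open>L E\<close> serves all words of length \<open>n\<close>, so its length
    can be counted on a constant word with an arbitrary letter.\<close>
  have "weight E * real (length (L E)) = pmf Q E" if "E \<in> compositions n" for E
    using length_deals_one[of "replicate n (undefined::'a)" E] L(2)[of "replicate n undefined" E] that
    by (simp add: compositions_def weight_mult)
  with L show thesis by (rule that)
qed

lemma sum_permutes_compose_right:
  assumes "\<tau> permutes {..<n}"
  shows "(\<Sum>\<sigma> | \<sigma> permutes {..<n}. h (\<sigma> \<circ> \<tau>)) = (\<Sum>\<sigma> | \<sigma> permutes {..<n}. h \<sigma>)"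
  using sum_permutations_compose_right[OF assms, of h] by simp

text \<open>Summing over all \<open>\<sigma>\<close> absorbs each place permutation
  \<open>\<tau>\<close> by right translation, so every deal returns \<open>sym_prod cs\<close>, and
  the weights of the deals add up to one.\<close>

lemma T_sym_prod:
  assumes cs: "cs \<in> words n"
  shows "T (sym_prod cs) = sym_prod cs"
proof -
  have n: "length cs = n" using cs by (simp add: words_def)
  obtain L where L: "\<And>E \<tau>. \<tau> \<in> set (L E) \<Longrightarrow> \<tau> permutes {..<n}"
    "\<And>E (xs :: 'a list). length xs = n \<Longrightarrow> deals (\<lambda>_. 1) E xs = map (\<lambda>\<tau>. permute_list \<tau> xs) (L E)"
    "\<And>E. E \<in> compositions n \<Longrightarrow> weight E * real (length (L E)) = pmf Q E"
    using deal_permutations by blast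
  let ?S = "{\<sigma>. \<sigma> permutes {..<n}}"
  have deal: "(\<Sum>\<sigma>\<in>?S. \<Sum>ys\<leftarrow>deals (\<lambda>_. 1) E (permute_list \<sigma> cs). prod_list ys) =
      real (length (L E)) *\<^sub>R sym_prod cs" for E
  proof -
    have "(\<Sum>\<sigma>\<in>?S. \<Sum>ys\<leftarrow>deals (\<lambda>_. 1) E (permute_list \<sigma> cs). prod_list ys) =
        (\<Sum>\<sigma>\<in>?S. \<Sum>\<tau>\<leftarrow>L E. prod_list (permute_list (\<sigma> \<circ> \<tau>) cs))"
    proof (rule sum.cong[OF refl])
      fix \<sigma>
      have "(\<Sum>ys\<leftarrow>deals (\<lambda>_. 1) E (permute_list \<sigma> cs). prod_list ys) =
          (\<Sum>\<tau>\<leftarrow>L E. prod_list (permute_list \<tau> (permute_list \<sigma> cs)))"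
        using L(2)[of "permute_list \<sigma> cs" E] n by (simp add: o_def)
      also have "\<dots> = (\<Sum>\<tau>\<leftarrow>L E. prod_list (permute_list (\<sigma> \<circ> \<tau>) cs))"
        using L(1) n by (intro arg_cong[of _ _ sum_list] map_cong refl) (simp add: permute_list_compose)
      finally show "(\<Sum>ys\<leftarrow>deals (\<lambda>_. 1) E (permute_list \<sigma> cs). prod_list ys) =
        (\<Sum>\<tau>\<leftarrow>L E. prod_list (permute_list (\<sigma> \<circ> \<tau>) cs))" .
    qed
    also have "\<dots> = (\<Sum>\<tau>\<leftarrow>L E. \<Sum>\<sigma>\<in>?S. prod_list (permute_list (\<sigma> \<circ> \<tau>) cs))"
      by (rule sum_list_sum_swap[symmetric])
    also have "\<dots> = (\<Sum>\<tau>\<leftarrow>L E. sym_prod cs)"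
      using L(1)
      by (intro arg_cong[of _ _ sum_list] map_cong refl)
        (simp add: sum_permutes_compose_right[of _ "\<lambda>\<sigma>. prod_list (permute_list \<sigma> cs)"] sym_prod_def n)
    also have "\<dots> = real (length (L E)) *\<^sub>R sym_prod cs"
      by (simp add: sum_list_triv scaleR_conv_of_real)
    finally show ?thesis .
  qed
  have "T (sym_prod cs) = (\<Sum>\<sigma>\<in>?S. T (prod_list (permute_list \<sigma> cs)))"
    by (simp add: sym_prod_def n linear_sum[OF linear_T])
  also have "\<dots> = (\<Sum>\<sigma>\<in>?S. \<Sum>E\<in>compositions n. weight E *\<^sub>R
      (\<Sum>ys\<leftarrow>deals (\<lambda>_. 1) E (permute_list \<sigma> cs). prod_list ys))"
    by (intro sum.cong refl T_prod_list permute_list_words[OF cs]) simp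
  also have "\<dots> = (\<Sum>E\<in>compositions n. weight E *\<^sub>R (real (length (L E)) *\<^sub>R sym_prod cs))"
    by (subst sum.swap) (simp add: scaleR_sum_right[symmetric] deal)
  also have "\<dots> = (\<Sum>E\<in>compositions n. pmf Q E *\<^sub>R sym_prod cs)"
    by (intro sum.cong refl) (simp add: L(3))
  also have "\<dots> = sym_prod cs" by (simp add: scaleR_sum_left[symmetric] sum_Q)
  finally show ?thesis .
qed

text \<open>A \<open>T\<close>-invariant functional is harmonic for a random walk on the symmetric group whose
  stationary distribution is uniform; expanding the (vanishing) Dirichlet form shows that it is constant
  along the steps of the walk.\<close>

lemma invariant_functional_deals:
  fixes \<phi> :: "'a \<Rightarrow> real"
  assumes lin: "linear \<phi>" and inv: "\<And>x. x \<in> H n \<Longrightarrow> \<phi> (T x) = \<phi> x"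
    and xs: "xs \<in> words n" and E: "0 < pmf Q E" and ys: "ys \<in> set (deals (\<lambda>_. 1) E xs)"
  shows "\<phi> (prod_list ys) = \<phi> (prod_list xs)"
proof -
  have n: "length xs = n" using xs by (simp add: words_def)
  obtain L where L: "\<And>E \<tau>. \<tau> \<in> set (L E) \<Longrightarrow> \<tau> permutes {..<n}"
    "\<And>E (xs :: 'a list). length xs = n \<Longrightarrow> deals (\<lambda>_. 1) E xs = map (\<lambda>\<tau>. permute_list \<tau> xs) (L E)"
    "\<And>E. E \<in> compositions n \<Longrightarrow> weight E * real (length (L E)) = pmf Q E"
    using deal_permutations by blast
  let ?S = "{\<sigma>. \<sigma> permutes {..<n}}"
  define G where "G \<sigma> = \<phi> (prod_list (permute_list \<sigma> xs))" for \<sigma>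
  define A where "A = (\<Sum>\<sigma>\<in>?S. (G \<sigma>)\<^sup>2)"
  have harmonic: "G \<sigma> = (\<Sum>E\<in>compositions n. weight E * (\<Sum>\<tau>\<leftarrow>L E. G (\<sigma> \<circ> \<tau>)))" if "\<sigma> \<in> ?S" for \<sigma>
  proof -
    have w: "permute_list \<sigma> xs \<in> words n" using permute_list_words[OF xs] that by simp
    have "G \<sigma> = \<phi> (T (prod_list (permute_list \<sigma> xs)))"
      unfolding G_def using prod_list_in_H[of "permute_list \<sigma> xs"] w
      by (intro inv[symmetric]) (simp add: words_def)
    also have "\<dots> = (\<Sum>E\<in>compositions n. weight E * (\<Sum>ys\<leftarrow>deals (\<lambda>_. 1) E (permute_list \<sigma> xs). \<phi> (prod_list ys)))"
      by (simp add: T_prod_list[OF w] linear_sum[OF lin] linear_cmul[OF lin] linear_sum_list[OF lin])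
    also have "\<dots> = (\<Sum>E\<in>compositions n. weight E * (\<Sum>\<tau>\<leftarrow>L E. G (\<sigma> \<circ> \<tau>)))"
    proof (intro sum.cong refl arg_cong[of _ _ "(*) _"])
      fix E
      have "(\<Sum>ys\<leftarrow>deals (\<lambda>_. 1) E (permute_list \<sigma> xs). \<phi> (prod_list ys)) =
          (\<Sum>\<tau>\<leftarrow>L E. \<phi> (prod_list (permute_list \<tau> (permute_list \<sigma> xs))))"
        using L(2)[of "permute_list \<sigma> xs" E] n by (simp add: o_def)
      also have "\<dots> = (\<Sum>\<tau>\<leftarrow>L E. G (\<sigma> \<circ> \<tau>))"
        unfolding G_def using L(1) n
        by (intro arg_cong[of _ _ sum_list] map_cong refl) (simp add: permute_list_compose)
      finally show "(\<Sum>ys\<leftarrow>deals (\<lambda>_. 1) E (permute_list \<sigma> xs). \<phi> (prod_list ys)) =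
          (\<Sum>\<tau>\<leftarrow>L E. G (\<sigma> \<circ> \<tau>))" .
    qed
    finally show ?thesis .
  qed
  \<comment> \<open>After expanding the square, both quadratic terms sum to \<open>A\<close> by
    right translation; the cross term remains.\<close>
  have step: "(\<Sum>\<tau>\<leftarrow>L E. \<Sum>\<sigma>\<in>?S. (G (\<sigma> \<circ> \<tau>) - G \<sigma>)\<^sup>2) =
      real (length (L E)) * (2 * A) - 2 * (\<Sum>\<sigma>\<in>?S. G \<sigma> * (\<Sum>\<tau>\<leftarrow>L E. G (\<sigma> \<circ> \<tau>)))" for E
  proof -
    have "(\<Sum>\<sigma>\<in>?S. (G (\<sigma> \<circ> \<tau>) - G \<sigma>)\<^sup>2) = 2 * A - 2 * (\<Sum>\<sigma>\<in>?S. G \<sigma> * G (\<sigma> \<circ> \<tau>))"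
      if "\<tau> \<in> set (L E)" for \<tau>
    proof -
      have "(\<Sum>\<sigma>\<in>?S. (G (\<sigma> \<circ> \<tau>))\<^sup>2) = A"
        unfolding A_def by (rule sum_permutes_compose_right[OF L(1)[OF that], of "\<lambda>\<sigma>. (G \<sigma>)\<^sup>2"])
      then show ?thesis
        by (simp add: power2_diff sum.distrib sum_subtractf A_def sum_distrib_left mult.commute mult.left_commute)
    qed
    then have "(\<Sum>\<tau>\<leftarrow>L E. \<Sum>\<sigma>\<in>?S. (G (\<sigma> \<circ> \<tau>) - G \<sigma>)\<^sup>2) =
        (\<Sum>\<tau>\<leftarrow>L E. 2 * A - 2 * (\<Sum>\<sigma>\<in>?S. G \<sigma> * G (\<sigma> \<circ> \<tau>)))"
      by (intro arg_cong[of _ _ sum_list] map_cong refl)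
    also have "\<dots> = real (length (L E)) * (2 * A) - 2 * (\<Sum>\<tau>\<leftarrow>L E. \<Sum>\<sigma>\<in>?S. G \<sigma> * G (\<sigma> \<circ> \<tau>))"
      by (simp add: sum_list_subtractf sum_list_triv sum_list_const_mult)
    also have "(\<Sum>\<tau>\<leftarrow>L E. \<Sum>\<sigma>\<in>?S. G \<sigma> * G (\<sigma> \<circ> \<tau>)) = (\<Sum>\<sigma>\<in>?S. G \<sigma> * (\<Sum>\<tau>\<leftarrow>L E. G (\<sigma> \<circ> \<tau>)))"
      by (simp add: sum_list_sum_swap sum_list_const_mult)
    finally show ?thesis .
  qed
  have summand: "weight E * (\<Sum>\<tau>\<leftarrow>L E. \<Sum>\<sigma>\<in>?S. (G (\<sigma> \<circ> \<tau>) - G \<sigma>)\<^sup>2) =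
      pmf Q E * (2 * A) - 2 * (\<Sum>\<sigma>\<in>?S. G \<sigma> * (weight E * (\<Sum>\<tau>\<leftarrow>L E. G (\<sigma> \<circ> \<tau>))))"
    if "E \<in> compositions n" for E
  proof -
    have "weight E * (\<Sum>\<tau>\<leftarrow>L E. \<Sum>\<sigma>\<in>?S. (G (\<sigma> \<circ> \<tau>) - G \<sigma>)\<^sup>2) =
        (weight E * real (length (L E))) * (2 * A) - 2 * (weight E * (\<Sum>\<sigma>\<in>?S. G \<sigma> * (\<Sum>\<tau>\<leftarrow>L E. G (\<sigma> \<circ> \<tau>))))"
      unfolding step by (simp add: right_diff_distrib)
    also have "weight E * (\<Sum>\<sigma>\<in>?S. G \<sigma> * (\<Sum>\<tau>\<leftarrow>L E. G (\<sigma> \<circ> \<tau>))) =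
        (\<Sum>\<sigma>\<in>?S. G \<sigma> * (weight E * (\<Sum>\<tau>\<leftarrow>L E. G (\<sigma> \<circ> \<tau>))))"
      unfolding sum_distrib_left by (rule sum.cong[OF refl]) simp
    finally show ?thesis unfolding L(3)[OF that] .
  qed
  have "(\<Sum>E\<in>compositions n. weight E * (\<Sum>\<tau>\<leftarrow>L E. \<Sum>\<sigma>\<in>?S. (G (\<sigma> \<circ> \<tau>) - G \<sigma>)\<^sup>2)) =
      (\<Sum>E\<in>compositions n. pmf Q E * (2 * A) - 2 * (\<Sum>\<sigma>\<in>?S. G \<sigma> * (weight E * (\<Sum>\<tau>\<leftarrow>L E. G (\<sigma> \<circ> \<tau>)))))"
    by (rule sum.cong[OF refl summand])
  also have "\<dots> = (\<Sum>E\<in>compositions n. pmf Q E * (2 * A)) -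
      2 * (\<Sum>E\<in>compositions n. \<Sum>\<sigma>\<in>?S. G \<sigma> * (weight E * (\<Sum>\<tau>\<leftarrow>L E. G (\<sigma> \<circ> \<tau>))))"
    by (simp only: sum_subtractf sum_distrib_left[of 2])
  also have "(\<Sum>E\<in>compositions n. pmf Q E * (2 * A)) = 2 * A"
    by (simp add: sum_distrib_right[symmetric] sum_Q)
  also have "(\<Sum>E\<in>compositions n. \<Sum>\<sigma>\<in>?S. G \<sigma> * (weight E * (\<Sum>\<tau>\<leftarrow>L E. G (\<sigma> \<circ> \<tau>)))) =
      (\<Sum>\<sigma>\<in>?S. G \<sigma> * (\<Sum>E\<in>compositions n. weight E * (\<Sum>\<tau>\<leftarrow>L E. G (\<sigma> \<circ> \<tau>))))"
    by (subst sum.swap) (simp add: sum_distrib_left)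
  also have "\<dots> = (\<Sum>\<sigma>\<in>?S. G \<sigma> * G \<sigma>)"
    by (rule sum.cong[OF refl]) (simp only: harmonic[symmetric])
  also have "\<dots> = A" by (simp add: A_def power2_eq_square)
  \<comment> \<open>Averaged over \<open>E\<close>, harmonicity turns the cross term into
    \<open>2 * A\<close> too, so a sum of non-negative terms vanishes.\<close>
  finally have zero: "(\<Sum>E\<in>compositions n. weight E * (\<Sum>\<tau>\<leftarrow>L E. \<Sum>\<sigma>\<in>?S. (G (\<sigma> \<circ> \<tau>) - G \<sigma>)\<^sup>2)) = 0"
    by (simp only: diff_self)
  have nn: "0 \<le> (\<Sum>\<tau>\<leftarrow>L E. \<Sum>\<sigma>\<in>?S. (G (\<sigma> \<circ> \<tau>) - G \<sigma>)\<^sup>2)" for E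
    by (intro sum_list_nonneg) (auto intro: sum_nonneg)
  have Ec: "E \<in> compositions n" using E by (rule Q_pos_composition)
  have "weight E * (\<Sum>\<tau>\<leftarrow>L E. \<Sum>\<sigma>\<in>?S. (G (\<sigma> \<circ> \<tau>) - G \<sigma>)\<^sup>2) = 0"
    using zero Ec by (subst (asm) sum_nonneg_eq_0_iff) (auto simp: finite_compositions weight_nonneg nn)
  moreover have "weight E \<noteq> 0" using weight_mult[of E] E by auto
  ultimately have s0: "(\<Sum>\<tau>\<leftarrow>L E. \<Sum>\<sigma>\<in>?S. (G (\<sigma> \<circ> \<tau>) - G \<sigma>)\<^sup>2) = 0" by simp
  obtain \<tau> where \<tau>: "\<tau> \<in> set (L E)" "ys = permute_list \<tau> xs"
    using ys L(2)[OF n, of E] by auto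
  have "(\<Sum>\<sigma>\<in>?S. (G (\<sigma> \<circ> \<tau>) - G \<sigma>)\<^sup>2) = 0"
    using s0 \<tau>(1) by (subst (asm) sum_list_nonneg_eq_0_iff) (auto intro: sum_nonneg)
  then have "\<forall>\<sigma>\<in>?S. (G (\<sigma> \<circ> \<tau>) - G \<sigma>)\<^sup>2 = 0"
    by (subst (asm) sum_nonneg_eq_0_iff) (auto simp: finite_permutations)
  \<comment> \<open>At the identity the two values belong to \<open>xs\<close> and to its deal
    \<open>ys\<close>.\<close>
  from bspec[OF this, of id] have "G \<tau> = G id" by (simp add: permutes_id)
  then show ?thesis using \<tau> by (simp add: G_def)
qed

text \<open>Two words that differ by an adjacent swap have a deal in common, and
  \<open>\<phi>\<close> has the same value there as at both. So \<open>\<phi>\<close> is constant on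
  rearrangements, and its value on the symmetrised product is \<open>fact n\<close> times that
  constant.\<close>

lemma invariant_functional_prod_list:
  fixes \<phi> :: "'a \<Rightarrow> real"
  assumes lin: "linear \<phi>" and inv: "\<And>x. x \<in> H n \<Longrightarrow> \<phi> (T x) = \<phi> x"
    and sym: "\<And>cs. cs \<in> words n \<Longrightarrow> \<phi> (sym_prod cs) = 0" and cs: "cs \<in> words n"
  shows "\<phi> (prod_list cs) = 0"
proof -
  have n: "length cs = n" using cs by (simp add: words_def)
  obtain d D where E: "0 < pmf Q (d # D)" "0 < d" "0 < sum_list D" using ex_proper_composition by blast
  have sum: "sum_list (d # D) = n" using Q_pos_composition[OF E(1)] by (simp add: compositions_def)
  have "\<phi> (prod_list ([] @ cs)) = \<phi> (prod_list ([] @ ds))" if "mset cs = mset ds" for ds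
  proof (rule adjacent_swap_invariant_imp_permutation_invariant[where M = "mset cs"])
    fix u p q w assume m: "mset (u @ p # q # w) = mset cs"
    then have m': "mset (u @ q # p # w) = mset cs" by (simp add: add_mset_commute)
    have W: "u @ p # q # w \<in> words n" "u @ q # p # w \<in> words n"
      using mset_eq_setD[OF m] mset_eq_length[OF m] mset_eq_setD[OF m'] mset_eq_length[OF m'] cs
      by (simp_all only: words_def mem_Collect_eq)
    have len: "length (u @ p # q # w) = sum_list (d # D)" using W(1) sum by (simp add: words_def)
    obtain ys where "ys \<in> set (deals (\<lambda>_. 1) (d # D) (u @ p # q # w))"
      "ys \<in> set (deals (\<lambda>_. 1) (d # D) (u @ q # p # w))"
      by (rule deals_swap_common[OF len E(2,3)])
    then show "\<phi> (prod_list (u @ p # q # w)) = \<phi> (prod_list (u @ q # p # w))"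
      using invariant_functional_deals[OF lin inv W(1) E(1)] invariant_functional_deals[OF lin inv W(2) E(1)]
      by metis
  qed (use that in auto)
  then have const: "\<phi> (prod_list ds) = \<phi> (prod_list cs)" if "mset cs = mset ds" for ds
    using that by simp
  have "0 = \<phi> (sym_prod cs)" using sym[OF cs] by simp
  also have "\<dots> = (\<Sum>\<sigma> | \<sigma> permutes {..<n}. \<phi> (prod_list cs))"
    unfolding sym_prod_def linear_sum[OF lin] n using n by (intro sum.cong refl const) simp
  also have "\<dots> = fact n * \<phi> (prod_list cs)" by (simp add: card_permutations[of "{..<n}" n])
  finally show ?thesis by simp
qed

text \<open>Since \<open>next_layer\<close> removes the error, the value at a rearrangement is a
  weighted sum of values at rearrangements. Where the absolute value is largest, this reads
  \<open>m \<le> c * m\<close> with a total weight \<open>c < 1\<close>.\<close>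

lemma invariant_functional_fval:
  fixes \<phi> :: "'a \<Rightarrow> real"
  assumes lin: "linear \<phi>" and inv: "\<And>x. x \<in> H n \<Longrightarrow> \<phi> (T x) = \<phi> x"
    and next_layer: "\<And>x. x \<in> aug_pow (Suc (length zs)) n \<Longrightarrow> \<phi> x = 0"
    and zs: "factors zs" "fdeg zs = n" and big: "\<exists>z\<in>set zs. 2 \<le> fst z"
  shows "\<phi> (fval zs) = 0"
proof -
  \<comment> \<open>Dealing only reorders the factors, so the estimate closes up on this finite
    set.\<close>
  define Z where "Z = {ys. mset ys = mset zs}"
  have fin: "finite Z"
    using finite_permutations_of_multiset[of "mset zs"] by (simp add: Z_def permutations_of_multiset_def)
  have Z: "factors ys" "fdeg ys = n" "length ys = length zs" "\<exists>z\<in>set ys. 2 \<le> fst z" if "ys \<in> Z" for ys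
  proof -
    have m: "mset ys = mset zs" using that by (simp add: Z_def)
    show "factors ys" using factors_mset[OF m] zs by simp
    show "fdeg ys = n" using m zs(2) by (metis mset_map sum_mset_sum_list)
    show "length ys = length zs" by (rule mset_eq_length[OF m])
    show "\<exists>z\<in>set ys. 2 \<le> fst z" using mset_eq_setD[OF m] big by simp
  qed
  define m where "m = Max ((\<lambda>ys. \<bar>\<phi> (fval ys)\<bar>) ` Z)"
  have zsZ: "zs \<in> Z" by (simp add: Z_def)
  have le_m: "\<bar>\<phi> (fval ys)\<bar> \<le> m" if "ys \<in> Z" for ys
    unfolding m_def by (rule Max_ge) (use fin that in auto)
  have "m \<in> (\<lambda>ys. \<bar>\<phi> (fval ys)\<bar>) ` Z" unfolding m_def by (rule Max_in) (use fin zsZ in auto)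
  then obtain ys where ys: "ys \<in> Z" "m = \<bar>\<phi> (fval ys)\<bar>" by blast
  have pos: "0 < fst z" if "z \<in> set ys" for z
    using that Z(1)[OF ys(1)] by (auto simp: factors_def)
  have "\<phi> (fval ys) = \<phi> (T (fval ys))"
    using prod_in_H[OF Z(1)[OF ys(1)]] Z(2)[OF ys(1)] inv by simp
  also have "\<dots> = (\<Sum>E\<in>compositions n. weight E * \<phi> (mcop E (fval ys)))"
    by (simp add: T_def linear_sum[OF lin] linear_cmul[OF lin])
  also have "\<dots> = (\<Sum>E\<in>compositions n. weight E * (\<Sum>us\<leftarrow>deals fst E ys. \<phi> (fval us)))"
  proof (rule sum.cong[OF refl])
    fix E assume "E \<in> compositions n"
    then have "mcop E (fval ys) - (\<Sum>us\<leftarrow>deals fst E ys. fval us) \<in> aug_pow (Suc (length ys)) (fdeg ys)"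
      using Z[OF ys(1)] by (intro mcop_fval) (auto simp: compositions_def)
    then have "\<phi> (mcop E (fval ys) - (\<Sum>us\<leftarrow>deals fst E ys. fval us)) = 0"
      using next_layer Z[OF ys(1)] by simp
    then show "weight E * \<phi> (mcop E (fval ys)) = weight E * (\<Sum>us\<leftarrow>deals fst E ys. \<phi> (fval us))"
      by (simp add: linear_diff[OF lin] linear_sum_list[OF lin])
  qed
  finally have eq: "\<phi> (fval ys) = (\<Sum>E\<in>compositions n. weight E * (\<Sum>us\<leftarrow>deals fst E ys. \<phi> (fval us)))" .
  have "m \<le> (\<Sum>E\<in>compositions n. weight E * (real (length (deals fst E ys)) * m))"
    unfolding ys(2) eq
  proof (rule order_trans[OF sum_abs sum_mono])
    fix E
    have "\<bar>\<Sum>us\<leftarrow>deals fst E ys. \<phi> (fval us)\<bar> \<le> (\<Sum>us\<leftarrow>deals fst E ys. \<bar>\<phi> (fval us)\<bar>)"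
      using sum_list_abs[of "map (\<lambda>us. \<phi> (fval us)) (deals fst E ys)"] by (simp add: o_def)
    also have "\<dots> \<le> (\<Sum>us\<leftarrow>deals fst E ys. m)"
    proof (rule sum_list_mono)
      fix us assume "us \<in> set (deals fst E ys)"
      from deals_mset[OF this] ys(1) have "us \<in> Z" by (simp add: Z_def)
      then show "\<bar>\<phi> (fval us)\<bar> \<le> m" by (rule le_m)
    qed
    \<comment> \<open>\<open>m\<close> was unfolded on the right-hand side as well;
      \<open>eq\<close> and \<open>ys(2)\<close> fold it back.\<close>
    finally show "\<bar>weight E * (\<Sum>us\<leftarrow>deals fst E ys. \<phi> (fval us))\<bar> \<le>
        weight E * (real (length (deals fst E ys)) * \<bar>\<Sum>E\<in>compositions n. weight E * (\<Sum>us\<leftarrow>deals fst E ys. \<phi> (fval us))\<bar>)"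
      unfolding eq[symmetric] ys(2)[symmetric]
      by (simp add: abs_mult weight_nonneg sum_list_triv mult_left_mono)
  qed
  also have "\<dots> = (\<Sum>E\<in>compositions n. weight E * real (length (deals fst E ys))) * m"
    by (simp add: sum_distrib_right mult.assoc)
  finally have le: "m \<le> (\<Sum>E\<in>compositions n. weight E * real (length (deals fst E ys))) * m" .
  \<comment> \<open>No composition exceeds its share of the mass; one with two positive blocks falls
    short, owing to the factor of degree at least two.\<close>
  have "(\<Sum>E\<in>compositions n. weight E * real (length (deals fst E ys))) < (\<Sum>E\<in>compositions n. pmf Q E)"
  proof (rule sum_strict_mono_ex1[OF finite_compositions])
    show "\<forall>E\<in>compositions n. weight E * real (length (deals fst E ys)) \<le> pmf Q E"
    proof
      fix E assume "E \<in> compositions n"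
      then have "real (length (deals fst E ys)) \<le> multinomial n E"
        using length_deals_le[of ys fst E] pos Z(2)[OF ys(1)] by (simp add: compositions_def)
      then show "weight E * real (length (deals fst E ys)) \<le> pmf Q E"
        unfolding weight_mult[symmetric] by (intro mult_left_mono weight_nonneg)
    qed
    obtain d D where E: "0 < pmf Q (d # D)" "0 < d" "0 < sum_list D" using ex_proper_composition by blast
    then have Ec: "d # D \<in> compositions n" by (intro Q_pos_composition)
    have "real (length (deals fst (d # D) ys)) < multinomial (sum_list (d # D)) (d # D)"
      by (rule length_deals_less) (use pos Z[OF ys(1)] Ec E in \<open>auto simp: compositions_def\<close>)
    moreover have "0 < weight (d # D)"
      using E(1) multinomial_pos[of n "d # D"] by (simp add: weight_def)
    ultimately have "weight (d # D) * real (length (deals fst (d # D) ys)) < pmf Q (d # D)"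
      unfolding weight_mult[symmetric] using Ec by (intro mult_strict_left_mono) (auto simp: compositions_def)
    then show "\<exists>E\<in>compositions n. weight E * real (length (deals fst E ys)) < pmf Q E" using Ec by blast
  qed
  then have lt: "(\<Sum>E\<in>compositions n. weight E * real (length (deals fst E ys))) < 1" by (simp add: sum_Q)
  have "m = 0"
  proof (rule ccontr)
    assume "m \<noteq> 0"
    then have "0 < m" using ys(2) by simp
    then have "(\<Sum>E\<in>compositions n. weight E * real (length (deals fst E ys))) * m < 1 * m"
      using lt by (intro mult_strict_right_mono)
    with le show False by simp
  qed
  then show ?thesis using le_m[OF zsZ] by simp
qed

text \<open>The induction starts at \<open>Suc n\<close> factors, where the layer is zero, and ends
  at one factor, where it is all of \<open>H n\<close> because \<open>n\<close> is positive.\<close>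

lemma invariant_functional_zero:
  fixes \<phi> :: "'a \<Rightarrow> real"
  assumes lin: "linear \<phi>" and inv: "\<And>x. x \<in> H n \<Longrightarrow> \<phi> (T x) = \<phi> x"
    and sym: "\<And>cs. cs \<in> words n \<Longrightarrow> \<phi> (sym_prod cs) = 0" and x: "x \<in> H n"
  shows "\<phi> x = 0"
proof -
  have "\<forall>x\<in>aug_pow 1 n. \<phi> x = 0"
  proof (rule inc_induct[of 1 "Suc n"])
    show "\<forall>x\<in>aug_pow (Suc n) n. \<phi> x = 0" by (simp add: aug_pow_trivial linear_0[OF lin])
    fix k assume "1 \<le> k" "k < Suc n" and IH: "\<forall>x\<in>aug_pow (Suc k) n. \<phi> x = 0"
    show "\<forall>x\<in>aug_pow k n. \<phi> x = 0"
    proof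
      fix x assume "x \<in> aug_pow k n"
      then show "\<phi> x = 0"
        unfolding aug_pow_def
      proof (rule linear_eq_0_on_span[OF lin, rotated])
        fix y assume "y \<in> {fval zs |zs. factors zs \<and> fdeg zs = n \<and> k \<le> length zs}"
        then obtain zs where zs: "y = fval zs" "factors zs" "fdeg zs = n" "k \<le> length zs" by blast
        show "\<phi> y = 0"
        proof (cases "Suc k \<le> length zs")
          case True
          then show ?thesis using IH fval_aug_pow[OF zs(2) True] zs by simp
        next
          case False
          then have k: "length zs = k" using zs by simp
          show ?thesis
          proof (cases "\<exists>z\<in>set zs. 2 \<le> fst z")
            case True
            then show ?thesis
              unfolding zs(1) using invariant_functional_fval[OF lin inv _ zs(2,3)] IH k by blast
          next
            case False
            have one: "fst z = 1" if "z \<in> set zs" for z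
              using False that zs(2) by (force simp: factors_def)
            then have "zs = map (Pair 1) (map snd zs)"
              by (intro nth_equalityI) (auto simp: prod_eq_iff)
            then have "fdeg zs = length (map snd zs)" by (metis fdeg_Pair_1)
            moreover have "set (map snd zs) \<subseteq> B 1" using zs(2) one by (force simp: factors_def)
            ultimately have "map snd zs \<in> words n" using zs(3) by (simp add: words_def)
            then show ?thesis unfolding zs(1) using invariant_functional_prod_list[of \<phi> "map snd zs"] lin inv sym by blast
          qed
        qed
      qed
    qed
  qed (use n_pos in simp)
  then show ?thesis using H_in_aug_pow[OF n_pos] x by auto
qed

section \<open>The fixed space of \<open>T\<close>\<close>

lemma fixed_in_span_sym_prod:
  assumes v: "v \<in> H n" "T v = v"
  shows "v \<in> span (sym_prod ` words n)"
proof (rule kernel_subset_complement_of_range[of "\<lambda>x. x - T x" "B n" "H n"])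
  let ?Sp = "span (sym_prod ` words n)"
  show linE: "linear (\<lambda>x. x - T x)" by (intro linear_compose_sub linear_T module_hom_ident)
  show sub: "?Sp \<subseteq> H n" by (rule span_minimal[OF _ subspace_H]) (use sym_prod_in_H in auto)
  show "s - T s = 0" if "s \<in> ?Sp" for s
    using that by (rule linear_eq_0_on_span[OF linE, rotated]) (auto simp: T_sym_prod)
  \<comment> \<open>A functional vanishes on \<open>U\<close> exactly if it is
    \<open>T\<close>-invariant on \<open>H n\<close> and zero on the symmetrised products, so a
    vector of \<open>H n\<close> outside \<open>U\<close> could be separated by a functional already
    known to vanish.\<close>
  define U where "U = {s + (u - T u) | s u. s \<in> ?Sp \<and> u \<in> H n}"
  have "subspace U"
  proof (rule subspaceI)
    show "0 \<in> U"
      unfolding U_def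
      by (rule CollectI, rule exI[of _ 0], rule exI[of _ 0])
        (simp add: span_zero subspace_0[OF subspace_H] linear_0[OF linear_T])
    fix x y assume "x \<in> U" "y \<in> U"
    then obtain s u s' u' where "x = s + (u - T u)" "s \<in> ?Sp" "u \<in> H n"
      "y = s' + (u' - T u')" "s' \<in> ?Sp" "u' \<in> H n" unfolding U_def by blast
    then show "x + y \<in> U"
      unfolding U_def
      by - (rule CollectI, rule exI[of _ "s + s'"], rule exI[of _ "u + u'"],
        auto simp: linear_add[OF linear_T] span_add subspace_add[OF subspace_H])
  next
    fix c x assume "x \<in> U"
    then obtain s u where "x = s + (u - T u)" "s \<in> ?Sp" "u \<in> H n" unfolding U_def by blast
    then show "c *\<^sub>R x \<in> U"
      unfolding U_def
      by - (rule CollectI, rule exI[of _ "c *\<^sub>R s"], rule exI[of _ "c *\<^sub>R u"],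
        auto simp: linear_cmul[OF linear_T] span_scale subspace_scale[OF subspace_H] scaleR_add_right scaleR_diff_right)
  qed
  have "w \<in> U" if w: "w \<in> H n" for w
  proof (rule ccontr)
    assume "w \<notin> U"
    then obtain \<phi> :: "'a \<Rightarrow> real" where \<phi>: "linear \<phi>" "\<And>u. u \<in> U \<Longrightarrow> \<phi> u = 0" "\<phi> w \<noteq> 0"
      using separating_functional[OF \<open>subspace U\<close>] by metis
    have "\<phi> (T x) = \<phi> x" if "x \<in> H n" for x
    proof -
      have "x - T x \<in> U" unfolding U_def using that span_zero by force
      from \<phi>(2)[OF this] show ?thesis by (simp add: linear_diff[OF \<phi>(1)])
    qed
    moreover have "\<phi> (sym_prod cs) = 0" if "cs \<in> words n" for cs
    proof -
      have "sym_prod cs \<in> U"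
        unfolding U_def using that subspace_0[OF subspace_H] linear_0[OF linear_T]
        by (intro CollectI exI[of _ "sym_prod cs"] exI[of _ 0]) (auto intro: span_base)
      then show ?thesis by (rule \<phi>(2))
    qed
    ultimately have "\<phi> w = 0" using invariant_functional_zero[OF \<phi>(1) _ _ w] by blast
    with \<phi>(3) show False ..
  qed
  then show "\<exists>s\<in>?Sp. \<exists>u\<in>H n. w = s + (u - T u)" if "w \<in> H n" for w
    using that unfolding U_def by blast
qed (use v span_B finite_B subspace_span in auto)

section \<open>Stationary distributions\<close>

abbreviation K :: "'a \<Rightarrow> 'a \<Rightarrow> real" where
  "K \<equiv> transition_matrix \<Delta> \<epsilon> H B n P"

text \<open>The chain is the Doob transform of \<open>T\<close> by \<open>\<eta>\<close>: the
  denominators cancel, so multiplying coordinates by \<open>\<eta>\<close> carries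
  \<open>T v = v\<close> to the stationarity equation.\<close>

lemma doob_transform:
  assumes v: "v \<in> H n" and y: "y \<in> B n"
  shows "(\<Sum>x\<in>B n. (\<eta> x * basis_coeff B v x) * K x y) = \<eta> y * basis_coeff B (T v) y"
proof -
  have "(\<Sum>x\<in>B n. (\<eta> x * basis_coeff B v x) * K x y) =
      \<eta> y * (\<Sum>x\<in>B n. basis_coeff B v x * basis_coeff B (T x) y)"
    unfolding sum_distrib_left
  proof (rule sum.cong[OF refl])
    fix x assume "x \<in> B n"
    then show "\<eta> x * basis_coeff B v x * K x y = \<eta> y * (basis_coeff B v x * basis_coeff B (T x) y)"
      using eta_pos[of x] by (simp add: transition_matrix_def mDeltaP_eq_T[OF B_in_H])
  qed
  also have "(\<Sum>x\<in>B n. basis_coeff B v x * basis_coeff B (T x) y) =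
      basis_coeff B (T (\<Sum>x\<in>B n. basis_coeff B v x *\<^sub>R x)) y"
    by (simp add: linear_sum[OF linear_T] linear_cmul[OF linear_T] linear_sum[OF linear_basis_coeff]
        linear_cmul[OF linear_basis_coeff])
  finally show ?thesis by (simp add: basis_expansion[OF v])
qed

lemma pi_list_stationary:
  assumes cs: "cs \<in> words n" and nonneg: "\<And>x. x \<in> B n \<Longrightarrow> 0 \<le> pi_list \<Delta> \<epsilon> H B cs x"
  shows "stationary_distribution (B n) K (pi_list \<Delta> \<epsilon> H B cs)"
  unfolding stationary_distribution_def
proof (intro conjI ballI)
  fix y assume y: "y \<in> B n"
  have "(\<Sum>x\<in>B n. pi_list \<Delta> \<epsilon> H B cs x * K x y) =
      (\<Sum>x\<in>B n. (\<eta> x * basis_coeff B (sym_prod cs) x) * K x y) / (fact n)\<^sup>2"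
    by (simp add: pi_list_eq[OF cs] sum_divide_distrib)
  then show "(\<Sum>x\<in>B n. pi_list \<Delta> \<epsilon> H B cs x * K x y) = pi_list \<Delta> \<epsilon> H B cs y"
    by (simp add: doob_transform[OF sym_prod_in_H[OF cs] y] T_sym_prod[OF cs] pi_list_eq[OF cs])
qed (use nonneg sum_pi_list[OF cs] in auto)

definition msets :: "'a multiset set" where
  "msets = {M. size M = n \<and> set_mset M \<subseteq> B 1}"

definition word :: "'a multiset \<Rightarrow> 'a list" where
  "word M = (SOME cs. mset cs = M)"

lemma mset_word: "mset (word M) = M"
  unfolding word_def using ex_mset[of M] by (rule someI_ex)

lemma word_in_words: "M \<in> msets \<Longrightarrow> word M \<in> words n"
  using mset_word[of M] by (auto simp: words_def msets_def simp flip: size_mset set_mset_mset)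

lemma finite_msets: "finite msets"
proof (rule finite_subset)
  show "msets \<subseteq> mset ` words n"
    using word_in_words mset_word by (metis image_eqI subsetI)
qed (simp add: finite_words)

lemma pi_mset_eq:
  assumes "M \<in> msets"
  shows "pi_mset \<Delta> \<epsilon> H B M x = \<eta> x / (fact n)\<^sup>2 * basis_coeff B (sym_prod (word M)) x"
  using pi_list_eq[OF word_in_words[OF assms]] pi_mset_mset[of \<Delta> \<epsilon> H B "word M"] by (simp add: mset_word)

lemma sym_prod_word: "cs \<in> words n \<Longrightarrow> sym_prod cs = sym_prod (word (mset cs))"
  unfolding sym_prod_def by (rule permute_sum_mset_cong) (simp add: mset_word)

text \<open>Rearranged words have the same symmetrised product; one word per multiset removes the
  repetitions that would spoil uniqueness of coefficients.\<close>

lemma sym_prod_words: "sym_prod ` words n \<subseteq> (\<lambda>M. sym_prod (word M)) ` msets"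
proof clarify
  fix cs assume cs: "cs \<in> words n"
  then have "mset cs \<in> msets" by (auto simp: words_def msets_def)
  with sym_prod_word[OF cs] show "sym_prod cs \<in> (\<lambda>M. sym_prod (word M)) ` msets" by blast
qed

text \<open>Dual words evaluated after \<open>coprod (replicate n 1)\<close> give a diagonal system
  with positive diagonal.\<close>

lemma sym_prod_independent:
  assumes "(\<Sum>M\<in>msets. a M *\<^sub>R sym_prod (word M)) = 0" "M \<in> msets"
  shows "a M = 0"
proof -
  define f where "f x = word_dual (word M) (coprod (replicate n 1) x)" for x
  have lin: "linear f"
    using linear_compose[OF linear_coprod linear_word_dual] by (simp add: o_def f_def[abs_def])
  have "0 = f (\<Sum>M\<in>msets. a M *\<^sub>R sym_prod (word M))" using assms(1) linear_0[OF lin] by simp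
  also have "\<dots> = (\<Sum>N\<in>msets. a N * f (sym_prod (word N)))"
    by (simp add: linear_sum[OF lin] linear_cmul[OF lin])
  also have "\<dots> = a M * f (sym_prod (word M)) + (\<Sum>N\<in>msets - {M}. a N * f (sym_prod (word N)))"
    by (rule sum.remove[OF finite_msets assms(2)])
  also have "(\<Sum>N\<in>msets - {M}. a N * f (sym_prod (word N))) = 0"
    using word_dual_sym_prod(1)[OF word_in_words word_in_words[OF assms(2)]]
    by (intro sum.neutral) (auto simp: f_def mset_word)
  finally show ?thesis
    using word_dual_sym_prod(2)[OF word_in_words[OF assms(2)] word_in_words[OF assms(2)]] by (simp add: f_def)
qed

text \<open>Requiring \<open>a\<close> to vanish outside \<open>msets\<close> fixes the values that
  the sum does not read, so that uniqueness can be stated for functions on all multisets.\<close>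

lemma stationary_decomposition:
  assumes st: "stationary_distribution (B n) K \<pi>"
  shows "\<exists>!a. (\<forall>M. M \<notin> msets \<longrightarrow> a M = 0) \<and>
    (\<forall>x\<in>B n. \<pi> x = (\<Sum>M\<in>msets. a M * pi_mset \<Delta> \<epsilon> H B M x))"
proof -
  \<comment> \<open>Inverts the rescaling of \<open>doob_transform\<close>, so that stationarity of
    \<open>\<pi>\<close> makes \<open>v\<close> a fixed vector.\<close>
  define v where "v = (\<Sum>x\<in>B n. (\<pi> x / \<eta> x) *\<^sub>R x)"
  have vH: "v \<in> H n"
    unfolding v_def by (intro subspace_sum subspace_scale subspace_H B_in_H)
  have coeff: "basis_coeff B v x = \<pi> x / \<eta> x" if "x \<in> B n" for x
  proof -
    have "basis_coeff B v x = (\<Sum>y\<in>B n. \<pi> y / \<eta> y * (if x = y then 1 else 0))"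
      unfolding v_def linear_sum[OF linear_basis_coeff] linear_cmul[OF linear_basis_coeff] real_scaleR_def
      by (intro sum.cong refl) (simp add: basis_coeff_basis)
    then show ?thesis using that by (simp add: finite_B if_distrib cong: if_cong)
  qed
  then have pi: "\<eta> x * basis_coeff B v x = \<pi> x" if "x \<in> B n" for x
    using eta_pos[of x] that by simp
  have "basis_coeff B (T v) y = basis_coeff B v y" if "y \<in> B n" for y
  proof -
    have "\<eta> y * basis_coeff B (T v) y = (\<Sum>x\<in>B n. \<pi> x * K x y)"
      unfolding doob_transform[OF vH that, symmetric] by (intro sum.cong refl) (simp add: pi)
    also have "\<dots> = \<eta> y * basis_coeff B v y"
      using st that by (simp add: stationary_distribution_def pi)
    finally show ?thesis using eta_pos[OF that] by simp
  qed
  then have "T v = v"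
    using basis_expansion[OF vH] basis_expansion[OF T_in_H[OF vH]] by (metis (no_types, lifting) sum.cong)
  from fixed_in_span_sym_prod[OF vH this] have "v \<in> span ((\<lambda>M. sym_prod (word M)) ` msets)"
    using span_mono[OF sym_prod_words] by blast
  then obtain b where b: "v = (\<Sum>M\<in>msets. b M *\<^sub>R sym_prod (word M))"
    using span_image_sum[OF finite_msets] by metis
  have combo: "(\<Sum>M\<in>msets. a M * pi_mset \<Delta> \<epsilon> H B M x) =
      \<eta> x / (fact n)\<^sup>2 * basis_coeff B (\<Sum>M\<in>msets. a M *\<^sub>R sym_prod (word M)) x" for a x
    by (simp add: linear_sum[OF linear_basis_coeff] linear_cmul[OF linear_basis_coeff] sum_distrib_left
        pi_mset_eq mult.commute mult.left_commute)
  show ?thesis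
  proof (rule ex_ex1I)
    \<comment> \<open>The factor \<open>(fact n)\<^sup>2\<close> cancels the normalisation of
      \<open>pi_mset\<close>.\<close>
    have "\<pi> x = (\<Sum>M\<in>msets. (if M \<in> msets then b M * (fact n)\<^sup>2 else 0) * pi_mset \<Delta> \<epsilon> H B M x)"
      if "x \<in> B n" for x
    proof -
      have "(\<Sum>M\<in>msets. (if M \<in> msets then b M * (fact n)\<^sup>2 else 0) *\<^sub>R sym_prod (word M)) = (fact n)\<^sup>2 *\<^sub>R v"
        unfolding b scaleR_sum_right by (intro sum.cong refl) (simp add: mult.commute)
      then show ?thesis
        unfolding combo using pi[OF that] by (simp add: linear_cmul[OF linear_basis_coeff])
    qed
    then show "\<exists>a. (\<forall>M. M \<notin> msets \<longrightarrow> a M = 0) \<and>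
        (\<forall>x\<in>B n. \<pi> x = (\<Sum>M\<in>msets. a M * pi_mset \<Delta> \<epsilon> H B M x))"
      by (intro exI[of _ "\<lambda>M. if M \<in> msets then b M * (fact n)\<^sup>2 else 0"]) auto
  next
    fix a a'
    assume a: "(\<forall>M. M \<notin> msets \<longrightarrow> a M = 0) \<and> (\<forall>x\<in>B n. \<pi> x = (\<Sum>M\<in>msets. a M * pi_mset \<Delta> \<epsilon> H B M x))"
      and a': "(\<forall>M. M \<notin> msets \<longrightarrow> a' M = 0) \<and> (\<forall>x\<in>B n. \<pi> x = (\<Sum>M\<in>msets. a' M * pi_mset \<Delta> \<epsilon> H B M x))"
    define w where "w = (\<Sum>M\<in>msets. (a M - a' M) *\<^sub>R sym_prod (word M))"
    have wH: "w \<in> H n"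
      unfolding w_def by (intro subspace_sum subspace_scale subspace_H sym_prod_in_H word_in_words)
    have "basis_coeff B w x = 0" if "x \<in> B n" for x
    proof -
      have "\<eta> x / (fact n)\<^sup>2 * basis_coeff B w x = (\<Sum>M\<in>msets. (a M - a' M) * pi_mset \<Delta> \<epsilon> H B M x)"
        unfolding w_def by (rule combo[symmetric])
      also have "\<dots> = \<pi> x - \<pi> x"
        using a a' that by (simp add: left_diff_distrib sum_subtractf)
      finally show ?thesis using eta_pos[OF that] by simp
    qed
    then have "w = 0" using basis_expansion[OF wH] by simp
    then have "a M - a' M = 0" if "M \<in> msets" for M
      using sym_prod_independent[of "\<lambda>M. a M - a' M" M] that by (simp add: w_def)
    then show "a = a'" using a a' by (intro ext) (metis right_minus_eq)
  qed
qed

end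

theorem theorem3p11:
  fixes \<Delta> :: "'a::real_algebra_1 \<Rightarrow> 'a tensor"
    and \<epsilon> :: "'a \<Rightarrow> real"
    and S :: "'a \<Rightarrow> 'a"
    and H B :: "nat \<Rightarrow> 'a set"
    and n :: nat
    and P :: "nat list pmf"
  assumes "graded_connected_hopf_algebra \<Delta> \<epsilon> S H"
    and "\<forall>m. \<exists>T. finite T \<and> H m = span T"
    and "graded_basis H B"
    and "set_pmf P \<subseteq> weak_compositions n"
    and "state_space_basis_for \<Delta> \<epsilon> H B P"
    and "\<exists>D. 0 < pmf P D \<and> 2 \<le> card {i. i < length D \<and> D ! i \<noteq> 0}"
  shows "(\<forall>M. size M = n \<and> set_mset M \<subseteq> B 1 \<longrightarrow>
            (\<forall>x\<in>B n. 0 \<le> pi_mset \<Delta> \<epsilon> H B M x) \<longrightarrow>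
            stationary_distribution (B n) (transition_matrix \<Delta> \<epsilon> H B n P) (pi_mset \<Delta> \<epsilon> H B M)) \<and>
         (\<forall>\<pi>. stationary_distribution (B n) (transition_matrix \<Delta> \<epsilon> H B n P) \<pi> \<longrightarrow>
            (\<exists>!a :: 'a multiset \<Rightarrow> real.
               (\<forall>M. \<not> (size M = n \<and> set_mset M \<subseteq> B 1) \<longrightarrow> a M = 0) \<and>
               (\<forall>x\<in>B n. \<pi> x = (\<Sum>M | size M = n \<and> set_mset M \<subseteq> B 1. a M * pi_mset \<Delta> \<epsilon> H B M x))))"
proof -
  \<comment> \<open>\<open>state_space_basis_for\<close> speaks of lists of positive probability;
    the one with two non-zero parts supplies an instance.\<close>
  have "0 < eta \<Delta> \<epsilon> H B x" if "x \<in> B n" for x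
    using assms(5,6) that by (auto simp: state_space_basis_for_def state_space_basis_def)
  then interpret hopf_chain \<Delta> \<epsilon> S H B n P
    using assms by (simp add: hopf_chain_def hopf_chain_axioms_def graded_hopf_basis_def graded_hopf_basis_axioms_def)
  show ?thesis
  proof (intro conjI allI impI)
    fix M assume M: "size M = n \<and> set_mset M \<subseteq> B 1" and nonneg: "\<forall>x\<in>B n. 0 \<le> pi_mset \<Delta> \<epsilon> H B M x"
    have "pi_mset \<Delta> \<epsilon> H B M = pi_list \<Delta> \<epsilon> H B (word M)"
      using pi_mset_mset[of \<Delta> \<epsilon> H B "word M"] by (simp add: mset_word)
    then show "stationary_distribution (B n) K (pi_mset \<Delta> \<epsilon> H B M)"
      using pi_list_stationary[OF word_in_words[of M]] M nonneg by (simp add: msets_def)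
  next
    fix \<pi> assume "stationary_distribution (B n) K \<pi>"
    from stationary_decomposition[OF this]
    show "\<exists>!a. (\<forall>M. \<not> (size M = n \<and> set_mset M \<subseteq> B 1) \<longrightarrow> a M = 0) \<and>
      (\<forall>x\<in>B n. \<pi> x = (\<Sum>M | size M = n \<and> set_mset M \<subseteq> B 1. a M * pi_mset \<Delta> \<epsilon> H B M x))"
      by (simp only: msets_def mem_Collect_eq)
  qed
qed

end
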